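(* (a) Let $(M,L)$ be a Lagrange space and $$2\,{}^{L}G^i=\tfrac12\,{}^{L}g^{ij}\Big(\frac{\partial^2L}{\partial y^j\partial x^k}y^k-\frac{\partial L}{\partial x^j}\Big).$$ The coefficients ${}^{L}G^i(x,y)$ define the solutions of both the Euler–Lagrange equations $\frac{d}{dt}\big(\frac{\partial L}{\partial y^i}\big)-\frac{\partial L}{\partial x^i}=0$, $y^i=\dot x^i$, and the nonlinear geodesic equations $\frac{dy^i}{dt}+2\,{}^{L}G^i(x,y)=0$, $y^i=\dot x^i$, as paths of the canonical semispray $$\xi_L=y^i\frac{\partial}{\partial x^i}-2\,{}^{L}G^i\frac{\partial}{\partial y^i},$$ and they define the canonical N-connection structure on the Lagrange space, with coefficients $${}^{L}N^i_j=\frac{\partial\,{}^{L}G^i}{\partial y^j}.$$ (b) Let $(E,l)$ be a Lagrange algebroid and $$2\,{}^{l}G^a=\tfrac12\,{}^{l}g^{ab}\Big(\frac{\partial^2l}{\partial u^b\partial x^i}\rho^i_cu^c+C^e_{bc}u^c\frac{\partial l}{\partial u^e}-\rho^i_b\frac{\partial l}{\partial x^i}\Big).$$ The coefficients ${}^{l}G^a(x,u)$ define the solutions of both the Euler–Lagrange equations $\frac{d}{dt}\big(\frac{\partial l}{\partial u^a}\big)-\rho^i_a\frac{\partial l}{\partial x^i}+C^e_{ab}u^b\frac{\partial l}{\partial u^e}=0$, $\dot x^i=\rho^i_bu^b$, and the nonlinear geodesic equations $\frac{du^a}{dt}+2\,{}^{l}G^a(x,u)=0$, $\dot x^i=\rho^i_bu^b$,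 as paths of the canonical semispray $$\xi_l=u^a\rho^i_a\frac{\partial}{\partial x^i}-2\,{}^{l}G^a\frac{\partial}{\partial u^a},$$ and they define the canonical N-connection structure on the Lagrange algebroid, that is, a global Whitney sum decomposition $\mathcal L^{\pi}E=h\,\mathcal L^{\pi}E\oplus v\,\mathcal L^{\pi}E$ determined by $l$, with coefficients $${}^{l}N^a_b=\frac{\partial\,{}^{l}G^a}{\partial u^b}.$$
   Context: Summation over repeated indices. $M$ is an $n$-manifold with local coordinates $x^i$; $TM$ has coordinates $(x^i,y^i)$ and $\widetilde{TM}$ is $TM$ minus the zero section. A Lagrange space is a pair $(M,L)$ with $L:TM\to\mathbb R$ a regular Lagrangian: ${}^{L}g_{ij}=\frac12\frac{\partial^2L}{\partial y^i\partial y^j}$ is nondegenerate and of constant signature on $\widetilde{TM}$, with inverse ${}^{L}g^{ij}$. An N-connection on the Lagrange space is a global Whitney sum splitting $TTM=hTM\oplus vTM$ (over $\widetilde{TM}$), where $vTM$ is the vertical distribution, spanned by $\partial/\partial y^i$; it has coefficients $N^i_j$ if $hTM$ is locally spanned by $\frac{\partial}{\partial x^j}-N^i_j\frac{\partial}{\partial y^i}$. The word "canonical" means defined by the Lagrangian. Paths of a semispray are its integral curves. $\pi:E\to M$ is a vector bundle of rank $m$ with a Lie algebroid structure: a Lie bracket $[\cdot,\cdot]$ on sections of $E$ and an anchor $\rho:E\to TM$ with $[X,fY]=f[X,Y]+\rho(X)(f)Y$. For a local basis $v_a$ of sections of $E$, with fibre coordinates $u^a$, the structure functions are given by $\rho(v_a)=\rho^i_a(x)\partial/\partial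 x^i$ and $[v_a,v_b]=C^c_{ab}(x)v_c$. A Lagrange algebroid is a pair $(E,l)$ with $l:E\to\mathbb R$ a regular Lagrangian: ${}^{l}g_{ab}=\frac12\frac{\partial^2l}{\partial u^a\partial u^b}$ is nondegenerate and of constant signature on $\widetilde E$ ($E$ minus the zero section), with inverse ${}^{l}g^{ab}$. The prolongation of $E$ is $\mathcal L^{\pi}E=\{(b,z)\in E\times TE:\rho(b)=T\pi(z)\}$, a vector bundle of rank $2m$ over $E$ via $(b,z)\mapsto\tau_E(z)$ ($\tau_E:TE\to E$ the tangent projection), and a Lie algebroid with anchor $(b,z)\mapsto z$. The local basis $v_a$ induces a local basis $(\widetilde z_a,\widetilde v_a)$ of sections of $\mathcal L^\pi E$ with anchors $\rho_a^i\partial/\partial x^i$ and $\partial/\partial u^a$ respectively and brackets $[\widetilde z_a,\widetilde z_b]=C_{ab}^e\widetilde z_e$, $[\widetilde z_a,\widetilde v_b]=0$, $[\widetilde v_a,\widetilde v_b]=0$. The vertical subbundle $v\mathcal L^\pi E$ (elements $(0,z)$) is locally spanned by the $\widetilde v_a$. An N-connection on $\mathcal L^\pi E$ is a Whitney sum splitting $\mathcal L^\pi E=h\mathcal L^\pi E\oplus v\mathcal L^\pi E$ (here over $\widetilde E$); it has coefficients $N^b_a(x,u)$ if $h\mathcal L^\pi E$ is locally spanned by $\widetilde z_a-N^b_a\widetilde v_b$. The displayed vector field $\xi_l$ on $E$ is the image under the anchor of $\mathcal L^\pi E$ of the section $u^a\widetilde z_a-2\,{}^{l}G^a\widetilde 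v_a$.
   Formalization: In (b), the splittings with coefficients ∂G^a/∂u^b differ between local bases in general, so these are claimed only over the domain of each local basis; the global splitting determined by l is stated with coefficients ∂G^a/∂u^b + ½ C^a_{bd} u^d. *)

theory Defs
  imports "HOL-Analysis.Analysis" "HOL-Library.Function_Algebras"
begin

section \<open>Smooth maps between open subsets of Euclidean spaces\<close>

text \<open>Meaningful for open \<open>S\<close> only, as the derivatives are two-sided.\<close>

primrec Ck_on :: "nat \<Rightarrow> 'a::euclidean_space set \<Rightarrow> ('a \<Rightarrow> 'b::euclidean_space) \<Rightarrow> bool" where
  "Ck_on 0 S f \<longleftrightarrow> continuous_on S f"
| "Ck_on (Suc k) S f \<longleftrightarrow> (\<forall>x\<in>S. f differentiable (at x)) \<and>
      (\<forall>v. Ck_on k S (\<lambda>x. frechet_derivative f (at x) v))"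

definition smooth_on :: "'a::euclidean_space set \<Rightarrow> ('a \<Rightarrow> 'b::euclidean_space) \<Rightarrow> bool" where
  "smooth_on S f \<longleftrightarrow> (\<forall>k. Ck_on k S f)"


section \<open>Manifolds given by an atlas\<close>

text \<open>A chart is a pair of its domain and its coordinate map. An atlas need not be maximal: a
  statement about all charts of an arbitrary atlas includes the case of the maximal one.\<close>

type_synonym ('p, 'x) chart = "'p set \<times> ('p \<Rightarrow> 'x)"

abbreviation cdom :: "('p, 'x) chart \<Rightarrow> 'p set" where "cdom \<equiv> fst"
abbreviation cmap :: "('p, 'x) chart \<Rightarrow> 'p \<Rightarrow> 'x" where "cmap \<equiv> snd"

definition cinv :: "('p, 'x) chart \<Rightarrow> 'x \<Rightarrow> 'p" where
  "cinv c = inv_into (cdom c) (cmap c)"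

definition carrier_of :: "('p, 'x) chart set \<Rightarrow> 'p set" where
  "carrier_of A = (\<Union>c\<in>A. cdom c)"

definition smooth_atlas :: "('p, 'x::euclidean_space) chart set \<Rightarrow> bool" where
  "smooth_atlas A \<longleftrightarrow>
     (\<forall>c\<in>A. inj_on (cmap c) (cdom c) \<and> open (cmap c ` cdom c)) \<and>
     (\<forall>c\<in>A. \<forall>d\<in>A. open (cmap c ` (cdom c \<inter> cdom d)) \<and>
        smooth_on (cmap c ` (cdom c \<inter> cdom d)) (cmap d \<circ> cinv c))"

definition mopen :: "('p, 'x::euclidean_space) chart set \<Rightarrow> 'p set \<Rightarrow> bool" where
  "mopen A S \<longleftrightarrow> S \<subseteq> carrier_of A \<and> (\<forall>c\<in>A. open (cmap c ` (S \<inter> cdom c)))"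

definition atlas_topology :: "('p, 'x::euclidean_space) chart set \<Rightarrow> 'p topology" where
  "atlas_topology A = topology (mopen A)"

lemma openin_atlas_topology:
  assumes "smooth_atlas A"
  shows "openin (atlas_topology A) S \<longleftrightarrow> mopen A S"
proof -
  have "istopology (mopen A)"
    unfolding istopology_def
  proof (intro conjI allI impI)
    fix S T assume S: "mopen A S" and T: "mopen A T"
    have "cmap c ` (S \<inter> T \<inter> cdom c) = cmap c ` (S \<inter> cdom c) \<inter> cmap c ` (T \<inter> cdom c)"
      if "c \<in> A" for c
    proof -
      have "inj_on (cmap c) (cdom c)" using assms that by (simp add: smooth_atlas_def)
      then have "cmap c ` ((S \<inter> cdom c) \<inter> (T \<inter> cdom c)) = cmap c ` (S \<inter> cdom c) \<inter> cmap c ` (T \<inter> cdom c)"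
        by (intro inj_on_image_Int[of _ "cdom c"]) auto
      moreover have "(S \<inter> cdom c) \<inter> (T \<inter> cdom c) = S \<inter> T \<inter> cdom c" by auto
      ultimately show ?thesis by simp
    qed
    then show "mopen A (S \<inter> T)" using S T by (auto simp: mopen_def)
  next
    fix K assume K: "\<forall>S\<in>K. mopen A S"
    have im: "cmap c ` (\<Union>K \<inter> cdom c) = (\<Union>S\<in>K. cmap c ` (S \<inter> cdom c))" for c :: "('a, 'b) chart"
      by auto
    show "mopen A (\<Union>K)"
      unfolding mopen_def
    proof (intro conjI ballI)
      show "\<Union>K \<subseteq> carrier_of A" using K by (auto simp: mopen_def)
      fix c assume "c \<in> A"
      then have "open (\<Union>S\<in>K. cmap c ` (S \<inter> cdom c))"
        using K by (intro open_UN) (auto simp: mopen_def)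
      then show "open (cmap c ` (\<Union>K \<inter> cdom c))" by (simp only: im)
    qed
  qed
  then show ?thesis by (simp add: atlas_topology_def topology_inverse')
qed

definition smooth_manifold :: "('p, 'x::euclidean_space) chart set \<Rightarrow> bool" where
  "smooth_manifold A \<longleftrightarrow> smooth_atlas A \<and>
     Hausdorff_space (atlas_topology A) \<and> second_countable (atlas_topology A)"

text \<open>Smoothness on the open set \<open>S\<close> of the manifold.\<close>

definition smooth_fun ::
  "('p, 'x::euclidean_space) chart set \<Rightarrow> 'p set \<Rightarrow> ('p \<Rightarrow> 'b::euclidean_space) \<Rightarrow> bool" where
  "smooth_fun A S g \<longleftrightarrow> (\<forall>c\<in>A. smooth_on (cmap c ` (S \<inter> cdom c)) (g \<circ> cinv c))"


section \<open>Tangent vectors\<close>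

instantiation "fun" :: (type, real_vector) real_vector
begin

definition scaleR_fun :: "real \<Rightarrow> ('a \<Rightarrow> 'b) \<Rightarrow> 'a \<Rightarrow> 'b" where
  "scaleR_fun r f = (\<lambda>x. r *\<^sub>R f x)"

instance
  by standard (auto simp: scaleR_fun_def plus_fun_def fun_eq_iff algebra_simps)

end

text \<open>A tangent vector at \<open>p\<close> is the family of its components in all charts around \<open>p\<close>,
  transforming with the Jacobian of the coordinate change (and \<open>0\<close> in all other charts). The
  vector space operations are the pointwise ones.\<close>

type_synonym ('p, 'x) tvec = "('p, 'x) chart \<Rightarrow> 'x"

definition tangent :: "('p, 'x::euclidean_space) chart set \<Rightarrow> 'p \<Rightarrow> ('p, 'x) tvec set" where
  "tangent A p = {v.
     (\<forall>c. c \<notin> A \<or> p \<notin> cdom c \<longrightarrow> v c = 0) \<and>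
     (\<forall>c\<in>A. \<forall>d\<in>A. p \<in> cdom c \<and> p \<in> cdom d \<longrightarrow>
        v d = frechet_derivative (cmap d \<circ> cinv c) (at (cmap c p)) (v c))}"

text \<open>The tangent vector at \<open>p\<close> with components \<open>w\<close> in the chart \<open>c\<close>.\<close>

definition coord_vec :: "('p, 'x::euclidean_space) chart set \<Rightarrow> ('p, 'x) chart \<Rightarrow> 'p \<Rightarrow> 'x \<Rightarrow> ('p, 'x) tvec"
  where
  "coord_vec A c p w = (\<lambda>d. if d \<in> A \<and> p \<in> cdom d
      then frechet_derivative (cmap d \<circ> cinv c) (at (cmap c p)) w else 0)"

text \<open>The derivative \<open>v(f)\<close> of a function \<open>f\<close> along \<open>v \<in> tangent A p\<close>.\<close>

definition tangent_deriv ::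
  "('p, 'x::euclidean_space) chart set \<Rightarrow> ('p \<Rightarrow> real) \<Rightarrow> 'p \<Rightarrow> ('p, 'x) tvec \<Rightarrow> real" where
  "tangent_deriv A f p v = (THE r. \<forall>c\<in>A. p \<in> cdom c \<longrightarrow>
      r = frechet_derivative (f \<circ> cinv c) (at (cmap c p)) (v c))"

text \<open>The tangent map \<open>T\<Phi>\<close> of \<open>\<Phi>\<close>, on pairs (base point, tangent vector).\<close>

definition tangent_map ::
  "('p, 'x::euclidean_space) chart set \<Rightarrow> ('q, 'y::euclidean_space) chart set \<Rightarrow> ('p \<Rightarrow> 'q) \<Rightarrow>
   'p \<times> ('p, 'x) tvec \<Rightarrow> 'q \<times> ('q, 'y) tvec" where
  "tangent_map A B \<Phi> z = (\<Phi> (fst z), \<lambda>d. if d \<in> B \<and> \<Phi> (fst z) \<in> cdom d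
      then (THE w. \<forall>c\<in>A. fst z \<in> cdom c \<longrightarrow>
              w = frechet_derivative (cmap d \<circ> \<Phi> \<circ> cinv c) (at (cmap c (fst z))) (snd z c))
      else 0)"

definition smooth_vector_field ::
  "('p, 'x::euclidean_space) chart set \<Rightarrow> 'p set \<Rightarrow> ('p \<Rightarrow> ('p, 'x) tvec) \<Rightarrow> bool" where
  "smooth_vector_field A W \<xi> \<longleftrightarrow> (\<forall>p\<in>W. \<xi> p \<in> tangent A p) \<and>
     (\<forall>c\<in>A. smooth_fun A (W \<inter> cdom c) (\<lambda>p. \<xi> p c))"

text \<open>The curve \<open>\<gamma>\<close> has velocity \<open>v\<close> at time \<open>t\<close>; the first conjunct is continuity at \<open>t\<close>.\<close>

definition has_velocity ::
  "('p, 'x::euclidean_space) chart set \<Rightarrow> (real \<Rightarrow> 'p) \<Rightarrow> real \<Rightarrow> ('p, 'x) tvec \<Rightarrow> bool" where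
  "has_velocity A \<gamma> t v \<longleftrightarrow> (\<forall>c\<in>A. \<gamma> t \<in> cdom c \<longrightarrow>
     (\<forall>\<^sub>F s in at t. \<gamma> s \<in> cdom c) \<and> ((cmap c \<circ> \<gamma>) has_vector_derivative v c) (at t))"

definition differentiable_curve ::
  "('p, 'x::euclidean_space) chart set \<Rightarrow> 'p set \<Rightarrow> real set \<Rightarrow> (real \<Rightarrow> 'p) \<Rightarrow> bool" where
  "differentiable_curve A W I \<gamma> \<longleftrightarrow>
     (\<forall>t\<in>I. \<gamma> t \<in> W \<and> (\<exists>v\<in>tangent A (\<gamma> t). has_velocity A \<gamma> t v))"

definition integral_curve ::
  "('p, 'x::euclidean_space) chart set \<Rightarrow> ('p \<Rightarrow> ('p, 'x) tvec) \<Rightarrow> real set \<Rightarrow> (real \<Rightarrow> 'p) \<Rightarrow> bool" where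
  "integral_curve A \<xi> I \<gamma> \<longleftrightarrow> (\<forall>t\<in>I. has_velocity A \<gamma> t (\<xi> (\<gamma> t)))"


section \<open>Vector bundles\<close>

text \<open>The fibres of a vector bundle are subspaces \<open>F p\<close> of one ambient real vector space (which
  carries no further structure), and the total space is the set of the pairs \<open>(p, f)\<close> with
  \<open>f \<in> F p\<close>. A trivialization is a pair of its domain and the fibre coordinates
  \<open>p \<mapsto> (f \<mapsto> (u\<^sup>a))\<close>; it is the same as a local basis of sections.\<close>

type_synonym ('p, 'f, 'm) triv = "'p set \<times> ('p \<Rightarrow> 'f \<Rightarrow> (real^'m))"

text \<open>The section with constant fibre coordinates \<open>w\<close>, and the local basis \<open>v\<^sub>a\<close>.\<close>

definition triv_section :: "('p \<Rightarrow> 'f set) \<Rightarrow> ('p, 'f, 'm::finite) triv \<Rightarrow> (real^'m) \<Rightarrow> 'p \<Rightarrow> 'f" where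
  "triv_section F t w p = inv_into (F p) (snd t p) w"

definition basis_section :: "('p \<Rightarrow> 'f set) \<Rightarrow> ('p, 'f, 'm::finite) triv \<Rightarrow> 'm \<Rightarrow> 'p \<Rightarrow> 'f" where
  "basis_section F t a = triv_section F t (axis a 1)"

definition vector_bundle ::
  "('p, 'x::euclidean_space) chart set \<Rightarrow> ('p \<Rightarrow> 'f::real_vector set) \<Rightarrow> ('p, 'f, 'm::finite) triv set \<Rightarrow> bool"
  where
  "vector_bundle A F T \<longleftrightarrow>
     (\<forall>p\<in>carrier_of A. subspace (F p)) \<and>
     carrier_of A = (\<Union>t\<in>T. fst t) \<and>
     (\<forall>t\<in>T. mopen A (fst t) \<and> (\<forall>p\<in>fst t. bij_betw (snd t p) (F p) UNIV \<and>
        (\<forall>f\<in>F p. \<forall>g\<in>F p. \<forall>r. snd t p (f + g) = snd t p f + snd t p g \<and>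
           snd t p (r *\<^sub>R f) = r *\<^sub>R snd t p f))) \<and>
     (\<forall>t\<in>T. \<forall>t'\<in>T. \<forall>w. smooth_fun A (fst t \<inter> fst t') (\<lambda>p. snd t' p (triv_section F t w p)))"

definition smooth_section ::
  "('p, 'x::euclidean_space) chart set \<Rightarrow> ('p \<Rightarrow> 'f::real_vector set) \<Rightarrow> ('p, 'f, 'm::finite) triv set \<Rightarrow>
   'p set \<Rightarrow> ('p \<Rightarrow> 'f) \<Rightarrow> bool" where
  "smooth_section A F T W X \<longleftrightarrow> (\<forall>p\<in>W. X p \<in> F p) \<and>
     (\<forall>t\<in>T. smooth_fun A (W \<inter> fst t) (\<lambda>p. snd t p (X p)))"

text \<open>The local coordinates \<open>(x\<^sup>i, u\<^sup>a)\<close> on the total space.\<close>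

definition bundle_chart ::
  "('p \<Rightarrow> 'f set) \<Rightarrow> ('p, 'x) chart \<Rightarrow> ('p, 'f, 'm::finite) triv \<Rightarrow> ('p \<times> 'f, 'x \<times> (real^'m)) chart" where
  "bundle_chart F c t = (Sigma (cdom c \<inter> fst t) F, \<lambda>e. (cmap c (fst e), snd t (fst e) (snd e)))"

text \<open>The total space without the zero section.\<close>

definition slit :: "('p, 'x) chart set \<Rightarrow> ('p \<Rightarrow> 'f::zero set) \<Rightarrow> ('p \<times> 'f) set" where
  "slit A F = {e. fst e \<in> carrier_of A \<and> snd e \<in> F (fst e) \<and> snd e \<noteq> 0}"

text \<open>The coordinates \<open>(x\<^sup>i, y\<^sup>i)\<close> on \<open>TM\<close> induced by coordinates \<open>x\<^sup>i\<close> on \<open>M\<close>, where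
  \<open>n = CARD('n)\<close>.\<close>

definition tm_chart :: "('p, (real^'n)) chart set \<Rightarrow> ('p, (real^'n)) chart \<Rightarrow>
    ('p \<times> ('p, (real^'n::finite)) tvec, (real^'n) \<times> (real^'n)) chart" where
  "tm_chart A c = bundle_chart (tangent A) c (cdom c, \<lambda>p v. v c)"

definition tm_atlas :: "('p, (real^'n)) chart set \<Rightarrow>
    ('p \<times> ('p, (real^'n::finite)) tvec, (real^'n) \<times> (real^'n)) chart set" where
  "tm_atlas A = tm_chart A ` A"


section \<open>Whitney sum splittings\<close>

text \<open>\<open>B\<close> is the atlas of the base, \<open>Q e\<close> and \<open>V e\<close> are the fibres at \<open>e\<close> of a vector bundle
  and of its vertical subbundle, and \<open>smooth W' s\<close> says that \<open>s\<close> is a smooth section over \<open>W'\<close>.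
  \<open>H\<close> is the total space of a subbundle over \<open>W\<close>, with fibres \<open>H `` {e}\<close>; the last conjunct says
  that it has smooth local frames.\<close>

definition whitney_splitting ::
  "('e, 'x::euclidean_space) chart set \<Rightarrow> 'e set \<Rightarrow> ('e \<Rightarrow> 'v::real_vector set) \<Rightarrow> ('e \<Rightarrow> 'v set) \<Rightarrow>
   ('e set \<Rightarrow> ('e \<Rightarrow> 'v) \<Rightarrow> bool) \<Rightarrow> ('e \<times> 'v) set \<Rightarrow> bool" where
  "whitney_splitting B W Q V smooth H \<longleftrightarrow>
     H \<subseteq> Sigma W Q \<and>
     (\<forall>e\<in>W. subspace (H `` {e}) \<and> H `` {e} \<inter> V e = {0} \<and>
        Q e = {h + v | h v. h \<in> H `` {e} \<and> v \<in> V e}) \<and>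
     (\<forall>e\<in>W. \<exists>W' S. e \<in> W' \<and> W' \<subseteq> W \<and> mopen B W' \<and> finite S \<and> (\<forall>s\<in>S. smooth W' s) \<and>
        (\<forall>e'\<in>W'. inj_on (\<lambda>s. s e') S \<and> independent ((\<lambda>s. s e') ` S) \<and>
           span ((\<lambda>s. s e') ` S) = H `` {e'}))"


section \<open>Lagrangians in local coordinates \<open>(x\<^sup>i, u\<^sup>a)\<close>\<close>

definition pd_x :: "((real^'n) \<times> (real^'m) \<Rightarrow> real) \<Rightarrow> 'n \<Rightarrow> (real^'n::finite) \<times> (real^'m::finite) \<Rightarrow> real" where
  "pd_x f i z = frechet_derivative f (at z) (axis i 1, 0)"

definition pd_u :: "((real^'n) \<times> (real^'m) \<Rightarrow> real) \<Rightarrow> 'm \<Rightarrow> (real^'n::finite) \<times> (real^'m::finite) \<Rightarrow> real" where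
  "pd_u f a z = frechet_derivative f (at z) (0, axis a 1)"

text \<open>The coordinate vector fields \<open>\<partial>/\<partial>x\<^sup>i\<close> and \<open>\<partial>/\<partial>u\<^sup>a\<close> of the chart \<open>C\<close>.\<close>

definition vec_x :: "('e, (real^'n) \<times> (real^'m)) chart set \<Rightarrow> ('e, (real^'n) \<times> (real^'m)) chart \<Rightarrow> 'e \<Rightarrow> 'n \<Rightarrow>
    ('e, (real^'n::finite) \<times> (real^'m::finite)) tvec" where
  "vec_x B C e i = coord_vec B C e (axis i 1, 0)"

definition vec_u :: "('e, (real^'n) \<times> (real^'m)) chart set \<Rightarrow> ('e, (real^'n) \<times> (real^'m)) chart \<Rightarrow> 'e \<Rightarrow> 'm \<Rightarrow>
    ('e, (real^'n::finite) \<times> (real^'m::finite)) tvec" where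
  "vec_u B C e a = coord_vec B C e (0, axis a 1)"

text \<open>\<open>g\<^sub>a\<^sub>b = 1/2 \<partial>\<^sup>2l/\<partial>u\<^sup>a\<partial>u\<^sup>b\<close>.\<close>

definition fibre_metric :: "((real^'n) \<times> (real^'m) \<Rightarrow> real) \<Rightarrow> (real^'n::finite) \<times> (real^'m::finite) \<Rightarrow> (real^'m)^'m" where
  "fibre_metric f z = (\<chi> a b. 1/2 * pd_u (pd_u f b) a z)"

text \<open>The pair of the positive and the negative index of inertia of a symmetric matrix.\<close>

definition signature :: "(real^'m)^'m \<Rightarrow> nat \<times> nat" where
  "signature g =
     (Max {dim V | V. subspace V \<and> (\<forall>v\<in>V - {0}. v \<bullet> (g *v v) > 0)},
      Max {dim V | V. subspace V \<and> (\<forall>v\<in>V - {0}. v \<bullet> (g *v v) < 0)})"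

definition local_rep :: "('e \<Rightarrow> real) \<Rightarrow> ('e, 'x) chart \<Rightarrow> 'x \<Rightarrow> real" where
  "local_rep l C = l \<circ> cinv C"

text \<open>Nothing is required of \<open>l\<close> on the zero section, i.e. outside of \<open>W\<close>.\<close>

definition regular_lagrangian ::
  "('e, (real^'n::finite) \<times> (real^'m::finite)) chart set \<Rightarrow> 'e set \<Rightarrow> ('e \<Rightarrow> real) \<Rightarrow> bool" where
  "regular_lagrangian B W l \<longleftrightarrow> smooth_fun B W l \<and>
     (\<forall>C\<in>B. \<forall>e\<in>W \<inter> cdom C. invertible (fibre_metric (local_rep l C) (cmap C e))) \<and>
     (\<exists>\<sigma>. \<forall>C\<in>B. \<forall>e\<in>W \<inter> cdom C. signature (fibre_metric (local_rep l C) (cmap C e)) = \<sigma>)"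


section \<open>Lagrange spaces\<close>

definition lagrange_space ::
  "('p, (real^'n::finite)) chart set \<Rightarrow> ('p \<times> ('p, (real^'n)) tvec \<Rightarrow> real) \<Rightarrow> bool" where
  "lagrange_space A L \<longleftrightarrow> smooth_manifold A \<and>
     regular_lagrangian (tm_atlas A) (slit A (tangent A)) L"

text \<open>The coefficients \<open>G\<^sup>i\<close> (not \<open>2G\<^sup>i\<close>) as functions of \<open>z = (x, y)\<close>.\<close>

definition lagrange_G :: "((real^'n) \<times> (real^'n) \<Rightarrow> real) \<Rightarrow> (real^'n) \<times> (real^'n) \<Rightarrow> 'n::finite \<Rightarrow> real" where
  "lagrange_G f z i = 1/2 * (1/2 * (\<Sum>j\<in>UNIV. matrix_inv (fibre_metric f z) $ i $ j *
      ((\<Sum>k\<in>UNIV. pd_u (pd_x f k) j z * snd z $ k) - pd_x f j z)))"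

definition lagrange_N :: "((real^'n) \<times> (real^'n) \<Rightarrow> real) \<Rightarrow> (real^'n) \<times> (real^'n) \<Rightarrow> 'n::finite \<Rightarrow> 'n \<Rightarrow> real" where
  "lagrange_N f z i j = pd_u (\<lambda>w. lagrange_G f w i) j z"

definition tm_projection :: "'p \<times> ('p, 'x) tvec \<Rightarrow> 'p" where
  "tm_projection = fst"

text \<open>A semispray is a smooth section \<open>\<xi>\<close> of \<open>TTM\<close> over \<open>TM\<close> minus the zero section with
  \<open>T\<tau> \<circ> \<xi> = id\<close>, where \<open>\<tau>\<close> is the projection of \<open>TM\<close>.\<close>

definition tm_semispray :: "('p, (real^'n::finite)) chart set \<Rightarrow>
    ('p \<times> ('p, (real^'n)) tvec \<Rightarrow> ('p \<times> ('p, (real^'n)) tvec, (real^'n) \<times> (real^'n)) tvec) \<Rightarrow> bool" where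
  "tm_semispray A \<xi> \<longleftrightarrow> smooth_vector_field (tm_atlas A) (slit A (tangent A)) \<xi> \<and>
     (\<forall>e\<in>slit A (tangent A). tangent_map (tm_atlas A) A tm_projection (e, \<xi> e) = e)"

text \<open>\<open>\<xi>\<^sub>L = y\<^sup>i \<partial>/\<partial>x\<^sup>i - 2 G\<^sup>i \<partial>/\<partial>y\<^sup>i\<close> in all induced coordinates.\<close>

definition is_xi_L :: "('p, (real^'n::finite)) chart set \<Rightarrow> ('p \<times> ('p, (real^'n)) tvec \<Rightarrow> real) \<Rightarrow>
    ('p \<times> ('p, (real^'n)) tvec \<Rightarrow> ('p \<times> ('p, (real^'n)) tvec, (real^'n) \<times> (real^'n)) tvec) \<Rightarrow> bool" where
  "is_xi_L A L \<xi> \<longleftrightarrow> (\<forall>C\<in>tm_atlas A. \<forall>e\<in>slit A (tangent A) \<inter> cdom C.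
     \<xi> e = (\<Sum>i\<in>UNIV. snd (cmap C e) $ i *\<^sub>R vec_x (tm_atlas A) C e i)
         - (\<Sum>i\<in>UNIV. (2 * lagrange_G (local_rep L C) (cmap C e) i) *\<^sub>R vec_u (tm_atlas A) C e i))"

text \<open>In the next two definitions the curve \<open>\<gamma>\<close> runs in \<open>TM\<close> minus the zero section.\<close>

definition euler_lagrange_tm ::
  "('p, (real^'n::finite)) chart set \<Rightarrow> ('p \<times> ('p, (real^'n)) tvec \<Rightarrow> real) \<Rightarrow>
   real set \<Rightarrow> (real \<Rightarrow> 'p \<times> ('p, (real^'n)) tvec) \<Rightarrow> bool" where
  "euler_lagrange_tm A L I \<gamma> \<longleftrightarrow> (\<forall>t\<in>I. \<forall>C\<in>tm_atlas A. \<gamma> t \<in> cdom C \<longrightarrow>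
     (let f = local_rep L C; z = (\<lambda>s. cmap C (\<gamma> s)) in
      ((\<lambda>s. fst (z s)) has_vector_derivative snd (z t)) (at t) \<and>
      (\<forall>i. \<exists>d. ((\<lambda>s. pd_u f i (z s)) has_real_derivative d) (at t) \<and> d - pd_x f i (z t) = 0)))"

definition nonlinear_geodesic_tm ::
  "('p, (real^'n::finite)) chart set \<Rightarrow> ('p \<times> ('p, (real^'n)) tvec \<Rightarrow> real) \<Rightarrow>
   real set \<Rightarrow> (real \<Rightarrow> 'p \<times> ('p, (real^'n)) tvec) \<Rightarrow> bool" where
  "nonlinear_geodesic_tm A L I \<gamma> \<longleftrightarrow> (\<forall>t\<in>I. \<forall>C\<in>tm_atlas A. \<gamma> t \<in> cdom C \<longrightarrow>
     (let f = local_rep L C; z = (\<lambda>s. cmap C (\<gamma> s)) in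
      ((\<lambda>s. fst (z s)) has_vector_derivative snd (z t)) (at t) \<and>
      (\<forall>i. \<exists>d. ((\<lambda>s. snd (z s) $ i) has_real_derivative d) (at t) \<and> d + 2 * lagrange_G f (z t) i = 0)))"

text \<open>The vertical distribution is the kernel of \<open>T\<tau>\<close>.\<close>

definition tm_vertical :: "('p, (real^'n::finite)) chart set \<Rightarrow> 'p \<times> ('p, (real^'n)) tvec \<Rightarrow>
    ('p \<times> ('p, (real^'n)) tvec, (real^'n) \<times> (real^'n)) tvec set" where
  "tm_vertical A e = {w \<in> tangent (tm_atlas A) e.
     tangent_map (tm_atlas A) A tm_projection (e, w) = (fst e, 0)}"

definition tm_nconnection :: "('p, (real^'n::finite)) chart set \<Rightarrow>
    (('p \<times> ('p, (real^'n)) tvec) \<times> ('p \<times> ('p, (real^'n)) tvec, (real^'n) \<times> (real^'n)) tvec) set \<Rightarrow> bool" where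
  "tm_nconnection A H \<longleftrightarrow> whitney_splitting (tm_atlas A) (slit A (tangent A))
     (tangent (tm_atlas A)) (tm_vertical A) (smooth_vector_field (tm_atlas A)) H"

text \<open>\<open>N C (x, y) i j\<close> is \<open>N\<^sup>i\<^sub>j(x, y)\<close> in the coordinates \<open>C\<close>.\<close>

definition tm_coefficients :: "('p, (real^'n::finite)) chart set \<Rightarrow>
    (('p \<times> ('p, (real^'n)) tvec) \<times> ('p \<times> ('p, (real^'n)) tvec, (real^'n) \<times> (real^'n)) tvec) set \<Rightarrow>
    (('p \<times> ('p, (real^'n)) tvec, (real^'n) \<times> (real^'n)) chart \<Rightarrow> (real^'n) \<times> (real^'n) \<Rightarrow> 'n \<Rightarrow> 'n \<Rightarrow> real) \<Rightarrow> bool"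
  where
  "tm_coefficients A H N \<longleftrightarrow> (\<forall>C\<in>tm_atlas A. \<forall>e\<in>slit A (tangent A) \<inter> cdom C.
     H `` {e} = span (range (\<lambda>j. vec_x (tm_atlas A) C e j
       - (\<Sum>i\<in>UNIV. N C (cmap C e) i j *\<^sub>R vec_u (tm_atlas A) C e i))))"


section \<open>Lie algebroids\<close>

text \<open>\<open>anchor D p\<close> is the anchor on the fibre at \<open>p\<close>, and \<open>bracket D U\<close> is the bracket of sections
  over the open set \<open>U\<close>: the bracket is given on local sections, compatibly with restriction.\<close>

record ('p, 'f, 'n, 'm) algebroid =
  base :: "('p, (real^'n::finite)) chart set"
  fibre :: "'p \<Rightarrow> 'f set"
  trivs :: "('p, 'f, 'm::finite) triv set"
  anchor :: "'p \<Rightarrow> 'f \<Rightarrow> ('p, (real^'n)) tvec"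
  bracket :: "'p set \<Rightarrow> ('p \<Rightarrow> 'f) \<Rightarrow> ('p \<Rightarrow> 'f) \<Rightarrow> 'p \<Rightarrow> 'f"

definition sections :: "('p, 'f::real_vector, 'n::finite, 'm::finite) algebroid \<Rightarrow> 'p set \<Rightarrow> ('p \<Rightarrow> 'f) set" where
  "sections D U = {X. smooth_section (base D) (fibre D) (trivs D) U X}"

definition lie_algebroid :: "('p, 'f::real_vector, 'n::finite, 'm::finite) algebroid \<Rightarrow> bool" where
  "lie_algebroid D \<longleftrightarrow>
     smooth_manifold (base D) \<and>
     vector_bundle (base D) (fibre D) (trivs D) \<and>
     \<comment> \<open>the anchor is a smooth vector bundle map to the tangent bundle\<close>
     (\<forall>p\<in>carrier_of (base D). \<forall>f\<in>fibre D p. \<forall>g\<in>fibre D p. \<forall>r.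
        anchor D p f \<in> tangent (base D) p \<and>
        anchor D p (f + g) = anchor D p f + anchor D p g \<and>
        anchor D p (r *\<^sub>R f) = r *\<^sub>R anchor D p f) \<and>
     (\<forall>t\<in>trivs D. \<forall>w. smooth_vector_field (base D) (fst t)
        (\<lambda>p. anchor D p (triv_section (fibre D) t w p))) \<and>
     \<comment> \<open>the bracket is local\<close>
     (\<forall>U V. mopen (base D) U \<and> mopen (base D) V \<and> V \<subseteq> U \<longrightarrow>
        (\<forall>X\<in>sections D U. \<forall>Y\<in>sections D U. \<forall>X'\<in>sections D V. \<forall>Y'\<in>sections D V.
          (\<forall>p\<in>V. X' p = X p \<and> Y' p = Y p) \<longrightarrow>
          (\<forall>p\<in>V. bracket D V X' Y' p = bracket D U X Y p))) \<and>
     \<comment> \<open>Lie algebra axioms and Leibniz rule\<close>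
     (\<forall>U. mopen (base D) U \<longrightarrow>
        (\<forall>X\<in>sections D U. \<forall>Y\<in>sections D U. \<forall>Z\<in>sections D U.
          bracket D U X Y \<in> sections D U \<and>
          (\<forall>p\<in>U.
            bracket D U (\<lambda>q. X q + Y q) Z p = bracket D U X Z p + bracket D U Y Z p \<and>
            bracket D U X (\<lambda>q. Y q + Z q) p = bracket D U X Y p + bracket D U X Z p \<and>
            (\<forall>r. bracket D U (\<lambda>q. r *\<^sub>R X q) Y p = r *\<^sub>R bracket D U X Y p \<and>
                 bracket D U X (\<lambda>q. r *\<^sub>R Y q) p = r *\<^sub>R bracket D U X Y p) \<and>
            bracket D U X X p = 0 \<and>
            bracket D U X (bracket D U Y Z) p + bracket D U Y (bracket D U Z X) p
              + bracket D U Z (bracket D U X Y) p = 0 \<and>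
            (\<forall>f. smooth_fun (base D) U f \<longrightarrow>
              bracket D U X (\<lambda>q. f q *\<^sub>R Y q) p
                = f p *\<^sub>R bracket D U X Y p
                + tangent_deriv (base D) f p (anchor D p (X p)) *\<^sub>R Y p))))"

text \<open>The structure functions \<open>\<rho>\<^sup>i\<^sub>a(x)\<close> and \<open>C\<^sup>e\<^sub>a\<^sub>b(x)\<close> in coordinates \<open>c\<close> on the base and the
  local basis given by the trivialization \<open>t\<close>.\<close>

definition anchor_coef :: "('p, 'f::real_vector, 'n::finite, 'm::finite) algebroid \<Rightarrow> ('p, (real^'n)) chart \<Rightarrow>
    ('p, 'f, 'm) triv \<Rightarrow> (real^'n) \<Rightarrow> 'n \<Rightarrow> 'm \<Rightarrow> real" where
  "anchor_coef D c t x i a =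
     (let p = cinv c x in anchor D p (basis_section (fibre D) t a p) c $ i)"

definition struct_coef :: "('p, 'f::real_vector, 'n::finite, 'm::finite) algebroid \<Rightarrow> ('p, (real^'n)) chart \<Rightarrow>
    ('p, 'f, 'm) triv \<Rightarrow> (real^'n) \<Rightarrow> 'm \<Rightarrow> 'm \<Rightarrow> 'm \<Rightarrow> real" where
  "struct_coef D c t x e a b =
     (let p = cinv c x in
      snd t p (bracket D (fst t) (basis_section (fibre D) t a) (basis_section (fibre D) t b) p) $ e)"

abbreviation e_chart :: "('p, 'f::real_vector, 'n::finite, 'm::finite) algebroid \<Rightarrow> ('p, (real^'n)) chart \<Rightarrow>
    ('p, 'f, 'm) triv \<Rightarrow> ('p \<times> 'f, (real^'n) \<times> (real^'m)) chart" where
  "e_chart D \<equiv> bundle_chart (fibre D)"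

definition e_atlas :: "('p, 'f::real_vector, 'n::finite, 'm::finite) algebroid \<Rightarrow>
    ('p \<times> 'f, (real^'n) \<times> (real^'m)) chart set" where
  "e_atlas D = {e_chart D c t | c t. c \<in> base D \<and> t \<in> trivs D}"

definition e_slit :: "('p, 'f::real_vector, 'n::finite, 'm::finite) algebroid \<Rightarrow> ('p \<times> 'f) set" where
  "e_slit D = slit (base D) (fibre D)"


section \<open>The prolongation of a Lie algebroid\<close>

definition prolongation :: "('p, 'f::real_vector, 'n::finite, 'm::finite) algebroid \<Rightarrow>
    (('p \<times> 'f) \<times> (('p \<times> 'f) \<times> ('p \<times> 'f, (real^'n) \<times> (real^'m)) tvec)) set" where
  "prolongation D = {(b, z).
     b \<in> Sigma (carrier_of (base D)) (fibre D) \<and>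
     z \<in> Sigma (Sigma (carrier_of (base D)) (fibre D)) (tangent (e_atlas D)) \<and>
     (fst b, anchor D (fst b) (snd b)) = tangent_map (e_atlas D) (base D) fst z}"

text \<open>The fibre at \<open>e\<close>. For \<open>(b, z)\<close> in the prolongation with \<open>z\<close> at \<open>e\<close>, the base points of \<open>b\<close>
  and \<open>e\<close> agree and are dropped. The vector space operations and the algebroid anchor
  \<open>(b, z) \<mapsto> z\<close> become those of the product type and \<open>snd\<close>.\<close>

definition prol_fibre :: "('p, 'f::real_vector, 'n::finite, 'm::finite) algebroid \<Rightarrow> 'p \<times> 'f \<Rightarrow>
    ('f \<times> ('p \<times> 'f, (real^'n) \<times> (real^'m)) tvec) set" where
  "prol_fibre D e = {(b, w). ((fst e, b), (e, w)) \<in> prolongation D}"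

definition prol_vertical :: "('p, 'f::real_vector, 'n::finite, 'm::finite) algebroid \<Rightarrow> 'p \<times> 'f \<Rightarrow>
    ('f \<times> ('p \<times> 'f, (real^'n) \<times> (real^'m)) tvec) set" where
  "prol_vertical D e = {q \<in> prol_fibre D e. fst q = 0}"

definition prol_section :: "('p, 'f::real_vector, 'n::finite, 'm::finite) algebroid \<Rightarrow> ('p \<times> 'f) set \<Rightarrow>
    ('p \<times> 'f \<Rightarrow> 'f \<times> ('p \<times> 'f, (real^'n) \<times> (real^'m)) tvec) \<Rightarrow> bool" where
  "prol_section D W s \<longleftrightarrow> (\<forall>e\<in>W. s e \<in> prol_fibre D e) \<and>
     (\<forall>t\<in>trivs D. smooth_fun (e_atlas D) {e \<in> W. fst e \<in> fst t} (\<lambda>e. snd t (fst e) (fst (s e)))) \<and>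
     smooth_vector_field (e_atlas D) W (\<lambda>e. snd (s e))"

text \<open>The induced local basis \<open>z\<^sub>a\<close>, \<open>v\<^sub>a\<close> (with tildes in the usual notation).\<close>

definition prol_z :: "('p, 'f::real_vector, 'n::finite, 'm::finite) algebroid \<Rightarrow> ('p, (real^'n)) chart \<Rightarrow>
    ('p, 'f, 'm) triv \<Rightarrow> 'p \<times> 'f \<Rightarrow> 'm \<Rightarrow> 'f \<times> ('p \<times> 'f, (real^'n) \<times> (real^'m)) tvec" where
  "prol_z D c t e a = (basis_section (fibre D) t a (fst e),
     \<Sum>i\<in>UNIV. anchor_coef D c t (cmap c (fst e)) i a *\<^sub>R vec_x (e_atlas D) (e_chart D c t) e i)"

definition prol_v :: "('p, 'f::real_vector, 'n::finite, 'm::finite) algebroid \<Rightarrow> ('p, (real^'n)) chart \<Rightarrow>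
    ('p, 'f, 'm) triv \<Rightarrow> 'p \<times> 'f \<Rightarrow> 'm \<Rightarrow> 'f \<times> ('p \<times> 'f, (real^'n) \<times> (real^'m)) tvec" where
  "prol_v D c t e a = (0, vec_u (e_atlas D) (e_chart D c t) e a)"

definition prol_nconnection :: "('p, 'f::real_vector, 'n::finite, 'm::finite) algebroid \<Rightarrow> ('p \<times> 'f) set \<Rightarrow>
    (('p \<times> 'f) \<times> 'f \<times> ('p \<times> 'f, (real^'n) \<times> (real^'m)) tvec) set \<Rightarrow> bool" where
  "prol_nconnection D W H \<longleftrightarrow>
     whitney_splitting (e_atlas D) W (prol_fibre D) (prol_vertical D) (prol_section D) H"

text \<open>Over \<open>W\<close>, \<open>H\<close> is spanned by \<open>z\<^sub>a - N\<^sup>b\<^sub>a v\<^sub>b\<close> for the local basis given by \<open>t\<close>, for all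
  coordinates \<open>c\<close> on the base. Here \<open>N c (x, u) b a\<close> is \<open>N\<^sup>b\<^sub>a(x, u)\<close>.\<close>

definition prol_coefficients :: "('p, 'f::real_vector, 'n::finite, 'm::finite) algebroid \<Rightarrow> ('p \<times> 'f) set \<Rightarrow>
    (('p \<times> 'f) \<times> 'f \<times> ('p \<times> 'f, (real^'n) \<times> (real^'m)) tvec) set \<Rightarrow> ('p, 'f, 'm) triv \<Rightarrow>
    (('p, (real^'n)) chart \<Rightarrow> (real^'n) \<times> (real^'m) \<Rightarrow> 'm \<Rightarrow> 'm \<Rightarrow> real) \<Rightarrow> bool" where
  "prol_coefficients D W H t N \<longleftrightarrow> (\<forall>c\<in>base D. \<forall>e\<in>W \<inter> cdom (e_chart D c t).
     H `` {e} = span (range (\<lambda>a. prol_z D c t e a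
       - (\<Sum>b\<in>UNIV. N c (cmap (e_chart D c t) e) b a *\<^sub>R prol_v D c t e b))))"


section \<open>Lagrange algebroids\<close>

definition lagrange_algebroid ::
  "('p, 'f::real_vector, 'n::finite, 'm::finite) algebroid \<Rightarrow> ('p \<times> 'f \<Rightarrow> real) \<Rightarrow> bool" where
  "lagrange_algebroid D l \<longleftrightarrow> lie_algebroid D \<and> regular_lagrangian (e_atlas D) (e_slit D) l"

text \<open>The coefficients \<open>G\<^sup>a\<close> (not \<open>2G\<^sup>a\<close>) and \<open>\<partial>G\<^sup>a/\<partial>u\<^sup>b\<close> as functions of \<open>z = (x, u)\<close>.\<close>

definition algebroid_G :: "('p, 'f::real_vector, 'n::finite, 'm::finite) algebroid \<Rightarrow> ('p \<times> 'f \<Rightarrow> real) \<Rightarrow>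
    ('p, (real^'n)) chart \<Rightarrow> ('p, 'f, 'm) triv \<Rightarrow> (real^'n) \<times> (real^'m) \<Rightarrow> 'm \<Rightarrow> real" where
  "algebroid_G D l c t z a =
     (let f = local_rep l (e_chart D c t); \<rho> = anchor_coef D c t (fst z);
          C = struct_coef D c t (fst z); u = snd z
      in 1/2 * (1/2 * (\<Sum>b\<in>UNIV. matrix_inv (fibre_metric f z) $ a $ b *
           ((\<Sum>i\<in>UNIV. \<Sum>d\<in>UNIV. pd_u (pd_x f i) b z * \<rho> i d * u $ d)
            + (\<Sum>e\<in>UNIV. \<Sum>d\<in>UNIV. C e b d * u $ d * pd_u f e z)
            - (\<Sum>i\<in>UNIV. \<rho> i b * pd_x f i z)))))"

definition algebroid_N :: "('p, 'f::real_vector, 'n::finite, 'm::finite) algebroid \<Rightarrow> ('p \<times> 'f \<Rightarrow> real) \<Rightarrow>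
    ('p, (real^'n)) chart \<Rightarrow> ('p, 'f, 'm) triv \<Rightarrow> (real^'n) \<times> (real^'m) \<Rightarrow> 'm \<Rightarrow> 'm \<Rightarrow> real" where
  "algebroid_N D l c t z a b = pd_u (\<lambda>w. algebroid_G D l c t w a) b z"

text \<open>For two local bases \<open>v'\<^sub>a = \<Lambda>\<^sup>b\<^sub>a v\<^sub>b\<close> the splittings given by \<open>\<partial>G\<^sup>a/\<partial>u\<^sup>b\<close> differ by
  \<open>1/2 (\<rho>(v'\<^sub>b)(\<Lambda>\<^sup>a\<^sub>d) - \<rho>(v'\<^sub>d)(\<Lambda>\<^sup>a\<^sub>b)) u'\<^sup>d\<close>, which is also the inhomogeneous part in the
  transformation of \<open>1/2 C\<^sup>a\<^sub>b\<^sub>d u\<^sup>d\<close>. So \<open>\<partial>G\<^sup>a/\<partial>u\<^sup>b\<close> defines a splitting on the domain of each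
  single local basis, and these agree on overlaps only after adding this term.\<close>

definition algebroid_N_global :: "('p, 'f::real_vector, 'n::finite, 'm::finite) algebroid \<Rightarrow> ('p \<times> 'f \<Rightarrow> real) \<Rightarrow>
    ('p, (real^'n)) chart \<Rightarrow> ('p, 'f, 'm) triv \<Rightarrow> (real^'n) \<times> (real^'m) \<Rightarrow> 'm \<Rightarrow> 'm \<Rightarrow> real" where
  "algebroid_N_global D l c t z a b = algebroid_N D l c t z a b
     + 1/2 * (\<Sum>d\<in>UNIV. struct_coef D c t (fst z) a b d * snd z $ d)"

text \<open>A semispray is a smooth section \<open>S\<close> of the prolongation whose value at \<open>e\<close> is \<open>(e, z)\<close> for
  some \<open>z\<close>.\<close>

definition algebroid_semispray :: "('p, 'f::real_vector, 'n::finite, 'm::finite) algebroid \<Rightarrow>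
    ('p \<times> 'f \<Rightarrow> 'f \<times> ('p \<times> 'f, (real^'n) \<times> (real^'m)) tvec) \<Rightarrow> bool" where
  "algebroid_semispray D S \<longleftrightarrow> prol_section D (e_slit D) S \<and> (\<forall>e\<in>e_slit D. fst (S e) = snd e)"

text \<open>\<open>S = u\<^sup>a z\<^sub>a - 2 G\<^sup>a v\<^sub>a\<close>, and its image
  \<open>\<xi>\<^sub>l = u\<^sup>a \<rho>\<^sup>i\<^sub>a \<partial>/\<partial>x\<^sup>i - 2 G\<^sup>a \<partial>/\<partial>u\<^sup>a\<close> under the anchor, in all local coordinates.\<close>

definition is_spray_section :: "('p, 'f::real_vector, 'n::finite, 'm::finite) algebroid \<Rightarrow> ('p \<times> 'f \<Rightarrow> real) \<Rightarrow>
    ('p \<times> 'f \<Rightarrow> 'f \<times> ('p \<times> 'f, (real^'n) \<times> (real^'m)) tvec) \<Rightarrow> bool" where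
  "is_spray_section D l S \<longleftrightarrow> (\<forall>c\<in>base D. \<forall>t\<in>trivs D. \<forall>e\<in>e_slit D \<inter> cdom (e_chart D c t).
     (let z = cmap (e_chart D c t) e in
      S e = (\<Sum>a\<in>UNIV. snd z $ a *\<^sub>R prol_z D c t e a)
          - (\<Sum>a\<in>UNIV. (2 * algebroid_G D l c t z a) *\<^sub>R prol_v D c t e a)))"

definition is_xi_l :: "('p, 'f::real_vector, 'n::finite, 'm::finite) algebroid \<Rightarrow> ('p \<times> 'f \<Rightarrow> real) \<Rightarrow>
    ('p \<times> 'f \<Rightarrow> ('p \<times> 'f, (real^'n) \<times> (real^'m)) tvec) \<Rightarrow> bool" where
  "is_xi_l D l \<xi> \<longleftrightarrow> (\<forall>c\<in>base D. \<forall>t\<in>trivs D. \<forall>e\<in>e_slit D \<inter> cdom (e_chart D c t).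
     (let C = e_chart D c t; z = cmap C e in
      \<xi> e = (\<Sum>i\<in>UNIV. (\<Sum>a\<in>UNIV. snd z $ a * anchor_coef D c t (fst z) i a) *\<^sub>R vec_x (e_atlas D) C e i)
          - (\<Sum>a\<in>UNIV. (2 * algebroid_G D l c t z a) *\<^sub>R vec_u (e_atlas D) C e a)))"

text \<open>In the next two definitions the curve \<open>\<gamma>\<close> runs in \<open>E\<close> minus the zero section.\<close>

definition euler_lagrange_algebroid ::
  "('p, 'f::real_vector, 'n::finite, 'm::finite) algebroid \<Rightarrow> ('p \<times> 'f \<Rightarrow> real) \<Rightarrow>
   real set \<Rightarrow> (real \<Rightarrow> 'p \<times> 'f) \<Rightarrow> bool" where
  "euler_lagrange_algebroid D l I \<gamma> \<longleftrightarrow>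
     (\<forall>s\<in>I. \<forall>c\<in>base D. \<forall>t\<in>trivs D. \<gamma> s \<in> cdom (e_chart D c t) \<longrightarrow>
     (let C = e_chart D c t; f = local_rep l C; z = (\<lambda>r. cmap C (\<gamma> r)); u = snd (z s);
          \<rho> = anchor_coef D c t (fst (z s)); K = struct_coef D c t (fst (z s)) in
      ((\<lambda>r. fst (z r)) has_vector_derivative (\<chi> i. \<Sum>b\<in>UNIV. \<rho> i b * u $ b)) (at s) \<and>
      (\<forall>a. \<exists>d. ((\<lambda>r. pd_u f a (z r)) has_real_derivative d) (at s) \<and>
         d - (\<Sum>i\<in>UNIV. \<rho> i a * pd_x f i (z s))
           + (\<Sum>e\<in>UNIV. \<Sum>b\<in>UNIV. K e a b * u $ b * pd_u f e (z s)) = 0)))"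

definition nonlinear_geodesic_algebroid ::
  "('p, 'f::real_vector, 'n::finite, 'm::finite) algebroid \<Rightarrow> ('p \<times> 'f \<Rightarrow> real) \<Rightarrow>
   real set \<Rightarrow> (real \<Rightarrow> 'p \<times> 'f) \<Rightarrow> bool" where
  "nonlinear_geodesic_algebroid D l I \<gamma> \<longleftrightarrow>
     (\<forall>s\<in>I. \<forall>c\<in>base D. \<forall>t\<in>trivs D. \<gamma> s \<in> cdom (e_chart D c t) \<longrightarrow>
     (let C = e_chart D c t; z = (\<lambda>r. cmap C (\<gamma> r)); u = snd (z s);
          \<rho> = anchor_coef D c t (fst (z s)) in
      ((\<lambda>r. fst (z r)) has_vector_derivative (\<chi> i. \<Sum>b\<in>UNIV. \<rho> i b * u $ b)) (at s) \<and>
      (\<forall>a. \<exists>d. ((\<lambda>r. snd (z r) $ a) has_real_derivative d) (at s) \<and>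
         d + 2 * algebroid_G D l c t (z s) a = 0)))"

end

theory Submission
  imports Defs
begin

text \<open>Contracted with a constant section \<open>a\<close>, the left-hand side of the Euler--Lagrange equations along
  a curve with velocity \<open>(\<rho> u, w)\<close> is a tensor in \<open>a\<close>, although \<open>w\<close> is not a vector; it is affine in
  \<open>w\<close> with linear part \<open>2 g\<close>, and by the symmetry of second derivatives it vanishes exactly for
  \<open>w = - 2 G\<close>. Hence the vectors \<open>(\<rho> u, - 2 G)\<close> glue to a global semispray, and the Euler--Lagrange
  and the geodesic equations both say that a curve has this velocity. Differentiating the
  transformation law of \<open>- 2 G\<close> along the fibres gives that of \<open>\<partial>G/\<partial>u\<close>; its inhomogeneous part is
  the symmetrization of \<open>(D\<Lambda> b)(\<rho> u)\<close> in \<open>b\<close> and \<open>u\<close>, where \<open>\<Lambda>\<close> is the transition matrix of the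
  bundle, whereas a splitting requires \<open>(D\<Lambda> u)(\<rho> b)\<close>. The difference is the antisymmetrization, which
  vanishes for \<open>\<Lambda> = D\<phi>\<close> (tangent bundle) and for constant \<open>\<Lambda>\<close> (fixed local basis), and in general is
  the inhomogeneous part in the transformation law of \<open>C/2\<close>, which follows from the Leibniz rule.\<close>

section \<open>Calculus of smooth maps\<close>

text \<open>The formula for G is never transformed directly; that would mean transforming the
  inverse of g together with all derivatives of the Lagrangian. Invertibility of g makes - 2 G the
  only zero of an affine expression, so its law follows from that of the expression, which takes
  only the chain rule and the laws of \<rho> and C. The law of G has to hold on an open set and not
  just at a point, because it is differentiated along the fibre afterwards; its inhomogeneous part
  is quadratic in u, and polarization is what symmetrizes it. Both parts of the theorem are
  instances of one locale indexed by pairs of a chart and a local basis. All local statements avoid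
  u = 0: nothing is known about the Lagrangian there, so every coordinate domain has the form of an
  open set times the punctured fibre.\<close>

abbreviation fd :: "('a::euclidean_space \<Rightarrow> 'b::euclidean_space) \<Rightarrow> 'a \<Rightarrow> 'a \<Rightarrow> 'b" where
  "fd f x \<equiv> frechet_derivative f (at x)"

lemma fd_eq: "(f has_derivative f') (at x) \<Longrightarrow> fd f x = f'"
  using frechet_derivative_at by metis

text \<open>Maps that agree near \<open>x\<close> have the same derivatives there, so the choice
  operator behind \<open>frechet_derivative\<close> returns the same map, whether or not they are
  differentiable.\<close>

lemma fd_cong:
  assumes "open S" "x \<in> S" "\<And>y. y \<in> S \<Longrightarrow> f y = g y"
  shows "fd f x = fd g x"
proof -
  have "(f has_derivative h) (at x) \<longleftrightarrow> (g has_derivative h) (at x)" for h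
    using assms has_derivative_transform_within_open[of f h x UNIV S g]
      has_derivative_transform_within_open[of g h x UNIV S f] by auto
  then show ?thesis by (simp add: frechet_derivative_def)
qed

lemma differentiable_cong:
  assumes "open S" "x \<in> S" "\<And>y. y \<in> S \<Longrightarrow> f y = g y"
  shows "f differentiable (at x) \<longleftrightarrow> g differentiable (at x)"
  using assms by (smt (verit) differentiable_def has_derivative_transform_within_open)

section \<open>Closure properties of differentiability of finite order\<close>

lemma Ck_on_cong:
  assumes "open S" "\<And>y. y \<in> S \<Longrightarrow> f y = g y"
  shows "Ck_on k S f \<longleftrightarrow> Ck_on k S g"
  using assms(2)
proof (induction k arbitrary: f g)
  case 0
  then show ?case by (simp cong: continuous_on_cong)
next
  case (Suc k)
  have "Ck_on k S (\<lambda>x. fd f x v) \<longleftrightarrow> Ck_on k S (\<lambda>x. fd g x v)" for v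
  proof (rule Suc.IH)
    fix y assume "y \<in> S"
    show "fd f y v = fd g y v" by (simp only: fd_cong[OF assms(1) \<open>y \<in> S\<close> Suc.prems])
  qed
  moreover have "f differentiable (at x) \<longleftrightarrow> g differentiable (at x)" if "x \<in> S" for x
    using differentiable_cong[OF assms(1) that] Suc.prems by blast
  ultimately show ?case by simp
qed

lemma Ck_on_congI:
  "(\<And>y. y \<in> S \<Longrightarrow> f y = g y) \<Longrightarrow> Ck_on k S g \<Longrightarrow> open S \<Longrightarrow> Ck_on k S f"
  by (subst Ck_on_cong[of S f g])

lemma Ck_on_subset: "Ck_on k S f \<Longrightarrow> T \<subseteq> S \<Longrightarrow> Ck_on k T f"
  by (induction k arbitrary: f) (auto intro: continuous_on_subset)

text \<open>Every clause of \<open>Ck_on\<close> is a condition at single points, and on an open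
  \<open>U\<close> it is two-sided. This is what later reduces smoothness in all charts to
  smoothness in one chart around each point.\<close>

lemma Ck_on_local:
  assumes "\<And>x. x \<in> S \<Longrightarrow> \<exists>U. open U \<and> x \<in> U \<and> Ck_on k U f"
  shows "Ck_on k S f"
  using assms
proof (induction k arbitrary: f)
  case 0
  have "isCont f x" if "x \<in> S" for x
    using 0[OF that] by (auto simp: continuous_on_eq_continuous_at)
  then show ?case by (simp add: continuous_at_imp_continuous_on)
next
  case (Suc k)
  have "Ck_on k S (\<lambda>x. fd f x v)" for v
    using Suc.prems by (intro Suc.IH) (metis Ck_on.simps(2))
  then show ?case using Suc.prems by (auto dest: Ck_on.simps(2)[THEN iffD1])
qed

lemma Ck_on_le_Suc: "Ck_on (Suc k) S f \<Longrightarrow> Ck_on k S f"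
proof (induction k arbitrary: f)
  case 0
  then show ?case
    by (auto intro!: continuous_at_imp_continuous_on differentiable_imp_continuous_within)
next
  case (Suc k)
  then show ?case by (metis Ck_on.simps(2))
qed

lemma Ck_on_const: "Ck_on k S (\<lambda>x. c)"
  by (induction k arbitrary: c) auto

lemma Ck_on_linear:
  assumes "bounded_linear f"
  shows "Ck_on k S f"
proof (cases k)
  case 0
  then show ?thesis using assms by (simp add: linear_continuous_on)
next
  case (Suc j)
  have "fd f x = f" for x
    by (rule fd_eq) (rule bounded_linear_imp_has_derivative[OF assms])
  then show ?thesis
    using Suc assms by (simp add: Ck_on_const bounded_linear_imp_differentiable)
qed

lemma Ck_on_add:
  assumes "open S" "Ck_on k S f" "Ck_on k S g"
  shows "Ck_on k S (\<lambda>x. f x + g x)"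
  using assms(2,3)
proof (induction k arbitrary: f g)
  case 0
  then show ?case by (simp add: continuous_on_add)
next
  case (Suc k)
  have d: "f differentiable (at x)" "g differentiable (at x)" if "x \<in> S" for x
    using Suc.prems that by auto
  have "Ck_on k S (\<lambda>x. fd (\<lambda>x. f x + g x) x v)" for v
  proof -
    have "fd (\<lambda>x. f x + g x) x v = fd f x v + fd g x v" if "x \<in> S" for x
      using fd_eq[OF has_derivative_add[OF d[OF that, unfolded frechet_derivative_works]]] by simp
    moreover have "Ck_on k S (\<lambda>x. fd f x v + fd g x v)"
      using Suc by (intro Suc.IH) auto
    ultimately show ?thesis by (rule Ck_on_congI[OF _ _ assms(1)])
  qed
  then show ?case using d by auto
qed

lemma Ck_on_sum:
  assumes "open S" "finite I" "\<And>i. i \<in> I \<Longrightarrow> Ck_on k S (f i)"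
  shows "Ck_on k S (\<lambda>x. \<Sum>i\<in>I. f i x)"
  using assms(2,3)
proof (induction I rule: finite_induct)
  case empty
  then show ?case by (simp add: Ck_on_const)
next
  case (insert i I)
  have "Ck_on k S (\<lambda>x. f i x + (\<Sum>i\<in>I. f i x))"
    using insert by (intro Ck_on_add[OF assms(1)]) auto
  then show ?case using insert by simp
qed

text \<open>Each summand of the product rule keeps one factor undifferentiated;
  \<open>Ck_on_le_Suc\<close> lowers its order so that the induction hypothesis applies to both
  summands.\<close>

lemma Ck_on_bilinear:
  fixes pr :: "'a::euclidean_space \<Rightarrow> 'b::euclidean_space \<Rightarrow> 'c::euclidean_space"
  assumes "bounded_bilinear pr" "open S" "Ck_on k S f" "Ck_on k S g"
  shows "Ck_on k S (\<lambda>x. pr (f x) (g x))"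
  using assms(3,4)
proof (induction k arbitrary: f g)
  case 0
  then show ?case by (simp add: bounded_bilinear.continuous_on[OF assms(1)])
next
  case (Suc k)
  have d: "(f has_derivative fd f x) (at x)" "(g has_derivative fd g x) (at x)" if "x \<in> S" for x
    using Suc.prems that frechet_derivative_works by (metis Ck_on.simps(2))+
  have D: "((\<lambda>x. pr (f x) (g x)) has_derivative (\<lambda>v. pr (f x) (fd g x v) + pr (fd f x v) (g x))) (at x)"
    if "x \<in> S" for x
    using bounded_bilinear.FDERIV[OF assms(1) d[OF that]] .
  have "Ck_on k S (\<lambda>x. fd (\<lambda>x. pr (f x) (g x)) x v)" for v
  proof -
    have "fd (\<lambda>x. pr (f x) (g x)) x v = pr (f x) (fd g x v) + pr (fd f x v) (g x)" if "x \<in> S" for x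
      using fd_eq[OF D[OF that]] by simp
    moreover have "Ck_on k S (\<lambda>x. pr (f x) (fd g x v) + pr (fd f x v) (g x))"
      by (intro Ck_on_add[OF assms(2)] Suc.IH Suc.prems[THEN Ck_on_le_Suc])
        (use Suc.prems in auto)
    ultimately show ?thesis by (rule Ck_on_congI[OF _ _ assms(2)])
  qed
  moreover have "(\<lambda>x. pr (f x) (g x)) differentiable (at x)" if "x \<in> S" for x
    unfolding differentiable_def using D[OF that] by blast
  ultimately show ?case by simp
qed

text \<open>Replaces a derivative in a varying direction by derivatives in fixed directions, the
  only ones about which \<open>Ck_on\<close> makes a statement.\<close>

lemma fd_sum_Basis:
  fixes f :: "'a::euclidean_space \<Rightarrow> 'b::euclidean_space"
  assumes "f differentiable (at x)"
  shows "fd f x v = (\<Sum>b\<in>Basis. (v \<bullet> b) *\<^sub>R fd f x b)"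
proof -
  have "linear (fd f x)" using assms by (rule linear_frechet_derivative)
  then have "fd f x (\<Sum>b\<in>Basis. (v \<bullet> b) *\<^sub>R b) = (\<Sum>b\<in>Basis. (v \<bullet> b) *\<^sub>R fd f x b)"
    by (simp add: linear_sum linear_scale)
  then show ?thesis by (simp only: euclidean_representation)
qed

text \<open>The chain rule differentiates \<open>g\<close> in the direction \<open>fd f x v\<close>,
  which moves with \<open>x\<close>. Expanded in the basis, it becomes a sum of products of
  components of \<open>fd f x v\<close> with maps \<open>fd g (f x) b\<close>; the latter are again
  compositions with \<open>f\<close>, hence the induction over all \<open>g\<close> for fixed
  \<open>f\<close>.\<close>

lemma Ck_on_compose:
  fixes g :: "'b::euclidean_space \<Rightarrow> 'c::euclidean_space" and f :: "'a::euclidean_space \<Rightarrow> 'b"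
  assumes "open S" "open T" "f ` S \<subseteq> T" "Ck_on k S f" "Ck_on k T g"
  shows "Ck_on k S (\<lambda>x. g (f x))"
  using assms(4,5)
proof (induction k arbitrary: g)
  case 0
  then show ?case using continuous_on_compose2[of T g S f] assms(3) by simp
next
  case (Suc k)
  have df: "f differentiable (at x)" and dg: "g differentiable (at (f x))" if "x \<in> S" for x
    using Suc.prems that assms(3) by auto
  have D: "((\<lambda>x. g (f x)) has_derivative (\<lambda>v. fd g (f x) (fd f x v))) (at x)" if "x \<in> S" for x
    using diff_chain_at[of f "fd f x" x g "fd g (f x)"] df[OF that] dg[OF that]
    by (simp add: frechet_derivative_works o_def)
  have "Ck_on k S (\<lambda>x. fd (\<lambda>x. g (f x)) x v)" for v
  proof -
    have "fd (\<lambda>x. g (f x)) x v = (\<Sum>b\<in>Basis. (fd f x v \<bullet> b) *\<^sub>R fd g (f x) b)" if "x \<in> S" for x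
      unfolding fd_eq[OF D[OF that]] by (rule fd_sum_Basis[OF dg[OF that]])
    moreover have "Ck_on k S (\<lambda>x. \<Sum>b\<in>Basis. (fd f x v \<bullet> b) *\<^sub>R fd g (f x) b)"
    proof (intro Ck_on_sum[OF assms(1)] Ck_on_bilinear[OF bounded_bilinear_scaleR assms(1)])
      fix b :: 'b
      show "Ck_on k S (\<lambda>x. fd f x v \<bullet> b)"
        using Suc.prems(1) by (intro Ck_on_bilinear[OF bounded_bilinear_inner assms(1)])
          (auto intro: Ck_on_const)
      show "Ck_on k S (\<lambda>x. fd g (f x) b)"
        by (intro Suc.IH Ck_on_le_Suc[OF Suc.prems(1)]) (use Suc.prems(2) in auto)
    qed simp
    ultimately show ?thesis by (rule Ck_on_congI[OF _ _ assms(1)])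
  qed
  moreover have "(\<lambda>x. g (f x)) differentiable (at x)" if "x \<in> S" for x
    unfolding differentiable_def using D[OF that] by blast
  ultimately show ?case by simp
qed

text \<open>The derivative of \<open>1/f\<close> is a polynomial in \<open>1/f\<close> and the
  derivative of \<open>f\<close>, so the order of \<open>1/f\<close> can be raised step by
  step.\<close>

lemma Ck_on_inverse:
  fixes f :: "'a::euclidean_space \<Rightarrow> real"
  assumes "open S" "Ck_on k S f" "\<And>x. x \<in> S \<Longrightarrow> f x \<noteq> 0"
  shows "Ck_on k S (\<lambda>x. inverse (f x))"
  using assms(2)
proof (induction k)
  case 0
  then show ?case using assms(3) by (simp add: continuous_on_inverse)
next
  case (Suc k)
  have d: "(f has_derivative fd f x) (at x)" if "x \<in> S" for x
    using Suc.prems that frechet_derivative_works by auto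
  have D: "((\<lambda>x. inverse (f x)) has_derivative (\<lambda>v. - (inverse (f x) * fd f x v * inverse (f x)))) (at x)"
    if "x \<in> S" for x
    using Deriv.has_derivative_inverse[OF assms(3)[OF that] d[OF that]] .
  have k: "Ck_on k S (\<lambda>x. inverse (f x))" using Suc Ck_on_le_Suc by blast
  have "Ck_on k S (\<lambda>x. fd (\<lambda>x. inverse (f x)) x v)" for v
  proof -
    have "fd (\<lambda>x. inverse (f x)) x v = (-1) * (inverse (f x) * (fd f x v * inverse (f x)))"
      if "x \<in> S" for x
      using fd_eq[OF D[OF that]] by simp
    moreover have "Ck_on k S (\<lambda>x. (-1) * (inverse (f x) * (fd f x v * inverse (f x))))"
      using Suc.prems by (intro Ck_on_bilinear[OF bounded_bilinear_mult assms(1)] Ck_on_const k) auto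
    ultimately show ?thesis by (rule Ck_on_congI[OF _ _ assms(1)])
  qed
  moreover have "(\<lambda>x. inverse (f x)) differentiable (at x)" if "x \<in> S" for x
    unfolding differentiable_def using D[OF that] by blast
  ultimately show ?case by simp
qed

section \<open>Closure properties of smooth maps\<close>

lemma smooth_on_cong:
  "open S \<Longrightarrow> (\<And>y. y \<in> S \<Longrightarrow> f y = g y) \<Longrightarrow> smooth_on S f \<longleftrightarrow> smooth_on S g"
  unfolding smooth_on_def using Ck_on_cong by blast

lemma smooth_on_congI:
  "(\<And>y. y \<in> S \<Longrightarrow> f y = g y) \<Longrightarrow> smooth_on S g \<Longrightarrow> open S \<Longrightarrow> smooth_on S f"
  by (subst smooth_on_cong[of S f g])

lemma smooth_on_subset: "smooth_on S f \<Longrightarrow> T \<subseteq> S \<Longrightarrow> smooth_on T f"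
  unfolding smooth_on_def using Ck_on_subset by blast

lemma smooth_on_local:
  assumes "\<And>x. x \<in> S \<Longrightarrow> \<exists>U. open U \<and> x \<in> U \<and> smooth_on U f"
  shows "smooth_on S f"
  unfolding smooth_on_def using assms by (intro allI Ck_on_local) (metis smooth_on_def)

lemma smooth_on_differentiable: "smooth_on S f \<Longrightarrow> x \<in> S \<Longrightarrow> f differentiable (at x)"
  unfolding smooth_on_def using Ck_on.simps(2) by blast

lemma smooth_on_has_derivative: "smooth_on S f \<Longrightarrow> x \<in> S \<Longrightarrow> (f has_derivative fd f x) (at x)"
  using smooth_on_differentiable frechet_derivative_works by blast

lemma smooth_on_continuous_on: "smooth_on S f \<Longrightarrow> continuous_on S f"
  unfolding smooth_on_def using Ck_on.simps(1) by blast

lemma smooth_on_fd_const: "smooth_on S f \<Longrightarrow> smooth_on S (\<lambda>x. fd f x v)"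
  unfolding smooth_on_def using Ck_on.simps(2) by blast

lemma smooth_on_const: "smooth_on S (\<lambda>x. c)"
  by (simp add: smooth_on_def Ck_on_const)

lemma smooth_on_linear: "bounded_linear f \<Longrightarrow> smooth_on S f"
  by (simp add: smooth_on_def Ck_on_linear)

lemma smooth_on_id: "smooth_on S (\<lambda>x. x)"
  by (simp add: smooth_on_linear bounded_linear_ident)

lemma smooth_on_add: "open S \<Longrightarrow> smooth_on S f \<Longrightarrow> smooth_on S g \<Longrightarrow> smooth_on S (\<lambda>x. f x + g x)"
  by (simp add: smooth_on_def Ck_on_add)

lemma smooth_on_sum:
  "open S \<Longrightarrow> finite I \<Longrightarrow> (\<And>i. i \<in> I \<Longrightarrow> smooth_on S (f i)) \<Longrightarrow> smooth_on S (\<lambda>x. \<Sum>i\<in>I. f i x)"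
  by (simp add: smooth_on_def Ck_on_sum)

lemma smooth_on_bilinear:
  fixes pr :: "'a::euclidean_space \<Rightarrow> 'b::euclidean_space \<Rightarrow> 'c::euclidean_space"
  shows "bounded_bilinear pr \<Longrightarrow> open S \<Longrightarrow> smooth_on S f \<Longrightarrow> smooth_on S g \<Longrightarrow>
    smooth_on S (\<lambda>x. pr (f x) (g x))"
  unfolding smooth_on_def using Ck_on_bilinear[of pr S _ f g] by blast

lemmas smooth_on_scaleR = smooth_on_bilinear[OF bounded_bilinear_scaleR]
lemmas smooth_on_mult = smooth_on_bilinear[OF bounded_bilinear_mult[where 'a = real]]
lemmas smooth_on_inner = smooth_on_bilinear[OF bounded_bilinear_inner]

lemma smooth_on_compose:
  fixes g :: "'b::euclidean_space \<Rightarrow> 'c::euclidean_space" and f :: "'a::euclidean_space \<Rightarrow> 'b"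
  shows "open S \<Longrightarrow> open T \<Longrightarrow> f ` S \<subseteq> T \<Longrightarrow> smooth_on S f \<Longrightarrow> smooth_on T g \<Longrightarrow>
    smooth_on S (\<lambda>x. g (f x))"
  unfolding smooth_on_def using Ck_on_compose[of S T f _ g] by blast

lemma smooth_on_linear_compose:
  fixes h :: "'b::euclidean_space \<Rightarrow> 'c::euclidean_space"
  shows "bounded_linear h \<Longrightarrow> open S \<Longrightarrow> smooth_on S f \<Longrightarrow> smooth_on S (\<lambda>x. h (f x))"
  using smooth_on_compose[of S UNIV f h] smooth_on_linear[of h UNIV] by auto

lemma smooth_on_uminus: 
  "open S \<Longrightarrow> smooth_on S f \<Longrightarrow> smooth_on S (\<lambda>x. - f x)"
  by (rule smooth_on_linear_compose) (auto intro: bounded_linear_minus bounded_linear_ident)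

lemma smooth_on_diff: "open S \<Longrightarrow> smooth_on S f \<Longrightarrow> smooth_on S g \<Longrightarrow> smooth_on S (\<lambda>x. f x - g x)"
  using smooth_on_add[of S f "\<lambda>x. - g x"] smooth_on_uminus[of S g] by simp

lemma smooth_on_inverse:
  fixes f :: "'a::euclidean_space \<Rightarrow> real"
  shows "open S \<Longrightarrow> smooth_on S f \<Longrightarrow> (\<And>x. x \<in> S \<Longrightarrow> f x \<noteq> 0) \<Longrightarrow> smooth_on S (\<lambda>x. inverse (f x))"
  by (simp add: smooth_on_def Ck_on_inverse)

lemma smooth_on_snd: "open S \<Longrightarrow> smooth_on S f \<Longrightarrow> smooth_on S (\<lambda>x. snd (f x))"
  by (rule smooth_on_linear_compose[OF bounded_linear_snd])

lemma smooth_on_nth: "open S \<Longrightarrow> smooth_on S f \<Longrightarrow> smooth_on S (\<lambda>x. f x $ i)"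
  for f :: "'a::euclidean_space \<Rightarrow> real^'n"
  by (rule smooth_on_linear_compose[OF bounded_linear_vec_nth])

lemma smooth_on_Pair:
  assumes "open S" "smooth_on S f" "smooth_on S g"
  shows "smooth_on S (\<lambda>x. (f x, g x))"
proof -
  have "smooth_on S (\<lambda>x. (f x, 0))" "smooth_on S (\<lambda>x. (0, g x))"
    using smooth_on_linear_compose[of "\<lambda>y. (y, 0)" S f] smooth_on_linear_compose[of "\<lambda>y. (0, y)" S g] assms
    by (simp_all add: bounded_linear_Pair bounded_linear_ident bounded_linear_zero)
  from smooth_on_add[OF assms(1) this] show ?thesis by simp
qed

lemma smooth_on_vec:
  fixes f :: "'a::euclidean_space \<Rightarrow> 'n::finite \<Rightarrow> real"
  assumes "open S" "\<And>i. smooth_on S (\<lambda>x. f x i)"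
  shows "smooth_on S (\<lambda>x. (\<chi> i. f x i) :: real^'n)"
proof -
  have "(\<chi> i. f x i) = (\<Sum>i\<in>UNIV. f x i *\<^sub>R (axis i 1 :: real^'n))" for x
    by (simp add: vec_eq_iff axis_def if_distrib cong: if_cong)
  moreover have "smooth_on S (\<lambda>x. \<Sum>i\<in>UNIV. f x i *\<^sub>R (axis i 1 :: real^'n))"
    by (rule smooth_on_sum[OF assms(1) finite smooth_on_scaleR[OF assms(1) assms(2) smooth_on_const]])
  ultimately show ?thesis by simp
qed

lemma smooth_on_prod:
  fixes f :: "'i \<Rightarrow> 'a::euclidean_space \<Rightarrow> real"
  assumes "open S" "finite I" "\<And>i. i \<in> I \<Longrightarrow> smooth_on S (f i)"
  shows "smooth_on S (\<lambda>x. \<Prod>i\<in>I. f i x)"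
  using assms(2,3)
proof (induction I rule: finite_induct)
  case empty
  then show ?case by (simp add: smooth_on_const)
next
  case (insert i I)
  have "smooth_on S (\<lambda>x. f i x * (\<Prod>i\<in>I. f i x))"
    using insert by (intro smooth_on_mult[OF assms(1)]) auto
  then show ?case using insert by simp
qed

section \<open>Smoothness of determinants and matrix inverses\<close>

lemma smooth_on_det:
  fixes M :: "'a::euclidean_space \<Rightarrow> real^'n^'n"
  assumes "open S" "\<And>i j. smooth_on S (\<lambda>x. M x $ i $ j)"
  shows "smooth_on S (\<lambda>x. det (M x))"
proof -
  have "smooth_on S (\<lambda>x. \<Prod>i\<in>UNIV. M x $ i $ p i)" for p
    using assms by (intro smooth_on_prod) auto
  then show ?thesis
    unfolding det_def by (intro smooth_on_sum[OF assms(1)] smooth_on_mult[OF assms(1) smooth_on_const])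
      (auto simp: finite_permutations)
qed

lemma matrix_inv_mult:
  assumes "invertible A"
  shows "A ** matrix_inv A = mat 1" "matrix_inv A ** A = mat 1"
proof -
  have "A ** matrix_inv A = mat 1 \<and> matrix_inv A ** A = mat 1"
    unfolding matrix_inv_def using assms unfolding invertible_def by (rule someI_ex)
  then show "A ** matrix_inv A = mat 1" "matrix_inv A ** A = mat 1" by auto
qed

text \<open>By Cramer's rule an entry of the inverse is a quotient of two determinants: in
  \<open>?C x\<close> column \<open>i\<close> of the matrix is replaced by the \<open>j\<close>-th
  unit vector.\<close>

lemma smooth_on_matrix_inv:
  fixes M :: "'a::euclidean_space \<Rightarrow> real^'n^'n"
  assumes "open S" "\<And>i j. smooth_on S (\<lambda>x. M x $ i $ j)" "\<And>x. x \<in> S \<Longrightarrow> invertible (M x)"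
  shows "smooth_on S (\<lambda>x. matrix_inv (M x) $ i $ j)"
proof -
  let ?C = "\<lambda>x. (\<chi> a b. if b = i then axis j 1 $ a else M x $ a $ b) :: real^'n^'n"
  have "matrix_inv (M x) $ i $ j = det (?C x) * inverse (det (M x))" if "x \<in> S" for x
  proof -
    have nz: "det (M x) \<noteq> 0" using assms(3)[OF that] by (simp add: invertible_det_nz)
    have "M x *v (matrix_inv (M x) *v axis j 1) = axis j 1"
      using assms(3)[OF that] by (simp add: matrix_vector_mul_assoc matrix_inv_mult)
    then have "matrix_inv (M x) *v axis j 1 = (\<chi> k. det (\<chi> a b. if b = k then axis j 1 $ a else M x $ a $ b) / det (M x))"
      using cramer[OF nz] by blast
    moreover have "(matrix_inv (M x) *v axis j 1) $ i = matrix_inv (M x) $ i $ j"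
      by (simp add: matrix_vector_mul_component inner_axis)
    ultimately show ?thesis by (simp add: divide_inverse)
  qed
  moreover have "smooth_on S (\<lambda>x. det (?C x) * inverse (det (M x)))"
  proof (rule smooth_on_mult[OF assms(1) smooth_on_det[OF assms(1)] smooth_on_inverse[OF assms(1) smooth_on_det[OF assms(1,2)]]])
    show "smooth_on S (\<lambda>x. ?C x $ a $ b)" for a b
      using assms(2) by (cases "b = i") (auto intro: smooth_on_const)
    show "x \<in> S \<Longrightarrow> det (M x) \<noteq> 0" for x using assms(3) by (simp add: invertible_det_nz)
  qed
  ultimately show ?thesis by (rule smooth_on_congI[OF _ _ assms(1)])
qed

section \<open>Differentiation of families of linear maps\<close>

lemma fd_linear: "f differentiable (at z) \<Longrightarrow> linear (fd f z)"
  by (rule linear_frechet_derivative)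

lemma fd_chain:
  assumes "(Y has_derivative Y') (at z)" "f differentiable (at (Y z))"
  shows "((\<lambda>x. f (Y x)) has_derivative (\<lambda>v. fd f (Y z) (Y' v))) (at z)"
  using diff_chain_at[of Y Y' z f "fd f (Y z)"] assms by (simp add: frechet_derivative_works o_def)

text \<open>Differentiate the identities \<open>M x (a + b) = M x a + M x b\<close> and
  \<open>M x (r *\<^sub>R a) = r *\<^sub>R M x a\<close>, valid near \<open>z\<close>, and use
  uniqueness of derivatives.\<close>

lemma linear_family_derivative:
  assumes "\<forall>\<^sub>F x in at z. linear (M x)" "linear (M z)"
    and M': "\<And>b. ((\<lambda>x. M x b) has_derivative M' b) (at z)"
  shows "linear (\<lambda>w. M' w v)"
proof (rule linearI)
  fix a b r
  have "((\<lambda>x. M x (a + b)) has_derivative (\<lambda>v. M' a v + M' b v)) (at z)"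
    by (rule has_derivative_transform_eventually[OF has_derivative_add[OF M' M']])
      (use assms(1,2) in \<open>auto elim!: eventually_mono simp: linear_add\<close>)
  from has_derivative_unique[OF M' this] show "M' (a + b) v = M' a v + M' b v" by simp
  have "((\<lambda>x. M x (r *\<^sub>R a)) has_derivative (\<lambda>v. r *\<^sub>R M' a v)) (at z)"
    by (rule has_derivative_transform_eventually[OF has_derivative_scaleR_right[OF M']])
      (use assms(1,2) in \<open>auto elim!: eventually_mono simp: linear_scale\<close>)
  from has_derivative_unique[OF M' this] show "M' (r *\<^sub>R a) v = r *\<^sub>R M' a v" by simp
qed

lemma linear_sum_Basis:
  fixes w :: "'a::euclidean_space"
  assumes "linear M"
  shows "M w = (\<Sum>b\<in>Basis. (w \<bullet> b) *\<^sub>R M b)"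
proof -
  have "M (\<Sum>b\<in>Basis. (w \<bullet> b) *\<^sub>R b) = (\<Sum>b\<in>Basis. (w \<bullet> b) *\<^sub>R M b)"
    using assms by (simp add: linear_sum linear_scale)
  then show ?thesis by (simp only: euclidean_representation)
qed

text \<open>The product rule for evaluating a linear map at a vector when both move. The family is
  differentiated only at fixed vectors \<open>b\<close>, which is how transition maps and anchors
  are given; the expansion of \<open>g x\<close> in the basis reduces everything to these.\<close>

lemma has_derivative_linear_family:
  fixes g :: "'a::real_normed_vector \<Rightarrow> 'b::euclidean_space" and M :: "'a \<Rightarrow> 'b \<Rightarrow> 'c::real_normed_vector"
  assumes ev: "\<forall>\<^sub>F x in at z. linear (M x)" and lin: "linear (M z)"
    and M': "\<And>b. ((\<lambda>x. M x b) has_derivative M' b) (at z)"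
    and g: "(g has_derivative g') (at z)"
  shows "((\<lambda>x. M x (g x)) has_derivative (\<lambda>v. M' (g z) v + M z (g' v))) (at z)"
proof -
  have "((\<lambda>x. \<Sum>b\<in>Basis. (g x \<bullet> b) *\<^sub>R M x b) has_derivative
      (\<lambda>v. \<Sum>b\<in>Basis. (g z \<bullet> b) *\<^sub>R M' b v + (g' v \<bullet> b) *\<^sub>R M z b)) (at z)"
    by (intro has_derivative_sum has_derivative_scaleR has_derivative_inner_left M' g)
  moreover have "(\<Sum>b\<in>Basis. (g z \<bullet> b) *\<^sub>R M' b v + (g' v \<bullet> b) *\<^sub>R M z b) = M' (g z) v + M z (g' v)" for v
    unfolding sum.distrib linear_sum_Basis[OF lin, of "g' v"]
      linear_sum_Basis[OF linear_family_derivative[OF ev lin M'], where w = "g z"] by (rule refl)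
  ultimately have "((\<lambda>x. \<Sum>b\<in>Basis. (g x \<bullet> b) *\<^sub>R M x b) has_derivative
      (\<lambda>v. M' (g z) v + M z (g' v))) (at z)" by simp
  moreover have "\<forall>\<^sub>F x in at z. (\<Sum>b\<in>Basis. (g x \<bullet> b) *\<^sub>R M x b) = M x (g x)"
    using ev by eventually_elim (rule linear_sum_Basis[symmetric])
  ultimately show ?thesis
    by (rule has_derivative_transform_eventually) (auto intro: linear_sum_Basis[OF lin, symmetric])
qed

lemma smooth_on_linear_family:
  fixes g :: "'a::euclidean_space \<Rightarrow> 'b::euclidean_space" and M :: "'a \<Rightarrow> 'b \<Rightarrow> 'c::euclidean_space"
  assumes "open S" "\<And>x. x \<in> S \<Longrightarrow> linear (M x)" "\<And>b. smooth_on S (\<lambda>x. M x b)" "smooth_on S g"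
  shows "smooth_on S (\<lambda>x. M x (g x))"
proof (rule smooth_on_congI[OF _ _ assms(1)])
  show "M x (g x) = (\<Sum>b\<in>Basis. (g x \<bullet> b) *\<^sub>R M x b)" if "x \<in> S" for x
    by (rule linear_sum_Basis[OF assms(2)[OF that]])
  show "smooth_on S (\<lambda>x. \<Sum>b\<in>Basis. (g x \<bullet> b) *\<^sub>R M x b)"
    by (rule smooth_on_sum[OF assms(1) finite_Basis smooth_on_scaleR[OF assms(1)
        smooth_on_inner[OF assms(1,4) smooth_on_const] assms(3)]])
qed

lemma smooth_on_fd:
  fixes f :: "'a::euclidean_space \<Rightarrow> 'b::euclidean_space"
  assumes "open S" "smooth_on S f" "smooth_on S g"
  shows "smooth_on S (\<lambda>x. fd f x (g x))"
  by (rule smooth_on_linear_family[OF assms(1) fd_linear[OF smooth_on_differentiable[OF assms(2)]]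
        smooth_on_fd_const[OF assms(2)] assms(3)])

lemma eventually_at_in_open:
  assumes "(Y has_derivative Y') (at z)" "open T" "Y z \<in> T"
  shows "\<forall>\<^sub>F x in at z. Y x \<in> T"
  using has_derivative_continuous[OF assms(1)] assms(2,3) by (metis continuous_at tendsto_def)

text \<open>Linearity in the inner direction of a second derivative: that direction sits under the
  outer differentiation, so this is an instance of \<open>linear_family_derivative\<close>.\<close>

lemma linear_fd_direction:
  assumes "open T" "smooth_on T f" "y \<in> T"
  shows "linear (\<lambda>w. fd (\<lambda>y. fd f y w) y v)"
proof (rule linear_family_derivative)
  show "\<forall>\<^sub>F x in at y. linear (fd f x)"
    using eventually_at_in_open[OF has_derivative_ident assms(1,3)]
    by eventually_elim (rule fd_linear[OF smooth_on_differentiable[OF assms(2)]])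
qed (use assms in \<open>auto intro: fd_linear smooth_on_differentiable smooth_on_has_derivative smooth_on_fd_const\<close>)

text \<open>Base point and direction both move. The first summand is a second derivative, the second
  one records the change of the direction.\<close>

lemma has_derivative_fd_field:
  assumes "open T" "smooth_on T f" "Y z \<in> T"
    and Y: "(Y has_derivative Y') (at z)" and B: "(B has_derivative B') (at z)"
  shows "((\<lambda>x. fd f (Y x) (B x)) has_derivative
    (\<lambda>v. fd (\<lambda>y. fd f y (B z)) (Y z) (Y' v) + fd f (Y z) (B' v))) (at z)"
proof (rule has_derivative_linear_family[OF _ _ _ B])
  show "\<forall>\<^sub>F x in at z. linear (fd f (Y x))"
    using eventually_at_in_open[OF Y assms(1,3)]
    by eventually_elim (rule fd_linear[OF smooth_on_differentiable[OF assms(2)]])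
  show "linear (fd f (Y z))" by (rule fd_linear[OF smooth_on_differentiable[OF assms(2,3)]])
  show "((\<lambda>x. fd f (Y x) b) has_derivative (\<lambda>v. fd (\<lambda>y. fd f y b) (Y z) (Y' v))) (at z)" for b
    by (rule fd_chain[OF Y smooth_on_differentiable[OF smooth_on_fd_const[OF assms(2)] assms(3)]])
qed

section \<open>Symmetry of second derivatives\<close>

lemma has_real_derivative_line:
  assumes "f differentiable (at (p + t *\<^sub>R v))"
  shows "((\<lambda>t. f (p + t *\<^sub>R v)) has_real_derivative fd f (p + t *\<^sub>R v) v) (at t)"
proof -
  have "((\<lambda>t. p + t *\<^sub>R v) has_derivative (\<lambda>h. h *\<^sub>R v)) (at t)"
    by (auto intro!: derivative_eq_intros)
  from fd_chain[OF this assms] have "((\<lambda>t. f (p + t *\<^sub>R v)) has_derivative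
      (\<lambda>h. fd f (p + t *\<^sub>R v) (h *\<^sub>R v))) (at t)" .
  then show ?thesis
    unfolding linear_scale[OF fd_linear[OF assms]]
    by (rule has_derivative_imp_has_field_derivative) simp
qed

text \<open>The mean value theorem is applied twice: in the direction \<open>v\<close> to the
  difference of \<open>f\<close> along two parallel segments, then in the direction \<open>w\<close>
  to the derivative so obtained.\<close>

lemma second_difference:
  fixes f :: "'a::euclidean_space \<Rightarrow> real"
  assumes "open S" "smooth_on S f" "s > 0"
    and S: "\<And>a b. 0 \<le> a \<Longrightarrow> a \<le> s \<Longrightarrow> 0 \<le> b \<Longrightarrow> b \<le> s \<Longrightarrow> z + a *\<^sub>R v + b *\<^sub>R w \<in> S"
  obtains a b where "0 \<le> a" "a \<le> s" "0 \<le> b" "b \<le> s"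
    "f (z + s *\<^sub>R v + s *\<^sub>R w) - f (z + s *\<^sub>R v) - f (z + s *\<^sub>R w) + f z
      = s * s * fd (\<lambda>y. fd f y v) (z + a *\<^sub>R v + b *\<^sub>R w) w"
proof -
  let ?h = "\<lambda>t. f ((z + s *\<^sub>R w) + t *\<^sub>R v) - f (z + t *\<^sub>R v)"
  have "(?h has_real_derivative fd f ((z + s *\<^sub>R w) + t *\<^sub>R v) v - fd f (z + t *\<^sub>R v) v) (at t)"
    if "0 \<le> t" "t \<le> s" for t
    using S[of t s] S[of t 0] that assms(3)
    by (intro DERIV_diff has_real_derivative_line smooth_on_differentiable[OF assms(2)])
      (simp_all add: algebra_simps)
  from MVT2[OF assms(3) this] obtain a where a: "0 < a" "a < s"
    "?h s - ?h 0 = (s - 0) * (fd f ((z + s *\<^sub>R w) + a *\<^sub>R v) v - fd f (z + a *\<^sub>R v) v)" by blast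
  let ?g = "\<lambda>t. fd f ((z + a *\<^sub>R v) + t *\<^sub>R w) v"
  have "(?g has_real_derivative fd (\<lambda>y. fd f y v) ((z + a *\<^sub>R v) + t *\<^sub>R w) w) (at t)"
    if "0 \<le> t" "t \<le> s" for t
    using S[of a t] that a(1,2)
    by (intro has_real_derivative_line[where f = "\<lambda>y. fd f y v"]
        smooth_on_differentiable[OF smooth_on_fd_const[OF assms(2)]]) simp_all
  from MVT2[OF assms(3) this] obtain b where b: "0 < b" "b < s"
    "?g s - ?g 0 = (s - 0) * fd (\<lambda>y. fd f y v) ((z + a *\<^sub>R v) + b *\<^sub>R w) w" by blast
  have "?h s - ?h 0 = s * (?g s - ?g 0)" using a(3) by (simp add: algebra_simps)
  also have "\<dots> = s * s * fd (\<lambda>y. fd f y v) (z + a *\<^sub>R v + b *\<^sub>R w) w" using b(3) by simp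
  finally have "f (z + s *\<^sub>R v + s *\<^sub>R w) - f (z + s *\<^sub>R v) - f (z + s *\<^sub>R w) + f z
      = s * s * fd (\<lambda>y. fd f y v) (z + a *\<^sub>R v + b *\<^sub>R w) w"
    by (simp add: algebra_simps)
  with a b that show ?thesis by (meson less_imp_le)
qed

text \<open>The second difference is symmetric in \<open>v\<close> and \<open>w\<close>. By
  \<open>second_difference\<close> it equals, up to the factor \<open>s * s\<close>, each of the two
  mixed derivatives at points near \<open>z\<close>, and these are continuous.\<close>

lemma fd_symmetric_real:
  fixes f :: "'a::euclidean_space \<Rightarrow> real"
  assumes "open S" "smooth_on S f" "z \<in> S"
  shows "fd (\<lambda>y. fd f y v) z w = fd (\<lambda>y. fd f y w) z v"
proof (rule ccontr)
  define G where "G v w y = fd (\<lambda>y. fd f y v) y w" for v w y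
  assume "\<not> ?thesis"
  then have ne: "G v w z \<noteq> G w v z" by (simp add: G_def)
  \<comment> \<open>Half of the gap: values closer than \<open>e\<close> to \<open>G v w z\<close>
    and to \<open>G w v z\<close> cannot coincide.\<close>
  define e where "e = \<bar>G v w z - G w v z\<bar> / 2"
  have e: "e > 0" using ne by (simp add: e_def)
  have cont: "isCont (G v w) z" for v w
    unfolding G_def using smooth_on_continuous_on[OF smooth_on_fd_const[OF smooth_on_fd_const[OF assms(2)]]]
    by (rule continuous_on_eq_continuous_at[OF assms(1), THEN iffD1, rule_format, OF _ assms(3)])
  obtain d1 where d1: "d1 > 0" "\<And>y. dist y z < d1 \<Longrightarrow> dist (G v w y) (G v w z) < e"
    using cont[of v w, unfolded continuous_at_eps_delta, rule_format, OF e] by blast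
  obtain d2 where d2: "d2 > 0" "\<And>y. dist y z < d2 \<Longrightarrow> dist (G w v y) (G w v z) < e"
    using cont[of w v, unfolded continuous_at_eps_delta, rule_format, OF e] by blast
  obtain d3 where d3: "d3 > 0" "ball z d3 \<subseteq> S" using assms(1,3) open_contains_ball by blast
  define d where "d = min d1 (min d2 d3)"
  \<comment> \<open>The summand 1 keeps the denominator positive when \<open>v\<close> and
    \<open>w\<close> are 0 and makes the estimate in \<open>small\<close> strict.\<close>
  define s where "s = d / (norm v + norm w + 1)"
  have nz: "norm v + norm w + 1 > 0" by (simp add: add_nonneg_pos)
  have "d > 0" using d1 d2 d3 by (simp add: d_def)
  then have s: "s > 0" unfolding s_def using nz by (rule divide_pos_pos)
  have small: "dist (z + a *\<^sub>R v + b *\<^sub>R w) z < d" if "0 \<le> a" "a \<le> s" "0 \<le> b" "b \<le> s" for a b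
  proof -
    have "dist (z + a *\<^sub>R v + b *\<^sub>R w) z \<le> a * norm v + b * norm w"
      using norm_triangle_ineq[of "a *\<^sub>R v" "b *\<^sub>R w"] that by (simp add: dist_norm)
    also have "\<dots> \<le> s * norm v + s * norm w" using that by (intro add_mono mult_right_mono) auto
    also have "\<dots> < s * (norm v + norm w + 1)" using s by (simp add: algebra_simps)
    also have "\<dots> = d" using nz by (simp add: s_def)
    finally show ?thesis .
  qed
  have inS: "z + a *\<^sub>R v + b *\<^sub>R w \<in> S" if "0 \<le> a" "a \<le> s" "0 \<le> b" "b \<le> s" for a b
    using small[OF that] d3(2) by (auto simp: d_def dist_commute)
  then have inS': "z + a *\<^sub>R w + b *\<^sub>R v \<in> S" if "0 \<le> a" "a \<le> s" "0 \<le> b" "b \<le> s" for a b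
    using inS[OF that(3,4,1,2)] by (simp add: add.commute add.left_commute)
  let ?\<Delta> = "f (z + s *\<^sub>R v + s *\<^sub>R w) - f (z + s *\<^sub>R v) - f (z + s *\<^sub>R w) + f z"
  obtain a b where ab: "0 \<le> a" "a \<le> s" "0 \<le> b" "b \<le> s" "?\<Delta> = s * s * G v w (z + a *\<^sub>R v + b *\<^sub>R w)"
    unfolding G_def by (rule second_difference[OF assms(1,2) s inS])
  obtain a' b' where ab': "0 \<le> a'" "a' \<le> s" "0 \<le> b'" "b' \<le> s"
    "f (z + s *\<^sub>R w + s *\<^sub>R v) - f (z + s *\<^sub>R w) - f (z + s *\<^sub>R v) + f z = s * s * G w v (z + a' *\<^sub>R w + b' *\<^sub>R v)"
    unfolding G_def by (rule second_difference[OF assms(1,2) s inS'])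
  have "f (z + s *\<^sub>R w + s *\<^sub>R v) = f (z + s *\<^sub>R v + s *\<^sub>R w)"
    by (simp only: add.assoc add.commute[of "s *\<^sub>R w"])
  then have "s * s * G v w (z + a *\<^sub>R v + b *\<^sub>R w) = s * s * G w v (z + a' *\<^sub>R w + b' *\<^sub>R v)"
    using ab(5) ab'(5) by linarith
  then have "G v w (z + a *\<^sub>R v + b *\<^sub>R w) = G w v (z + b' *\<^sub>R v + a' *\<^sub>R w)"
    using s by (simp add: add.commute add.left_commute)
  moreover have "dist (G v w (z + a *\<^sub>R v + b *\<^sub>R w)) (G v w z) < e"
    using small[OF ab(1-4)] by (intro d1(2)) (simp add: d_def)
  moreover have "dist (G w v (z + b' *\<^sub>R v + a' *\<^sub>R w)) (G w v z) < e"
    using small[OF ab'(3,4,1,2)] by (intro d2(2)) (simp add: d_def)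
  moreover have "\<bar>G v w z - G w v z\<bar> = 2 * e" by (simp add: e_def)
  ultimately show False unfolding dist_real_def by (simp add: abs_if split: if_splits)
qed

lemma fd_symmetric:
  fixes f :: "'a::euclidean_space \<Rightarrow> 'b::euclidean_space"
  assumes "open S" "smooth_on S f" "z \<in> S"
  shows "fd (\<lambda>y. fd f y v) z w = fd (\<lambda>y. fd f y w) z v"
proof (rule euclidean_eqI)
  fix b :: 'b assume "b \<in> Basis"
  have comp: "fd (\<lambda>y. g y \<bullet> b) y u = fd g y u \<bullet> b" if "smooth_on S g" "y \<in> S" for g :: "'a \<Rightarrow> 'b" and y u
    using fd_eq[OF has_derivative_inner_left[OF smooth_on_has_derivative[OF that]]] by metis
  have "fd (\<lambda>y. fd f y v) z w \<bullet> b = fd (\<lambda>y. fd (\<lambda>y. f y \<bullet> b) y v) z w" for v w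
  proof -
    have "fd (\<lambda>y. fd f y v) z w \<bullet> b = fd (\<lambda>y. fd f y v \<bullet> b) z w"
      using comp[OF smooth_on_fd_const[OF assms(2)] assms(3)] by simp
    also have "fd (\<lambda>y. fd f y v \<bullet> b) z = fd (\<lambda>y. fd (\<lambda>y. f y \<bullet> b) y v) z"
      using comp[OF assms(2)] by (intro fd_cong[OF assms(1,3)]) simp
    finally show ?thesis .
  qed
  moreover have "smooth_on S (\<lambda>y. f y \<bullet> b)"
    using assms by (intro smooth_on_inner smooth_on_const)
  ultimately show "fd (\<lambda>y. fd f y v) z w \<bullet> b = fd (\<lambda>y. fd f y w) z v \<bullet> b"
    using fd_symmetric_real[OF assms(1) _ assms(3)] by metis
qed

section \<open>The Euler--Lagrange operator in local coordinates\<close>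

text \<open>At a point \<open>z = (x, u)\<close>, \<open>R = \<rho>(x)\<close> and \<open>K = C(x)\<close> are the anchor and the bracket of
  constant sections. The left-hand side of the Euler--Lagrange equation along a curve with
  velocity \<open>(\<rho> u, w)\<close>, contracted with \<open>a\<close>:\<close>

definition EL ::
  "((real^'n) \<times> (real^'m) \<Rightarrow> real) \<Rightarrow> (real^'m \<Rightarrow> real^'n) \<Rightarrow> (real^'m \<Rightarrow> real^'m \<Rightarrow> real^'m) \<Rightarrow>
   (real^'n::finite) \<times> (real^'m::finite) \<Rightarrow> real^'m \<Rightarrow> real^'m \<Rightarrow> real" where
  "EL f R K z w a = fd (\<lambda>y. fd f y (0, a)) z (R (snd z), w) - fd f z (R a, 0) + fd f z (0, K a (snd z))"

text \<open>The part of the Euler-Lagrange expression without \<open>w\<close>, as a vector. It is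
  the bracket that g^{-1} multiplies in the formula for G, with the derivatives of mixed type in the
  same order.\<close>

definition EL_force ::
  "((real^'n) \<times> (real^'m) \<Rightarrow> real) \<Rightarrow> (real^'m \<Rightarrow> real^'n) \<Rightarrow> (real^'m \<Rightarrow> real^'m \<Rightarrow> real^'m) \<Rightarrow>
   (real^'n::finite) \<times> (real^'m::finite) \<Rightarrow> real^'m" where
  "EL_force f R K z = (\<chi> b. (\<Sum>i\<in>UNIV. pd_u (pd_x f i) b z * R (snd z) $ i)
     + fd f z (0, K (axis b 1) (snd z)) - fd f z (R (axis b 1), 0))"

text \<open>\<open>- 2 G\<close>.\<close>

definition spray ::
  "((real^'n) \<times> (real^'m) \<Rightarrow> real) \<Rightarrow> (real^'m \<Rightarrow> real^'n) \<Rightarrow> (real^'m \<Rightarrow> real^'m \<Rightarrow> real^'m) \<Rightarrow>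
   (real^'n::finite) \<times> (real^'m::finite) \<Rightarrow> real^'m" where
  "spray f R K z = (- 1/2) *\<^sub>R (matrix_inv (fibre_metric f z) *v EL_force f R K z)"

section \<open>Linear maps in components and linear systems\<close>

lemma vec_axis_sum: "(\<Sum>i\<in>UNIV. v $ i *\<^sub>R (axis i 1 :: real^'n)) = v"
  by (simp add: vec_eq_iff axis_def if_distrib cong: if_cong)

lemma linear_axis_sum: "linear M \<Longrightarrow> M v = (\<Sum>i\<in>UNIV. v $ i *\<^sub>R M (axis i 1))" for v :: "real^'n"
  using arg_cong[OF vec_axis_sum, of M v] by (simp add: linear_sum linear_scale)

lemma linear_Pair_zero: "linear g \<Longrightarrow> linear (\<lambda>a. g (a, 0))" "linear g \<Longrightarrow> linear (\<lambda>a. g (0, a))"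
proof -
  have "linear (\<lambda>a. (a, 0))" "linear (\<lambda>a. (0, a))" by (auto intro!: linearI)
  then show "linear g \<Longrightarrow> linear (\<lambda>a. g (a, 0))" "linear g \<Longrightarrow> linear (\<lambda>a. g (0, a))"
    using linear_compose[of "\<lambda>a. (a, 0)" g] linear_compose[of "\<lambda>a. (0, a)" g] by (simp_all add: o_def)
qed

lemma linear_Pair_split: "linear g \<Longrightarrow> g (a, b) = g (a, 0) + g (0, b)"
  using linear_add[of g "(a, 0)" "(0, b)"] by simp

lemma matrix_inv_solve:
  assumes "invertible (M :: real^'n^'n)"
  shows "M *v w = r \<longleftrightarrow> w = matrix_inv M *v r"
proof
  assume "M *v w = r"
  then have "matrix_inv M *v r = (matrix_inv M ** M) *v w" by (simp flip: matrix_vector_mul_assoc)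
  then show "w = matrix_inv M *v r" by (simp add: matrix_inv_mult[OF assms])
next
  assume "w = matrix_inv M *v r"
  then show "M *v w = r" by (simp add: matrix_vector_mul_assoc matrix_inv_mult[OF assms])
qed

context
  fixes f :: "(real^'n) \<times> (real^'m) \<Rightarrow> real" and \<Omega> :: "((real^'n) \<times> (real^'m)) set"
  assumes \<Omega>: "open \<Omega>" and f: "smooth_on \<Omega> f"
begin

lemma linear_EL:
  assumes "z \<in> \<Omega>" "linear R" "\<And>b. linear (\<lambda>a. K a b)"
  shows "linear (EL f R K z w)"
proof -
  have 1: "linear (\<lambda>a. fd (\<lambda>y. fd f y (0, a)) z (R (snd z), w))"
    by (rule linear_Pair_zero(2)[where g = "\<lambda>v. fd (\<lambda>y. fd f y v) z (R (snd z), w)"])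
      (rule linear_fd_direction[OF \<Omega> f assms(1)])
  have l: "linear (fd f z)" by (rule fd_linear[OF smooth_on_differentiable[OF f assms(1)]])
  have 2: "linear (\<lambda>a. fd f z (R a, 0))"
    using linear_compose[OF assms(2) linear_Pair_zero(1)[OF l]] by (simp add: o_def)
  have 3: "linear (\<lambda>a. fd f z (0, K a (snd z)))"
    using linear_compose[OF assms(3) linear_Pair_zero(2)[OF l]] by (simp add: o_def)
  show ?thesis
    unfolding EL_def by (intro linear_compose_add linear_compose_sub 1 2 3)
qed

text \<open>The velocity splits into \<open>(R (snd z), 0)\<close> and \<open>(0, w)\<close>.
  Symmetry of second derivatives turns the contribution of the first into the mixed derivatives as
  \<open>EL_force\<close> has them, and that of the second into \<open>2 g w\<close>.\<close>

lemma EL_axis: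
  assumes z: "z \<in> \<Omega>"
  shows "EL f R K z w (axis b 1) = 2 * (fibre_metric f z *v w) $ b + EL_force f R K z $ b"
proof -
  have l: "linear (fd (\<lambda>y. fd f y (0, axis b 1)) z)"
    by (rule fd_linear[OF smooth_on_differentiable[OF smooth_on_fd_const[OF f] z]])
  have sym: "fd (\<lambda>y. fd f y v) z w = fd (\<lambda>y. fd f y w) z v" for v w
    by (rule fd_symmetric[OF \<Omega> f z])
  have "fd (\<lambda>y. fd f y (0, axis b 1)) z (R (snd z), 0) = (\<Sum>i\<in>UNIV. pd_u (pd_x f i) b z * R (snd z) $ i)"
  proof -
    have "(\<Sum>i\<in>UNIV. R (snd z) $ i *\<^sub>R fd (\<lambda>y. fd f y (0, axis b 1)) z (axis i 1, 0))
        = (\<Sum>i\<in>UNIV. pd_u (pd_x f i) b z * R (snd z) $ i)"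
    proof (rule sum.cong[OF refl])
      fix i
      show "R (snd z) $ i *\<^sub>R fd (\<lambda>y. fd f y (0, axis b 1)) z (axis i 1, 0)
          = pd_u (pd_x f i) b z * R (snd z) $ i"
        unfolding pd_u_def pd_x_def[abs_def] real_scaleR_def sym[of "(0, axis b 1)" "(axis i 1, 0)"]
        by (rule mult.commute)
    qed
    then show ?thesis by (subst linear_axis_sum[OF linear_Pair_zero(1)[OF l]])
  qed
  moreover have "fd (\<lambda>y. fd f y (0, axis b 1)) z (0, w) = 2 * (fibre_metric f z *v w) $ b"
  proof -
    have "2 * fibre_metric f z $ b $ j = fd (\<lambda>y. fd f y (0, axis b 1)) z (0, axis j 1)" for j
    proof -
      have "2 * fibre_metric f z $ b $ j = fd (\<lambda>y. fd f y (0, axis j 1)) z (0, axis b 1)"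
        unfolding fibre_metric_def vec_lambda_beta pd_u_def[abs_def] by linarith
      also have "\<dots> = fd (\<lambda>y. fd f y (0, axis b 1)) z (0, axis j 1)" by (rule sym)
      finally show ?thesis .
    qed
    note this[symmetric]
    then have "(\<Sum>j\<in>UNIV. w $ j *\<^sub>R fd (\<lambda>y. fd f y (0, axis b 1)) z (0, axis j 1))
        = (\<Sum>j\<in>UNIV. w $ j * (2 * fibre_metric f z $ b $ j))"
      by (intro sum.cong refl) (simp only: real_scaleR_def)
    also have "\<dots> = 2 * (fibre_metric f z *v w) $ b"
      by (simp add: matrix_vector_mult_def sum_distrib_left algebra_simps)
    finally show ?thesis by (subst linear_axis_sum[OF linear_Pair_zero(2)[OF l]])
  qed
  ultimately show ?thesis
    unfolding EL_def EL_force_def by (subst linear_Pair_split[OF l]) simp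
qed

text \<open>By \<open>EL_axis\<close> the left side is the linear system
  \<open>2 g w + EL_force = 0\<close>. One direction shows that the spray is a zero, the other that
  it is the only one.\<close>

lemma EL_axis_eq_0_iff:
  assumes "z \<in> \<Omega>" "invertible (fibre_metric f z)"
  shows "(\<forall>b. EL f R K z w (axis b 1) = 0) \<longleftrightarrow> w = spray f R K z"
proof -
  have "(\<forall>b. EL f R K z w (axis b 1) = 0) \<longleftrightarrow> fibre_metric f z *v w = (- 1/2) *\<^sub>R EL_force f R K z"
  proof -
    have "2 * x + e = 0 \<longleftrightarrow> x = (- 1/2) * e" for x e :: real by auto
    then show ?thesis unfolding EL_axis[OF assms(1)] vec_eq_iff by simp
  qed
  also have "\<dots> \<longleftrightarrow> w = matrix_inv (fibre_metric f z) *v ((- 1/2) *\<^sub>R EL_force f R K z)"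
    by (rule matrix_inv_solve[OF assms(2)])
  finally show ?thesis by (simp only: spray_def matrix_vector_mult_scaleR)
qed

text \<open>Linearity of \<open>EL\<close> in the test vector extends the vanishing from unit
  vectors to all \<open>a\<close>. It is needed because a change of frame does not map unit vectors
  to unit vectors.\<close>

lemma EL_spray:
  assumes "z \<in> \<Omega>" "invertible (fibre_metric f z)" "linear R" "\<And>b. linear (\<lambda>a. K a b)"
  shows "EL f R K z (spray f R K z) a = 0"
proof -
  have "EL f R K z (spray f R K z) (axis b 1) = 0" for b
    using EL_axis_eq_0_iff[OF assms(1,2), of R K "spray f R K z"] by blast
  then show ?thesis
    by (subst linear_axis_sum[OF linear_EL[where K = K, OF assms(1,3,4)]]) simp
qed

lemma smooth_on_pd: "smooth_on \<Omega> (pd_u (pd_x f i) b)" "smooth_on \<Omega> (pd_u (pd_u f a) b)"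
  unfolding pd_u_def[abs_def] pd_x_def[abs_def] by (intro smooth_on_fd_const f)+

lemma smooth_on_spray:
  assumes inv: "\<And>z. z \<in> \<Omega> \<Longrightarrow> invertible (fibre_metric f z)"
    and R: "\<And>z. z \<in> \<Omega> \<Longrightarrow> linear (R (fst z))" "\<And>a. smooth_on \<Omega> (\<lambda>z. R (fst z) a)"
    and K: "\<And>z a. z \<in> \<Omega> \<Longrightarrow> linear (K (fst z) a)" "\<And>a b. smooth_on \<Omega> (\<lambda>z. K (fst z) a b)"
  shows "smooth_on \<Omega> (\<lambda>z. spray f (R (fst z)) (K (fst z)) z)"
proof -
  have snd: "smooth_on \<Omega> (\<lambda>z. snd z)" by (rule smooth_on_snd[OF \<Omega> smooth_on_id])
  have Ru: "smooth_on \<Omega> (\<lambda>z. R (fst z) (snd z))"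
    by (rule smooth_on_linear_family[OF \<Omega> R snd])
  have Ku: "smooth_on \<Omega> (\<lambda>z. K (fst z) a (snd z))" for a
    by (rule smooth_on_linear_family[OF \<Omega> K snd])
  have "smooth_on \<Omega> (\<lambda>z. EL_force f (R (fst z)) (K (fst z)) z)"
    unfolding EL_force_def
    by (rule smooth_on_vec[OF \<Omega> smooth_on_diff[OF \<Omega> smooth_on_add[OF \<Omega> smooth_on_sum[OF \<Omega> finite
      smooth_on_mult[OF \<Omega> smooth_on_pd(1) smooth_on_nth[OF \<Omega> Ru]]]
      smooth_on_fd[OF \<Omega> f smooth_on_Pair[OF \<Omega> smooth_on_const Ku]]]
      smooth_on_fd[OF \<Omega> f smooth_on_Pair[OF \<Omega> R(2) smooth_on_const]]]])
  then have F: "smooth_on \<Omega> (\<lambda>z. EL_force f (R (fst z)) (K (fst z)) z $ i)" for i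
    by (rule smooth_on_nth[OF \<Omega>])
  have "smooth_on \<Omega> (\<lambda>z. fibre_metric f z $ i $ j)" for i j
    unfolding fibre_metric_def vec_lambda_beta by (rule smooth_on_mult[OF \<Omega> smooth_on_const smooth_on_pd(2)])
  from smooth_on_matrix_inv[OF \<Omega> this inv]
  have M: "smooth_on \<Omega> (\<lambda>z. matrix_inv (fibre_metric f z) $ i $ j)" for i j .
  show ?thesis
    unfolding spray_def matrix_vector_mult_def
    by (rule smooth_on_scaleR[OF \<Omega> smooth_on_const smooth_on_vec[OF \<Omega> smooth_on_sum[OF \<Omega> finite
      smooth_on_mult[OF \<Omega> M F]]]])
qed

end

subsection \<open>Change of coordinates\<close>

text \<open>A change of coordinates \<open>\<phi>\<close> on the base together with a change of
  local basis \<open>\<Lambda>\<close>. As in \<open>vector_bundle\<close>, smoothness of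
  \<open>\<Lambda>\<close> is asked for each constant vector separately, so \<open>\<Lambda>\<close>
  is a family of linear maps and not a matrix-valued map.\<close>

locale frame_change =
  fixes X :: "(real^'n::finite) set" and \<phi> :: "real^'n \<Rightarrow> real^'n" and \<Lambda> :: "real^'n \<Rightarrow> real^'m::finite \<Rightarrow> real^'m"
  assumes X: "open X" and \<phi>: "smooth_on X \<phi>" and \<Lambda>: "\<And>w. smooth_on X (\<lambda>x. \<Lambda> x w)"
    and linear_\<Lambda>: "\<And>x. x \<in> X \<Longrightarrow> linear (\<Lambda> x)"
begin

definition \<Phi> :: "(real^'n) \<times> (real^'m) \<Rightarrow> (real^'n) \<times> (real^'m)" where
  "\<Phi> z = (\<phi> (fst z), \<Lambda> (fst z) (snd z))"

definition \<Phi>' :: "(real^'n) \<times> (real^'m) \<Rightarrow> (real^'n) \<times> (real^'m) \<Rightarrow> (real^'n) \<times> (real^'m)" where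
  "\<Phi>' z v = (fd \<phi> (fst z) (fst v), fd (\<lambda>x. \<Lambda> x (snd z)) (fst z) (fst v) + \<Lambda> (fst z) (snd v))"

lemma open_cylinder: "open (X \<times> UNIV)"
  by (rule open_Times[OF X open_UNIV])

lemma smooth_\<Phi>: "smooth_on (X \<times> UNIV) \<Phi>"
proof -
  have fst: "smooth_on (X \<times> UNIV) fst" and snd: "smooth_on (X \<times> UNIV) snd"
    by (simp_all add: smooth_on_linear bounded_linear_fst bounded_linear_snd)
  have "smooth_on (X \<times> UNIV) (\<lambda>z. \<Lambda> (fst z) (snd z))"
  proof (rule smooth_on_linear_family[OF open_cylinder _ _ snd])
    show "smooth_on (X \<times> UNIV) (\<lambda>z. \<Lambda> (fst z) b)" for b
      by (rule smooth_on_compose[OF open_cylinder X _ fst \<Lambda>]) auto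
  qed (auto intro: linear_\<Lambda>)
  moreover have "smooth_on (X \<times> UNIV) (\<lambda>z. \<phi> (fst z))"
    by (rule smooth_on_compose[OF open_cylinder X _ fst \<phi>]) auto
  ultimately show ?thesis
    unfolding \<Phi>_def[abs_def] by (intro smooth_on_Pair[OF open_cylinder])
qed

lemma linear_D\<Lambda>:
  assumes "x \<in> X"
  shows "linear (\<lambda>w. fd (\<lambda>x. \<Lambda> x w) x h)"
proof (rule linear_family_derivative)
  show "\<forall>\<^sub>F y in at x. linear (\<Lambda> y)"
    using eventually_at_in_open[OF has_derivative_ident X assms] by eventually_elim (rule linear_\<Lambda>)
qed (use assms linear_\<Lambda> smooth_on_has_derivative[OF \<Lambda>] in auto)

lemma has_derivative_\<Phi>:
  assumes "fst z \<in> X"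
  shows "(\<Phi> has_derivative \<Phi>' z) (at z)"
proof -
  have fst: "(fst has_derivative fst) (at z)" and snd: "(snd has_derivative snd) (at z)"
    by (rule bounded_linear_imp_has_derivative, rule bounded_linear_fst bounded_linear_snd)+
  have "\<forall>\<^sub>F y in at z. linear (\<Lambda> (fst y))"
    using eventually_at_in_open[OF fst X assms] by eventually_elim (rule linear_\<Lambda>)
  from has_derivative_linear_family[OF this linear_\<Lambda>[OF assms]
      fd_chain[OF fst smooth_on_differentiable[OF \<Lambda> assms]] snd]
  show ?thesis
    unfolding \<Phi>_def[abs_def] \<Phi>'_def[abs_def]
    by (intro has_derivative_Pair fd_chain[OF fst smooth_on_differentiable[OF \<phi> assms]])
qed

lemma fd_\<Phi>: "fst z \<in> X \<Longrightarrow> fd \<Phi> z = \<Phi>' z"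
  by (rule fd_eq[OF has_derivative_\<Phi>])

text \<open>The vector \<open>w\<close> is replaced by the fibre component of
  \<open>\<Phi>' z (R u, w)\<close>, as the coordinate velocity of a curve would be. In the new
  coordinates the first summand of \<open>EL\<close> acquires the term (D\<Lambda> a)(\<rho> u), the
  second - (D\<Lambda> u)(\<rho> a), and the third, by the law of \<open>K\<close>, the same two
  terms with opposite signs, each under the fibre derivative of \<open>f'\<close>; they
  cancel.\<close>

lemma EL_change:
  assumes \<Omega>: "open \<Omega>" "z \<in> \<Omega>" "\<Omega> \<subseteq> X \<times> UNIV" and \<Omega>': "open \<Omega>'" "\<Phi> ` \<Omega> \<subseteq> \<Omega>'"
    and f': "smooth_on \<Omega>' f'" and f: "\<And>y. y \<in> \<Omega> \<Longrightarrow> f y = f' (\<Phi> y)"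
    and R: "\<And>b. R' (\<Lambda> (fst z) b) = fd \<phi> (fst z) (R b)"
    and K: "\<And>a b. \<Lambda> (fst z) (K a b) = K' (\<Lambda> (fst z) a) (\<Lambda> (fst z) b)
        + fd (\<lambda>x. \<Lambda> x b) (fst z) (R a) - fd (\<lambda>x. \<Lambda> x a) (fst z) (R b)"
  shows "EL f' R' K' (\<Phi> z) (fd (\<lambda>x. \<Lambda> x (snd z)) (fst z) (R (snd z)) + \<Lambda> (fst z) w) (\<Lambda> (fst z) a) = EL f R K z w a"
proof -
  define x u where "x = fst z" and "u = snd z"
  have x: "x \<in> X" using \<Omega> by (auto simp: x_def)
  have \<Phi>z: "\<Phi> z \<in> \<Omega>'" using \<Omega> \<Omega>' by auto
  have df: "fd f y v = fd f' (\<Phi> y) (\<Phi>' y v)" if "y \<in> \<Omega>" for y v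
  proof -
    have "fd f y = fd (\<lambda>y. f' (\<Phi> y)) y" by (rule fd_cong[OF \<Omega>(1) that f])
    also have "\<dots> = (\<lambda>v. fd f' (\<Phi> y) (\<Phi>' y v))"
      by (rule fd_eq[OF fd_chain[OF has_derivative_\<Phi> smooth_on_differentiable[OF f']]])
        (use that \<Omega> \<Omega>' in auto)
    finally show ?thesis by simp
  qed
  have l': "linear (fd f' (\<Phi> z))" by (rule fd_linear[OF smooth_on_differentiable[OF f' \<Phi>z]])
  have \<Phi>'0: "\<Phi>' y (0, a) = (0, \<Lambda> (fst y) a)" if "y \<in> \<Omega>" for y a
  proof -
    have "fst y \<in> X" using that \<Omega> by auto
    then show ?thesis
      using linear_0[OF fd_linear[OF smooth_on_differentiable[OF \<phi>]]]
        linear_0[OF fd_linear[OF smooth_on_differentiable[OF \<Lambda>]]] by (simp add: \<Phi>'_def)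
  qed
  have fst: "(fst has_derivative fst) (at z)"
    by (rule bounded_linear_imp_has_derivative, rule bounded_linear_fst)
  \<comment> \<open>The constant test vector \<open>a\<close> becomes the non-constant
    \<open>\<Lambda> (fst y) a\<close>; its derivative is the correction term in
    \<open>1\<close>.\<close>
  have "((\<lambda>y. (0, \<Lambda> (fst y) a)) has_derivative (\<lambda>v. (0, fd (\<lambda>x. \<Lambda> x a) x (fst v)))) (at z)"
    using fd_chain[OF fst smooth_on_differentiable[OF \<Lambda>], of a] x unfolding x_def
    by (intro has_derivative_Pair has_derivative_const) auto
  from has_derivative_fd_field[OF \<Omega>'(1) f' \<Phi>z has_derivative_\<Phi> this] x
  have "((\<lambda>y. fd f' (\<Phi> y) (0, \<Lambda> (fst y) a)) has_derivative
      (\<lambda>v. fd (\<lambda>y. fd f' y (0, \<Lambda> x a)) (\<Phi> z) (\<Phi>' z v) + fd f' (\<Phi> z) (0, fd (\<lambda>x. \<Lambda> x a) x (fst v)))) (at z)"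
    by (simp add: x_def)
  from fd_eq[OF this] fd_cong[OF \<Omega>(1,2), of "\<lambda>y. fd f y (0, a)" "\<lambda>y. fd f' (\<Phi> y) (0, \<Lambda> (fst y) a)"]
  have 1: "fd (\<lambda>y. fd f y (0, a)) z v
      = fd (\<lambda>y. fd f' y (0, \<Lambda> x a)) (\<Phi> z) (\<Phi>' z v) + fd f' (\<Phi> z) (0, fd (\<lambda>x. \<Lambda> x a) x (fst v))" for v
    by (simp add: df \<Phi>'0)
  have 2: "fd f z (R a, 0) = fd f' (\<Phi> z) (R' (\<Lambda> x a), 0) + fd f' (\<Phi> z) (0, fd (\<lambda>x. \<Lambda> x u) x (R a))"
    unfolding df[OF \<Omega>(2)] \<Phi>'_def x_def u_def R
    by (subst linear_Pair_split[OF l']) (simp add: linear_0[OF linear_\<Lambda>[OF x, unfolded x_def]])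
  have 3: "fd f z (0, K a u) = fd f' (\<Phi> z) (0, K' (\<Lambda> x a) (\<Lambda> x u))
      + fd f' (\<Phi> z) (0, fd (\<lambda>x. \<Lambda> x u) x (R a)) - fd f' (\<Phi> z) (0, fd (\<lambda>x. \<Lambda> x a) x (R u))"
  proof -
    have "fd f z (0, K a u) = fd f' (\<Phi> z) (0, \<Lambda> x (K a u))"
      unfolding df[OF \<Omega>(2)] \<Phi>'0[OF \<Omega>(2)] x_def by (rule refl)
    then show ?thesis
      unfolding K[of a u, folded x_def] linear_diff[OF linear_Pair_zero(2)[OF l']]
        linear_add[OF linear_Pair_zero(2)[OF l']] .
  qed
  have \<Phi>'w: "\<Phi>' z (R u, w) = (R' (\<Lambda> x u), fd (\<lambda>x. \<Lambda> x u) x (R u) + \<Lambda> x w)"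
    unfolding \<Phi>'_def x_def u_def R by simp
  have "snd (\<Phi> z) = \<Lambda> x u" by (simp add: \<Phi>_def x_def u_def)
  then show ?thesis
    unfolding EL_def 1 x_def[symmetric] u_def[symmetric] 2 3 \<Phi>'w by (simp only: fst_conv)
qed

text \<open>By \<open>EL_change\<close> the right side is a zero of the Euler-Lagrange expression in
  the new coordinates, surjectivity of \<open>\<Lambda>\<close> lets the test vector be arbitrary,
  and the zero is unique.\<close>

lemma spray_change:
  assumes \<Omega>: "open \<Omega>" "z \<in> \<Omega>" "\<Omega> \<subseteq> X \<times> UNIV" and \<Omega>': "open \<Omega>'" "\<Phi> ` \<Omega> \<subseteq> \<Omega>'"
    and f': "smooth_on \<Omega>' f'" and f: "\<And>y. y \<in> \<Omega> \<Longrightarrow> f y = f' (\<Phi> y)" "smooth_on \<Omega> f"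
    and R: "\<And>b. R' (\<Lambda> (fst z) b) = fd \<phi> (fst z) (R b)"
    and K: "\<And>a b. \<Lambda> (fst z) (K a b) = K' (\<Lambda> (fst z) a) (\<Lambda> (fst z) b)
        + fd (\<lambda>x. \<Lambda> x b) (fst z) (R a) - fd (\<lambda>x. \<Lambda> x a) (fst z) (R b)"
    and inv: "invertible (fibre_metric f z)" "invertible (fibre_metric f' (\<Phi> z))"
    and lin: "linear R" "\<And>b. linear (\<lambda>a. K a b)" and surj: "surj (\<Lambda> (fst z))"
  shows "spray f' R' K' (\<Phi> z) = fd (\<lambda>x. \<Lambda> x (snd z)) (fst z) (R (snd z)) + \<Lambda> (fst z) (spray f R K z)"
proof -
  let ?w = "fd (\<lambda>x. \<Lambda> x (snd z)) (fst z) (R (snd z)) + \<Lambda> (fst z) (spray f R K z)"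
  have "EL f' R' K' (\<Phi> z) ?w b = 0" for b
  proof -
    obtain a where "b = \<Lambda> (fst z) a" using surj by blast
    then show ?thesis
      using EL_change[OF \<Omega> \<Omega>' f' f(1) R K] EL_spray[OF \<Omega>(1) f(2) \<Omega>(2) inv(1) lin] by simp
  qed
  then show ?thesis
    using EL_axis_eq_0_iff[OF \<Omega>'(1) f' _ inv(2), of R' K' ?w] \<Omega>(2) \<Omega>'(2) by auto
qed

text \<open>The law \<open>change\<close> is differentiated along the fibre over a fixed base point.
  There \<open>\<Phi>\<close> is linear, and the inhomogeneous term is a bilinear form evaluated on
  the diagonal, so its derivative consists of two terms with \<open>b\<close> in either
  slot.\<close>

lemma fd_spray_change:
  assumes \<Omega>: "open \<Omega>" "z \<in> \<Omega>" "\<Omega> \<subseteq> X \<times> UNIV"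
    and W: "W differentiable (at z)" "W' differentiable (at (\<Phi> z))"
    and change: "\<And>y. y \<in> \<Omega> \<Longrightarrow> W' (\<Phi> y) = fd (\<lambda>x. \<Lambda> x (snd y)) (fst y) (R (fst y) (snd y)) + \<Lambda> (fst y) (W y)"
    and R: "linear (R (fst z))"
  shows "fd W' (\<Phi> z) (0, \<Lambda> (fst z) b) = fd (\<lambda>x. \<Lambda> x b) (fst z) (R (fst z) (snd z))
    + fd (\<lambda>x. \<Lambda> x (snd z)) (fst z) (R (fst z) b) + \<Lambda> (fst z) (fd W z (0, b))"
proof -
  define x u where "x = fst z" and "u = snd z"
  have x: "x \<in> X" using \<Omega> by (auto simp: x_def)
  have z: "z = (x, u)" by (simp add: x_def u_def)
  have lin: "(g has_derivative g) (at v)" if "linear g" for g :: "real^'m \<Rightarrow> 'z::euclidean_space" and v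
    using that by (simp add: bounded_linear_imp_has_derivative linear_conv_bounded_linear)
  have line: "((\<lambda>v. (x, v)) has_derivative (\<lambda>b. (0, b))) (at u)"
    by (intro has_derivative_Pair has_derivative_const has_derivative_ident)
  have "((\<lambda>v. \<Phi> (x, v)) has_derivative (\<lambda>b. (0, \<Lambda> x b))) (at u)"
    unfolding \<Phi>_def by (simp add: has_derivative_Pair has_derivative_const lin linear_\<Lambda>[OF x])
  from fd_chain[OF this] W(2)
  have 1: "((\<lambda>v. W' (\<Phi> (x, v))) has_derivative (\<lambda>b. fd W' (\<Phi> z) (0, \<Lambda> x b))) (at u)"
    by (simp add: z)
  have 2: "((\<lambda>v. fd (\<lambda>x. \<Lambda> x v) x (R x v)) has_derivative
      (\<lambda>b. fd (\<lambda>x. \<Lambda> x b) x (R x u) + fd (\<lambda>x. \<Lambda> x u) x (R x b))) (at u)"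
  proof (rule has_derivative_linear_family[where M = "\<lambda>v. fd (\<lambda>x. \<Lambda> x v) x" and g = "R x"
        and M' = "\<lambda>h b. fd (\<lambda>x. \<Lambda> x b) x h"])
    show l: "linear (fd (\<lambda>x. \<Lambda> x v) x)" for v
      by (rule fd_linear[OF smooth_on_differentiable[OF \<Lambda> x]])
    show "\<forall>\<^sub>F v in at u. linear (fd (\<lambda>x. \<Lambda> x v) x)" using l by (rule always_eventually[OF allI])
    show "((\<lambda>v. fd (\<lambda>x. \<Lambda> x v) x h) has_derivative (\<lambda>b. fd (\<lambda>x. \<Lambda> x b) x h)) (at u)" for h
      by (rule lin[OF linear_D\<Lambda>[OF x]])
    show "(R x has_derivative R x) (at u)"
      using R lin unfolding x_def by blast
  qed
  have 3: "((\<lambda>v. W (x, v)) has_derivative (\<lambda>b. fd W z (0, b))) (at u)"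
    using fd_chain[OF line, of W] W(1) by (simp add: z)
  have 4: "((\<lambda>v. \<Lambda> x (W (x, v))) has_derivative (\<lambda>b. \<Lambda> x (fd W z (0, b)))) (at u)"
    using bounded_linear.has_derivative[OF linear_\<Lambda>[OF x, unfolded linear_conv_bounded_linear] 3] .
  have ev: "\<forall>\<^sub>F v in at u. (x, v) \<in> \<Omega>"
    using eventually_at_in_open[OF line \<Omega>(1)] \<Omega>(2) by (simp add: z)
  have "((\<lambda>v. W' (\<Phi> (x, v))) has_derivative
      (\<lambda>b. fd (\<lambda>x. \<Lambda> x b) x (R x u) + fd (\<lambda>x. \<Lambda> x u) x (R x b) + \<Lambda> x (fd W z (0, b)))) (at u)"
    by (rule has_derivative_transform_eventually[OF has_derivative_add[OF 2 4]])
      (use ev change \<Omega>(2) in \<open>auto elim!: eventually_mono simp: z\<close>)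
  from has_derivative_unique[OF 1 this] show ?thesis
    by (metis (no_types) x_def u_def)
qed

text \<open>Horizontal lift with the coefficients \<open>N + s/2 C\<close>, where \<open>W = - 2 G\<close>: the case \<open>s = 0\<close>
  needs \<open>(D\<Lambda> b)(\<rho> u)\<close> to be symmetric in \<open>b\<close> and \<open>u\<close>, the case \<open>s = 1\<close> is the transformation law
  of the structure functions.\<close>

lemma horizontal_change:
  assumes \<Omega>: "open \<Omega>" "z \<in> \<Omega>" "\<Omega> \<subseteq> X \<times> UNIV"
    and W: "W differentiable (at z)" "W' differentiable (at (\<Phi> z))"
    and change: "\<And>y. y \<in> \<Omega> \<Longrightarrow> W' (\<Phi> y) = fd (\<lambda>x. \<Lambda> x (snd y)) (fst y) (R (fst y) (snd y)) + \<Lambda> (fst y) (W y)"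
    and lin: "linear (R (fst z))"
    and R: "R' (\<Lambda> (fst z) b) = fd \<phi> (fst z) (R (fst z) b)"
    and K: "s *\<^sub>R (\<Lambda> (fst z) (K b (snd z)) - K' (\<Lambda> (fst z) b) (\<Lambda> (fst z) (snd z)))
      = fd (\<lambda>x. \<Lambda> x (snd z)) (fst z) (R (fst z) b) - fd (\<lambda>x. \<Lambda> x b) (fst z) (R (fst z) (snd z))"
  shows "\<Phi>' z (R (fst z) b, (1/2) *\<^sub>R fd W z (0, b) - (s/2) *\<^sub>R K b (snd z))
    = (R' (\<Lambda> (fst z) b), (1/2) *\<^sub>R fd W' (\<Phi> z) (0, \<Lambda> (fst z) b) - (s/2) *\<^sub>R K' (\<Lambda> (fst z) b) (snd (\<Phi> z)))"
proof -
  define x u where "x = fst z" and "u = snd z"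
  have "x \<in> X" using \<Omega> by (auto simp: x_def)
  note l = linear_\<Lambda>[OF this]
  let ?A = "fd (\<lambda>x. \<Lambda> x u) x (R x b)" and ?B = "fd (\<lambda>x. \<Lambda> x b) x (R x u)"
    and ?k = "\<Lambda> x (K b u)" and ?k' = "K' (\<Lambda> x b) (\<Lambda> x u)" and ?w = "\<Lambda> x (fd W z (0, b))"
  have K2: "?A = s *\<^sub>R (?k - ?k') + ?B" using K by (simp add: x_def u_def)
  have "?A + \<Lambda> x ((1/2) *\<^sub>R fd W z (0, b) - (s/2) *\<^sub>R K b u) = ?A + (1/2) *\<^sub>R ?w - (s/2) *\<^sub>R ?k"
    by (simp add: linear_diff[OF l] linear_scale[OF l])
  \<comment> \<open>Write \<open>?A\<close> as half of \<open>?A + ?B\<close> plus half of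
    \<open>?A - ?B\<close>. The first half is the inhomogeneous part of the law of
    \<open>W'\<close>, and by \<open>K2\<close> the second is \<open>s/2\<close> times the
    difference of \<open>?k\<close> and \<open>?k'\<close>.\<close>
  also have "\<dots> = (1/2) *\<^sub>R (?B + ?A + ?w) - (s/2) *\<^sub>R ?k'"
  proof (rule vec_eq_iff[THEN iffD2, rule_format])
    fix i
    have "?A $ i = s * ?k $ i - s * ?k' $ i + ?B $ i"
      using arg_cong[OF K2, of "\<lambda>v. v $ i"] by (simp add: right_diff_distrib)
    then show "(?A + (1/2) *\<^sub>R ?w - (s/2) *\<^sub>R ?k) $ i = ((1/2) *\<^sub>R (?B + ?A + ?w) - (s/2) *\<^sub>R ?k') $ i"
      by (simp add: add_divide_distrib diff_divide_distrib)
  qed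
  finally show ?thesis
    using fd_spray_change[OF \<Omega> W change lin] R
    unfolding \<Phi>'_def \<Phi>_def fst_conv snd_conv x_def u_def by (metis (no_types))
qed

end

section \<open>Charts and tangent vectors\<close>

locale atlas =
  fixes A :: "('p, 'x::euclidean_space) chart set"
  assumes smooth_atlas: "smooth_atlas A"
begin

abbreviation trans :: "('p, 'x) chart \<Rightarrow> ('p, 'x) chart \<Rightarrow> 'x \<Rightarrow> 'x" where
  "trans c d \<equiv> cmap d \<circ> cinv c"

lemma inj_cmap: "c \<in> A \<Longrightarrow> inj_on (cmap c) (cdom c)"
  using smooth_atlas by (auto simp: smooth_atlas_def)

lemma cinv_cmap: "c \<in> A \<Longrightarrow> p \<in> cdom c \<Longrightarrow> cinv c (cmap c p) = p"
  by (simp add: cinv_def inj_cmap)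

lemma mopen_cdom: "c \<in> A \<Longrightarrow> mopen A (cdom c)"
  using smooth_atlas by (auto simp: smooth_atlas_def mopen_def carrier_of_def Int_commute)

lemma mopen_Int: "mopen A S \<Longrightarrow> mopen A T \<Longrightarrow> mopen A (S \<inter> T)"
  using openin_Int[of "atlas_topology A" S T] by (simp add: openin_atlas_topology[OF smooth_atlas])

lemma mopen_open_image: "mopen A S \<Longrightarrow> c \<in> A \<Longrightarrow> S \<subseteq> cdom c \<Longrightarrow> open (cmap c ` S)"
  by (auto simp: mopen_def Int_absorb2)

lemma smooth_trans:
  assumes "c \<in> A" "d \<in> A" "U \<subseteq> cdom c \<inter> cdom d"
  shows "smooth_on (cmap c ` U) (trans c d)"
proof (rule smooth_on_subset)
  show "smooth_on (cmap c ` (cdom c \<inter> cdom d)) (trans c d)"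
    using smooth_atlas assms(1,2) by (simp add: smooth_atlas_def)
qed (use assms(3) in blast)

lemma has_derivative_trans:
  assumes "c \<in> A" "d \<in> A" "p \<in> cdom c" "p \<in> cdom d"
  shows "(trans c d has_derivative fd (trans c d) (cmap c p)) (at (cmap c p))"
  by (rule smooth_on_has_derivative[OF smooth_trans[OF assms(1,2) subset_refl]]) (use assms in auto)

lemma linear_fd_trans:
  assumes "c \<in> A" "d \<in> A" "p \<in> cdom c" "p \<in> cdom d"
  shows "linear (fd (trans c d) (cmap c p))"
  using has_derivative_trans[OF assms] by (rule has_derivative_linear)

lemma fd_trans_self:
  assumes "c \<in> A" "p \<in> cdom c"
  shows "fd (trans c c) (cmap c p) = (\<lambda>v. v)"
proof -
  have "fd (trans c c) (cmap c p) = fd (\<lambda>x. x) (cmap c p)"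
    by (rule fd_cong[OF mopen_open_image[OF mopen_cdom]]) (use assms in \<open>auto simp: cinv_cmap\<close>)
  then show ?thesis by (simp add: fd_eq[OF has_derivative_ident])
qed

text \<open>With \<open>g = cmap e\<close> this is the cocycle rule.\<close>

lemma fd_trans_compose:
  assumes "c \<in> A" "d \<in> A" "p \<in> cdom c" "p \<in> cdom d"
    and "(g \<circ> cinv d) differentiable (at (cmap d p))"
  shows "fd (g \<circ> cinv c) (cmap c p) v = fd (g \<circ> cinv d) (cmap d p) (fd (trans c d) (cmap c p) v)"
proof -
  have "fd (g \<circ> cinv c) (cmap c p) = fd (\<lambda>x. (g \<circ> cinv d) (trans c d x)) (cmap c p)"
    by (rule fd_cong[OF mopen_open_image[OF mopen_Int[OF mopen_cdom[of c] mopen_cdom[of d]]]])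
      (use assms in \<open>auto simp: cinv_cmap\<close>)
  also have "\<dots> = (\<lambda>v. fd (g \<circ> cinv d) (cmap d p) (fd (trans c d) (cmap c p) v))"
    using fd_eq[OF fd_chain[OF has_derivative_trans[OF assms(1-4)], of "g \<circ> cinv d"]] assms
    by (simp add: cinv_cmap)
  finally show ?thesis by simp
qed

lemma tangentD:
  assumes v: "v \<in> tangent A p" and cd: "c \<in> A" "d \<in> A" "p \<in> cdom c" "p \<in> cdom d"
  shows "v d = fd (trans c d) (cmap c p) (v c)"
proof -
  from v have "\<forall>c\<in>A. \<forall>d\<in>A. p \<in> cdom c \<and> p \<in> cdom d \<longrightarrow> v d = fd (trans c d) (cmap c p) (v c)"
    unfolding tangent_def mem_Collect_eq by (rule conjunct2)
  then show ?thesis using cd by (elim ballE impE) (assumption | erule notE | rule conjI)+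
qed

lemma tangent_zero:
  assumes v: "v \<in> tangent A p" and c: "\<not> (c \<in> A \<and> p \<in> cdom c)"
  shows "v c = 0"
proof -
  from v have "\<forall>c. c \<notin> A \<or> p \<notin> cdom c \<longrightarrow> v c = 0"
    unfolding tangent_def mem_Collect_eq by (rule conjunct1)
  then show ?thesis using c by blast
qed

lemma tangentI:
  assumes "\<And>c. \<not> (c \<in> A \<and> p \<in> cdom c) \<Longrightarrow> v c = 0"
    and "\<And>c d. c \<in> A \<Longrightarrow> d \<in> A \<Longrightarrow> p \<in> cdom c \<Longrightarrow> p \<in> cdom d \<Longrightarrow> v d = fd (trans c d) (cmap c p) (v c)"
  shows "v \<in> tangent A p"
  unfolding tangent_def
proof (intro CollectI conjI allI impI ballI)
  show "c \<notin> A \<or> p \<notin> cdom c \<Longrightarrow> v c = 0" for c using assms(1)[of c] by blast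
  show "c \<in> A \<Longrightarrow> d \<in> A \<Longrightarrow> p \<in> cdom c \<and> p \<in> cdom d \<Longrightarrow> v d = fd (trans c d) (cmap c p) (v c)" for c d
    by (elim conjE) (rule assms(2))
qed

lemma coord_vec_apply:
  "d \<in> A \<Longrightarrow> p \<in> cdom d \<Longrightarrow> coord_vec A c p w d = fd (trans c d) (cmap c p) w"
  by (simp add: coord_vec_def)

lemma coord_vec_in_tangent:
  assumes "c \<in> A" "p \<in> cdom c"
  shows "coord_vec A c p w \<in> tangent A p"
proof (rule tangentI)
  fix d e assume de: "d \<in> A" "e \<in> A" "p \<in> cdom d" "p \<in> cdom e"
  have "fd (trans c e) (cmap c p) w = fd (trans d e) (cmap d p) (fd (trans c d) (cmap c p) w)"
    by (rule fd_trans_compose[OF assms(1) de(1) assms(2) de(3)])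
      (use has_derivative_trans[OF de] in \<open>auto simp: differentiable_def\<close>)
  then show "coord_vec A c p w e = fd (trans d e) (cmap d p) (coord_vec A c p w d)"
    by (simp only: coord_vec_apply[OF de(1,3)] coord_vec_apply[OF de(2,4)])
qed (auto simp: coord_vec_def)

lemma coord_vec_same: "c \<in> A \<Longrightarrow> p \<in> cdom c \<Longrightarrow> coord_vec A c p w c = w"
  by (simp add: coord_vec_apply fd_trans_self)

text \<open>Together with \<open>coord_vec_same\<close>: components in one chart around
  \<open>p\<close> are an isomorphism of the tangent space with the coordinate space. All later
  identities between tangent vectors are checked in one chart this way.\<close>

lemma tangent_eq_coord_vec:
  assumes "v \<in> tangent A p" "c \<in> A" "p \<in> cdom c"
  shows "coord_vec A c p (v c) = v"
proof
  fix d show "coord_vec A c p (v c) d = v d"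
    using tangentD[OF assms(1,2) _ assms(3), of d] tangent_zero[OF assms(1), of d]
    by (cases "d \<in> A \<and> p \<in> cdom d") (auto simp: coord_vec_def simp del: o_apply)
qed

lemma coord_vec_change:
  assumes "c \<in> A" "d \<in> A" "p \<in> cdom c" "p \<in> cdom d"
  shows "coord_vec A c p w = coord_vec A d p (fd (trans c d) (cmap c p) w)"
proof -
  have "coord_vec A d p (coord_vec A c p w d) = coord_vec A c p w"
    by (rule tangent_eq_coord_vec[OF coord_vec_in_tangent[OF assms(1,3)] assms(2,4)])
  then show ?thesis unfolding coord_vec_apply[OF assms(2,4)] by (rule sym)
qed

lemma linear_coord_vec:
  assumes "c \<in> A" "p \<in> cdom c"
  shows "linear (coord_vec A c p)"
proof (rule linearI)
  note l = linear_fd_trans[OF assms(1) _ assms(2)]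
  show "coord_vec A c p (v + w) = coord_vec A c p v + coord_vec A c p w" for v w
  proof
    fix d show "coord_vec A c p (v + w) d = (coord_vec A c p v + coord_vec A c p w) d"
      using linear_add[OF l, of d v w] by (cases "d \<in> A \<and> p \<in> cdom d") (auto simp: coord_vec_def)
  qed
  show "coord_vec A c p (r *\<^sub>R v) = r *\<^sub>R coord_vec A c p v" for r v
  proof
    fix d show "coord_vec A c p (r *\<^sub>R v) d = (r *\<^sub>R coord_vec A c p v) d"
      using linear_scale[OF l, of d r v]
      by (cases "d \<in> A \<and> p \<in> cdom d") (auto simp: coord_vec_def scaleR_fun_def)
  qed
qed

lemma inj_coord_vec: "c \<in> A \<Longrightarrow> p \<in> cdom c \<Longrightarrow> inj (coord_vec A c p)"
proof (rule injI)
  fix v w assume c: "c \<in> A" "p \<in> cdom c" and eq: "coord_vec A c p v = coord_vec A c p w"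
  have "v = coord_vec A c p v c" by (rule coord_vec_same[OF c, symmetric])
  also have "\<dots> = w" unfolding eq by (rule coord_vec_same[OF c])
  finally show "v = w" .
qed

lemma subspace_tangent: "subspace (tangent A p)"
proof (rule subspaceI)
  show "0 \<in> tangent A p"
    by (rule tangentI) (auto simp: linear_0[OF linear_fd_trans])
next
  fix v w assume v: "v \<in> tangent A p" and w: "w \<in> tangent A p"
  show "v + w \<in> tangent A p"
  proof (rule tangentI)
    fix c d assume cd: "c \<in> A" "d \<in> A" "p \<in> cdom c" "p \<in> cdom d"
    show "(v + w) d = fd (trans c d) (cmap c p) ((v + w) c)"
      unfolding plus_fun_def linear_add[OF linear_fd_trans[OF cd]] tangentD[OF v cd] tangentD[OF w cd] by (rule refl)
  qed (simp add: tangent_zero[OF v] tangent_zero[OF w])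
next
  fix v r assume v: "v \<in> tangent A p"
  show "r *\<^sub>R v \<in> tangent A p"
  proof (rule tangentI)
    fix c d assume cd: "c \<in> A" "d \<in> A" "p \<in> cdom c" "p \<in> cdom d"
    show "(r *\<^sub>R v) d = fd (trans c d) (cmap c p) ((r *\<^sub>R v) c)"
      unfolding scaleR_fun_def linear_scale[OF linear_fd_trans[OF cd]] tangentD[OF v cd] by (rule refl)
  qed (simp add: scaleR_fun_def tangent_zero[OF v])
qed

text \<open>The definite description in \<open>tangent_deriv\<close> is justified by the cocycle
  rule: all charts around \<open>p\<close> give the same number.\<close>

lemma tangent_deriv_eq:
  fixes f :: "'p \<Rightarrow> real"
  assumes "v \<in> tangent A p" "c \<in> A" "p \<in> cdom c"
    and "\<And>d. d \<in> A \<Longrightarrow> p \<in> cdom d \<Longrightarrow> (f \<circ> cinv d) differentiable (at (cmap d p))"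
  shows "tangent_deriv A f p v = fd (f \<circ> cinv c) (cmap c p) (v c)"
  unfolding tangent_deriv_def
proof (rule the_equality)
  show "\<forall>d\<in>A. p \<in> cdom d \<longrightarrow> fd (f \<circ> cinv c) (cmap c p) (v c) = fd (f \<circ> cinv d) (cmap d p) (v d)"
  proof (intro ballI impI)
    fix d assume d: "d \<in> A" "p \<in> cdom d"
    show "fd (f \<circ> cinv c) (cmap c p) (v c) = fd (f \<circ> cinv d) (cmap d p) (v d)"
      unfolding tangentD[OF assms(1,2) d(1) assms(3) d(2)]
      by (rule fd_trans_compose[OF assms(2) d(1) assms(3) d(2) assms(4)[OF d]])
  qed
  show "r = fd (f \<circ> cinv c) (cmap c p) (v c)"
    if "\<forall>d\<in>A. p \<in> cdom d \<longrightarrow> r = fd (f \<circ> cinv d) (cmap d p) (v d)" for r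
    by (rule that[rule_format, OF assms(2,3)])
qed

subsection \<open>Smooth functions and vector fields\<close>

lemma smooth_fun_chart:
  "smooth_fun A S g \<Longrightarrow> c \<in> A \<Longrightarrow> U \<subseteq> S \<inter> cdom c \<Longrightarrow> smooth_on (cmap c ` U) (g \<circ> cinv c)"
  unfolding smooth_fun_def
  by (rule smooth_on_subset[of "cmap c ` (S \<inter> cdom c)"], erule (1) bspec, erule image_mono)

lemma smooth_fun_subset: "smooth_fun A S g \<Longrightarrow> T \<subseteq> S \<Longrightarrow> smooth_fun A T g"
  unfolding smooth_fun_def[of _ T] by (intro ballI, erule (1) smooth_fun_chart) blast

text \<open>One chart around each point suffices: in another chart \<open>d\<close> the function is
  the composition of its expression in \<open>c\<close> with the smooth map
  \<open>trans d c\<close>.\<close>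

lemma smooth_fun_local:
  fixes g :: "'p \<Rightarrow> 'b::euclidean_space"
  assumes "\<And>p. p \<in> S \<Longrightarrow> \<exists>c\<in>A. \<exists>U. mopen A U \<and> p \<in> U \<and> U \<subseteq> cdom c \<and> smooth_on (cmap c ` U) (g \<circ> cinv c)"
  shows "smooth_fun A S g"
  unfolding smooth_fun_def
proof (intro ballI smooth_on_local)
  fix d x assume d: "d \<in> A" and "x \<in> cmap d ` (S \<inter> cdom d)"
  then obtain p where p: "p \<in> S" "p \<in> cdom d" "x = cmap d p" by auto
  obtain c U where c: "c \<in> A" and U: "mopen A U" "p \<in> U" "U \<subseteq> cdom c"
    and g: "smooth_on (cmap c ` U) (g \<circ> cinv c)"
    using assms[OF p(1)] by blast
  have o: "open (cmap d ` (U \<inter> cdom d))"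
    by (rule mopen_open_image[OF mopen_Int[OF U(1) mopen_cdom[OF d]] d]) auto
  have "smooth_on (cmap d ` (U \<inter> cdom d)) (\<lambda>x. (g \<circ> cinv c) (trans d c x))"
    using U c d
    by (intro smooth_on_compose[OF o mopen_open_image[OF U(1) c U(3)] _ smooth_trans g])
      (auto simp: cinv_cmap)
  then have "smooth_on (cmap d ` (U \<inter> cdom d)) (g \<circ> cinv d)"
    by (rule smooth_on_congI[rotated, OF _ o]) (use c d U(3) in \<open>auto simp: cinv_cmap\<close>)
  with o p U show "\<exists>V. open V \<and> x \<in> V \<and> smooth_on V (g \<circ> cinv d)" by blast
qed

text \<open>Components in another chart are the Jacobian applied to the components in
  \<open>c\<close>, and \<open>smooth_on_fd\<close> allows for the moving direction.\<close>

lemma smooth_vector_field_local: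
  assumes tan: "\<And>p. p \<in> W \<Longrightarrow> \<xi> p \<in> tangent A p"
    and loc: "\<And>p. p \<in> W \<Longrightarrow> \<exists>c\<in>A. \<exists>U. mopen A U \<and> p \<in> U \<and> U \<subseteq> W \<inter> cdom c \<and>
      smooth_on (cmap c ` U) (\<lambda>x. \<xi> (cinv c x) c)"
  shows "smooth_vector_field A W \<xi>"
  unfolding smooth_vector_field_def
proof (intro conjI ballI smooth_fun_local)
  fix d p assume d: "d \<in> A" and p: "p \<in> W \<inter> cdom d"
  obtain c U where c: "c \<in> A" and U: "mopen A U" "p \<in> U" "U \<subseteq> W \<inter> cdom c"
    and \<xi>: "smooth_on (cmap c ` U) (\<lambda>x. \<xi> (cinv c x) c)"
    using loc p by blast
  let ?U = "U \<inter> cdom d"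
  have U': "mopen A ?U" by (rule mopen_Int[OF U(1) mopen_cdom[OF d]])
  have o: "open (cmap c ` ?U)" by (rule mopen_open_image[OF U' c]) (use U in auto)
  have "smooth_on (cmap c ` ?U) (\<lambda>x. fd (trans c d) x (\<xi> (cinv c x) c))"
    using U by (intro smooth_on_fd[OF o smooth_trans[OF c d] smooth_on_subset[OF \<xi>]]) auto
  then have "smooth_on (cmap c ` ?U) ((\<lambda>p. \<xi> p d) \<circ> cinv c)"
  proof (rule smooth_on_congI[rotated, OF _ o])
    fix x assume "x \<in> cmap c ` ?U"
    then obtain q where q: "q \<in> U" "q \<in> cdom d" "x = cmap c q" by auto
    moreover have "q \<in> W" "q \<in> cdom c" using q U(3) by auto
    ultimately show "((\<lambda>p. \<xi> p d) \<circ> cinv c) x = fd (trans c d) x (\<xi> (cinv c x) c)"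
      using c d tangentD[OF tan, of q c d] by (simp add: cinv_cmap)
  qed
  moreover have "p \<in> ?U" "?U \<subseteq> cdom c" using p U by auto
  ultimately show "\<exists>c\<in>A. \<exists>U. mopen A U \<and> p \<in> U \<and> U \<subseteq> cdom c \<and> smooth_on (cmap c ` U) ((\<lambda>p. \<xi> p d) \<circ> cinv c)"
    using U' c by blast
qed (rule tan)

end

section \<open>Splittings given by local frames\<close>

text \<open>The sections \<open>h j \<cdot> a\<close> and \<open>v j \<cdot> b\<close> over \<open>P j\<close> are the local frames of the horizontal and of
  the vertical subbundle.\<close>

lemma whitney_splitting_unique_ex:
  fixes h :: "'j \<Rightarrow> 'e \<Rightarrow> real^'m::finite \<Rightarrow> 'v::real_vector" and v :: "'j \<Rightarrow> 'e \<Rightarrow> real^'k::finite \<Rightarrow> 'v"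
  assumes cover: "\<And>e. e \<in> W \<Longrightarrow> \<exists>j\<in>J. e \<in> P j"
    and mopen: "\<And>j. j \<in> J \<Longrightarrow> mopen B (W \<inter> P j)"
    and lin: "\<And>j e. j \<in> J \<Longrightarrow> e \<in> W \<inter> P j \<Longrightarrow> linear (h j e)"
      "\<And>j e. j \<in> J \<Longrightarrow> e \<in> W \<inter> P j \<Longrightarrow> linear (v j e)"
    and Q: "\<And>j e. j \<in> J \<Longrightarrow> e \<in> W \<inter> P j \<Longrightarrow> Q e = {h j e a + v j e b | a b. True}"
    and V: "\<And>j e. j \<in> J \<Longrightarrow> e \<in> W \<inter> P j \<Longrightarrow> V e = range (v j e)"
    and indep: "\<And>j e a b. j \<in> J \<Longrightarrow> e \<in> W \<inter> P j \<Longrightarrow> h j e a = v j e b \<Longrightarrow> a = 0"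
    and smooth: "\<And>j a. j \<in> J \<Longrightarrow> smooth (W \<inter> P j) (\<lambda>e. h j e (axis a 1))"
    and compat: "\<And>i j e. i \<in> J \<Longrightarrow> j \<in> J \<Longrightarrow> e \<in> W \<inter> P i \<Longrightarrow> e \<in> P j \<Longrightarrow> range (h i e) \<subseteq> range (h j e)"
  shows "\<exists>!H. whitney_splitting B W Q V smooth H \<and> (\<forall>j\<in>J. \<forall>e\<in>W \<inter> P j. H `` {e} = range (h j e))"
proof -
  \<comment> \<open>The union of the local ranges. Applying \<open>compat\<close> to both orders of
    two indices makes these ranges equal on overlaps, so the fibre of \<open>H\<close> does not
    depend on the index.\<close>
  define H where "H = {(e, w). e \<in> W \<and> (\<exists>j\<in>J. e \<in> P j \<and> w \<in> range (h j e))}"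
  have H: "H `` {e} = range (h j e)" if "j \<in> J" "e \<in> W \<inter> P j" for j e
  proof -
    have "w \<in> range (h j e)" if "i \<in> J" "e \<in> P i" "w \<in> range (h i e)" for i w
      using compat[of i j e] that \<open>j \<in> J\<close> \<open>e \<in> W \<inter> P j\<close> by blast
    then have "(e, w) \<in> H \<longleftrightarrow> w \<in> range (h j e)" for w
      using that unfolding H_def mem_Collect_eq case_prod_conv by (metis IntD1 IntD2)
    then show ?thesis by (simp add: set_eq_iff)
  qed
  have axis_span: "span (range (\<lambda>a. axis a 1 :: real^'m)) = UNIV"
  proof -
    have "Basis = range (\<lambda>a. axis a 1 :: real^'m)" by (auto simp: Basis_vec_def)
    then show ?thesis using span_Basis by metis
  qed
  have "whitney_splitting B W Q V smooth H"
    unfolding whitney_splitting_def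
  proof (intro conjI ballI)
    show "H \<subseteq> Sigma W Q"
    proof
      fix ew assume "ew \<in> H"
      then obtain e j a where e: "e \<in> W" "j \<in> J" "e \<in> P j" "ew = (e, h j e a)" unfolding H_def by auto
      have "h j e a = h j e a + v j e 0" using linear_0[OF lin(2)] e by simp
      then have "h j e a \<in> Q e" using Q[of j e] e by blast
      then show "ew \<in> Sigma W Q" using e by simp
    qed
  next
    fix e assume e: "e \<in> W"
    then obtain j where j: "j \<in> J" "e \<in> W \<inter> P j" using cover by blast
    show "subspace (H `` {e})"
      unfolding H[OF j] by (rule linear_subspace_image[OF lin(1)[OF j] subspace_UNIV])
    show "H `` {e} \<inter> V e = {0}"
    proof
      show "H `` {e} \<inter> V e \<subseteq> {0}"
        unfolding H[OF j] V[OF j] using indep[OF j] linear_0[OF lin(1)[OF j]] by auto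
      have "0 = h j e 0" "0 = v j e 0" using linear_0 lin[OF j] by metis+
      then show "{0} \<subseteq> H `` {e} \<inter> V e" unfolding H[OF j] V[OF j] by blast
    qed
    show "Q e = {a + b |a b. a \<in> H `` {e} \<and> b \<in> V e}"
      unfolding H[OF j] V[OF j] Q[OF j] by auto
    \<comment> \<open>The local frame consists of the images of the unit vectors. As
      \<open>S\<close> is a set of sections, its members must stay distinct at every point, which
      follows from the injectivity of \<open>h j e'\<close>.\<close>
    define S where "S = range (\<lambda>a e. h j e (axis a 1))"
    have inj: "inj (h j e')" if "e' \<in> W \<inter> P j" for e'
    proof (rule linear_injective_0[OF lin(1)[OF j(1) that], THEN iffD2], intro allI impI)
      fix a assume "h j e' a = 0"
      then have "h j e' a = v j e' 0" using linear_0[OF lin(2)[OF j(1) that]] by simp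
      then show "a = 0" by (rule indep[OF j(1) that])
    qed
    have "inj_on (\<lambda>s. s e') S \<and> independent ((\<lambda>s. s e') ` S) \<and> span ((\<lambda>s. s e') ` S) = H `` {e'}"
      if e': "e' \<in> W \<inter> P j" for e'
    proof (intro conjI)
      have im: "(\<lambda>s. s e') ` S = h j e' ` range (\<lambda>a. axis a 1)" by (auto simp: S_def)
      show "inj_on (\<lambda>s. s e') S"
        unfolding S_def inj_on_def by (auto dest!: injD[OF inj[OF e']] simp: axis_eq_axis)
      have "independent (range (\<lambda>a. axis a 1 :: real^'m))"
        using independent_Basis by (rule independent_mono) (auto simp: Basis_vec_def)
      then show "independent ((\<lambda>s. s e') ` S)"
        unfolding im by (rule linear_independent_injective_image[OF lin(1)[OF j(1) e'] _ inj_on_subset[OF inj[OF e'] subset_UNIV]])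
      show "span ((\<lambda>s. s e') ` S) = H `` {e'}"
        unfolding im H[OF j(1) e'] by (simp add: linear_span_image[OF lin(1)[OF j(1) e']] axis_span)
    qed
    moreover have "finite S" "\<forall>s\<in>S. smooth (W \<inter> P j) s" using smooth[OF j(1)] by (auto simp: S_def)
    ultimately show "\<exists>W' S. e \<in> W' \<and> W' \<subseteq> W \<and> mopen B W' \<and> finite S \<and> (\<forall>s\<in>S. smooth W' s) \<and>
        (\<forall>e'\<in>W'. inj_on (\<lambda>s. s e') S \<and> independent ((\<lambda>s. s e') ` S) \<and> span ((\<lambda>s. s e') ` S) = H `` {e'})"
      using j mopen[OF j(1)] by (intro exI[of _ "W \<inter> P j"] exI[of _ S]) auto
  qed
  with H have "whitney_splitting B W Q V smooth H \<and> (\<forall>j\<in>J. \<forall>e\<in>W \<inter> P j. H `` {e} = range (h j e))" by blast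
  moreover have "H' = H"
    if H': "whitney_splitting B W Q V smooth H' \<and> (\<forall>j\<in>J. \<forall>e\<in>W \<inter> P j. H' `` {e} = range (h j e))" for H'
  proof (rule set_eqI)
    \<comment> \<open>Over \<open>W\<close> the fibres of \<open>H'\<close> are prescribed; this
      inclusion excludes further elements over points outside \<open>W\<close>.\<close>
    have sub: "H' \<subseteq> Sigma W Q" using H' by (simp add: whitney_splitting_def)
    fix ew :: "'e \<times> 'v"
    obtain e w where ew: "ew = (e, w)" by fastforce
    show "ew \<in> H' \<longleftrightarrow> ew \<in> H"
    proof (cases "e \<in> W")
      case True
      then obtain j where "j \<in> J" "e \<in> W \<inter> P j" using cover by blast
      then have "H' `` {e} = H `` {e}" using H H' by blast
      then show ?thesis using ew by blast
    qed (use sub ew in \<open>auto simp: H_def\<close>)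
  qed
  ultimately show ?thesis by (rule ex1I)
qed

section \<open>Charts of the total space of a vector bundle\<close>

text \<open>\<open>J\<close> selects the pairs of a chart and a trivialization that define the atlas \<open>B\<close> of the
  total space.\<close>

locale bundle_atlas = atlas A
  for A :: "('p, real^'n::finite) chart set" +
  fixes F :: "'p \<Rightarrow> 'f::real_vector set" and T :: "('p, 'f, 'm::finite) triv set"
    and J :: "(('p, real^'n) chart \<times> ('p, 'f, 'm) triv) set"
    and B :: "('p \<times> 'f, (real^'n) \<times> (real^'m)) chart set"
  assumes vector_bundle: "vector_bundle A F T" and J: "J \<subseteq> A \<times> T"
    and cover: "\<And>p. p \<in> carrier_of A \<Longrightarrow> \<exists>c t. (c, t) \<in> J \<and> p \<in> cdom c \<inter> fst t"
    and B: "B = (\<lambda>(c, t). bundle_chart F c t) ` J"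
begin

abbreviation ch :: "('p, real^'n) chart \<Rightarrow> ('p, 'f, 'm) triv \<Rightarrow> ('p \<times> 'f, (real^'n) \<times> (real^'m)) chart" where
  "ch \<equiv> bundle_chart F"

lemma chart_J: "(c, t) \<in> J \<Longrightarrow> c \<in> A" and triv_J: "(c, t) \<in> J \<Longrightarrow> t \<in> T"
  using J by auto

lemma ch_in_B: "(c, t) \<in> J \<Longrightarrow> ch c t \<in> B"
  unfolding B by force

lemma B_cases: "C \<in> B \<Longrightarrow> (\<And>c t. (c, t) \<in> J \<Longrightarrow> C = ch c t \<Longrightarrow> P) \<Longrightarrow> P"
  unfolding B by auto

subsection \<open>Trivializations\<close>

lemma mopen_triv: "t \<in> T \<Longrightarrow> mopen A (fst t)"
  using vector_bundle by (simp add: vector_bundle_def)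

lemma triv_carrier: "t \<in> T \<Longrightarrow> p \<in> fst t \<Longrightarrow> p \<in> carrier_of A"
  using mopen_triv[of t] by (auto simp: mopen_def)

lemma subspace_fibre: "p \<in> carrier_of A \<Longrightarrow> subspace (F p)"
  using vector_bundle by (simp add: vector_bundle_def)

context
  fixes t p assumes t: "t \<in> T" and p: "p \<in> fst t"
begin

lemma bij_triv: "bij_betw (snd t p) (F p) UNIV"
  using vector_bundle t p unfolding vector_bundle_def by blast

lemma triv_triv_section: "snd t p (triv_section F t u p) = u"
  unfolding triv_section_def by (rule bij_betw_inv_into_right[OF bij_triv UNIV_I])

lemma triv_section_in: "triv_section F t u p \<in> F p"
  unfolding triv_section_def using bij_triv by (simp add: bij_betw_def inv_into_into)

lemma triv_section_triv: "f \<in> F p \<Longrightarrow> triv_section F t (snd t p f) p = f"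
  unfolding triv_section_def by (rule bij_betw_inv_into_left[OF bij_triv])

lemma triv_eqI: "f \<in> F p \<Longrightarrow> g \<in> F p \<Longrightarrow> snd t p f = snd t p g \<Longrightarrow> f = g"
  using bij_triv by (auto simp: bij_betw_def dest: inj_onD)

lemma triv_add: "f \<in> F p \<Longrightarrow> g \<in> F p \<Longrightarrow> snd t p (f + g) = snd t p f + snd t p g"
  and triv_scale: "f \<in> F p \<Longrightarrow> snd t p (r *\<^sub>R f) = r *\<^sub>R snd t p f"
  using vector_bundle t p unfolding vector_bundle_def by blast+

text \<open>The inverse of a bijection that is linear only on the subspace \<open>F p\<close>: both
  sides of each identity lie in \<open>F p\<close> and have the same fibre coordinates.\<close>

lemma linear_triv_section: "linear (\<lambda>u. triv_section F t u p)"
proof (rule linearI)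
  note s = subspace_fibre[OF triv_carrier[OF t p]]
  show "triv_section F t (u + v) p = triv_section F t u p + triv_section F t v p" for u v
    by (rule triv_eqI[OF triv_section_in subspace_add[OF s triv_section_in triv_section_in]])
      (simp only: triv_add[OF triv_section_in triv_section_in] triv_triv_section)
  show "triv_section F t (r *\<^sub>R u) p = r *\<^sub>R triv_section F t u p" for r u
    by (rule triv_eqI[OF triv_section_in subspace_scale[OF s triv_section_in]])
      (simp only: triv_scale[OF triv_section_in] triv_triv_section)
qed

lemma triv_eq_0_iff:
  assumes "f \<in> F p"
  shows "snd t p f = 0 \<longleftrightarrow> f = 0"
proof -
  have "triv_section F t 0 p = 0" by (rule linear_0[OF linear_triv_section])
  then show ?thesis using triv_triv_section[of 0] triv_section_triv[OF assms] by metis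
qed

end

subsection \<open>Transition maps\<close>

lemma ch_dom: "e \<in> cdom (ch c t) \<longleftrightarrow> fst e \<in> cdom c \<and> fst e \<in> fst t \<and> snd e \<in> F (fst e)"
  by (cases e) (auto simp: bundle_chart_def)

lemma cmap_ch: "cmap (ch c t) e = (cmap c (fst e), snd t (fst e) (snd e))"
  by (simp add: bundle_chart_def)

lemma cinv_ch:
  assumes "(c, t) \<in> J" "p \<in> cdom c" "p \<in> fst t"
  shows "cinv (ch c t) (cmap c p, u) = (p, triv_section F t u p)"
    and "(p, triv_section F t u p) \<in> cdom (ch c t)"
proof -
  note [simp] = triv_triv_section[OF triv_J[OF assms(1)] assms(3)]
    triv_section_in[OF triv_J[OF assms(1)] assms(3)]
  show d: "(p, triv_section F t u p) \<in> cdom (ch c t)" using assms by (simp add: ch_dom)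
  have "inj_on (cmap (ch c t)) (cdom (ch c t))"
  proof (rule inj_onI)
    fix e e' assume e: "e \<in> cdom (ch c t)" "e' \<in> cdom (ch c t)" "cmap (ch c t) e = cmap (ch c t) e'"
    then have "fst e = fst e'"
      using inj_cmap[OF chart_J[OF assms(1)]] by (auto simp: ch_dom cmap_ch dest: inj_onD)
    moreover from this have "snd e = snd e'"
      using e triv_eqI[OF triv_J[OF assms(1)], of "fst e" "snd e" "snd e'"] by (simp add: ch_dom cmap_ch)
    ultimately show "e = e'" by (simp add: prod_eq_iff)
  qed
  from inv_into_f_eq[OF this d] show "cinv (ch c t) (cmap c p, u) = (p, triv_section F t u p)"
    by (simp add: cinv_def cmap_ch)
qed

text \<open>Fibre coordinates are bijective and vanish only at the zero vector, so removing the zero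
  section punctures the coordinate fibre at 0.\<close>

lemma image_ch:
  assumes "(c, t) \<in> J" "S \<subseteq> cdom c \<inter> fst t"
  shows "cmap (ch c t) ` {e. fst e \<in> S \<and> snd e \<in> F (fst e)} = (cmap c ` S) \<times> UNIV"
    and "cmap (ch c t) ` {e. fst e \<in> S \<and> snd e \<in> F (fst e) \<and> snd e \<noteq> 0} = (cmap c ` S) \<times> (- {0})"
proof -
  have *: "(cmap c p, u) = cmap (ch c t) (p, triv_section F t u p)" "triv_section F t u p \<in> F p"
    "triv_section F t u p = 0 \<longleftrightarrow> u = 0" if "p \<in> S" for p u
    using triv_section_in[OF triv_J[OF assms(1)], of p u] triv_triv_section[OF triv_J[OF assms(1)], of p u]
      triv_eq_0_iff[OF triv_J[OF assms(1)], of p "triv_section F t u p"] that assms(2)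
    by (auto simp: cmap_ch)
  show "cmap (ch c t) ` {e. fst e \<in> S \<and> snd e \<in> F (fst e)} = (cmap c ` S) \<times> UNIV"
  proof (intro equalityI subsetI)
    fix z assume "z \<in> (cmap c ` S) \<times> (UNIV :: (real^'m) set)"
    then obtain p u where p: "p \<in> S" "z = (cmap c p, u)" by auto
    then show "z \<in> cmap (ch c t) ` {e. fst e \<in> S \<and> snd e \<in> F (fst e)}"
      using *(2)[OF p(1), of u] unfolding p(2) *(1)[OF p(1), of u] by (intro imageI) simp
  qed (auto simp: cmap_ch)
  show "cmap (ch c t) ` {e. fst e \<in> S \<and> snd e \<in> F (fst e) \<and> snd e \<noteq> 0} = (cmap c ` S) \<times> (- {0})"
  proof (intro equalityI subsetI)
    fix z assume "z \<in> (cmap c ` S) \<times> (- {0 :: real^'m})"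
    then obtain p u where p: "p \<in> S" "z = (cmap c p, u)" "u \<noteq> 0" by auto
    then show "z \<in> cmap (ch c t) ` {e. fst e \<in> S \<and> snd e \<in> F (fst e) \<and> snd e \<noteq> 0}"
      using *(2,3)[OF p(1), of u] unfolding p(2) *(1)[OF p(1), of u] by (intro imageI) simp
  next
    fix z assume "z \<in> cmap (ch c t) ` {e. fst e \<in> S \<and> snd e \<in> F (fst e) \<and> snd e \<noteq> 0}"
    then obtain p f where "p \<in> S" "f \<in> F p" "f \<noteq> 0" "z = (cmap c p, snd t p f)" by (auto simp: cmap_ch)
    then show "z \<in> (cmap c ` S) \<times> (- {0})"
      using triv_eq_0_iff[OF triv_J[OF assms(1)], of p f] assms(2) by auto
  qed
qed

text \<open>The transition map from the local basis \<open>t\<close> to \<open>t'\<close>, expressed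
  in the base coordinates \<open>c\<close>; it plays the role of \<open>\<Lambda>\<close> in
  \<open>frame_change\<close>.\<close>

definition lam :: "('p, real^'n) chart \<Rightarrow> ('p, 'f, 'm) triv \<Rightarrow> ('p, 'f, 'm) triv \<Rightarrow> real^'n \<Rightarrow> real^'m \<Rightarrow> real^'m" where
  "lam c t t' x u = snd t' (cinv c x) (triv_section F t u (cinv c x))"

abbreviation overlap :: "('p, real^'n) chart \<Rightarrow> ('p, 'f, 'm) triv \<Rightarrow> ('p, real^'n) chart \<Rightarrow> ('p, 'f, 'm) triv \<Rightarrow> 'p set" where
  "overlap c t c' t' \<equiv> (cdom c \<inter> fst t) \<inter> (cdom c' \<inter> fst t')"

lemma mopen_overlap: "(c, t) \<in> J \<Longrightarrow> (c', t') \<in> J \<Longrightarrow> mopen A (overlap c t c' t')"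
  by (intro mopen_Int mopen_cdom mopen_triv chart_J triv_J)

lemma lam_cmap: "c \<in> A \<Longrightarrow> p \<in> cdom c \<Longrightarrow> lam c t t' (cmap c p) u = snd t' p (triv_section F t u p)"
  by (simp add: lam_def cinv_cmap)

lemma frame_change_lam:
  assumes "(c, t) \<in> J" "(c', t') \<in> J"
  shows "frame_change (cmap c ` overlap c t c' t') (trans c c') (lam c t t')"
proof (rule frame_change.intro)
  note c = chart_J[OF assms(1)] chart_J[OF assms(2)] and t = triv_J[OF assms(1)] triv_J[OF assms(2)]
  show "open (cmap c ` overlap c t c' t')"
    by (rule mopen_open_image[OF mopen_overlap[OF assms] c(1)]) auto
  show "smooth_on (cmap c ` overlap c t c' t') (trans c c')"
    by (rule smooth_trans[OF c]) auto
  show "smooth_on (cmap c ` overlap c t c' t') (\<lambda>x. lam c t t' x w)" for w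
  proof -
    have "smooth_fun A (fst t \<inter> fst t') (\<lambda>p. snd t' p (triv_section F t w p))"
      using vector_bundle t unfolding vector_bundle_def by blast
    from smooth_fun_chart[OF this c(1), of "overlap c t c' t'"] show ?thesis
      by (simp add: lam_def o_def le_infI1 le_infI2)
  qed
  fix x assume "x \<in> cmap c ` overlap c t c' t'"
  then obtain p where p: "p \<in> cdom c" "p \<in> fst t" "p \<in> fst t'" "x = cmap c p" by auto
  note i = triv_section_in[OF t(1) p(2)] and l = linear_triv_section[OF t(1) p(2)]
  show "linear (lam c t t' x)"
    unfolding p(4) lam_cmap[OF c(1) p(1), abs_def]
    by (rule linearI)
      (simp_all only: linear_add[OF l] linear_scale[OF l] triv_add[OF t(2) p(3) i i] triv_scale[OF t(2) p(3) i])
qed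

lemma lam_triv:
  assumes "(c, t) \<in> J" "p \<in> cdom c" "p \<in> fst t" "f \<in> F p"
  shows "lam c t t' (cmap c p) (snd t p f) = snd t' p f"
  unfolding lam_cmap[OF chart_J[OF assms(1)] assms(2)] triv_section_triv[OF triv_J[OF assms(1)] assms(3,4)]
  by (rule refl)

lemma triv_section_lam:
  assumes "(c, t) \<in> J" "t' \<in> T" "p \<in> cdom c" "p \<in> fst t" "p \<in> fst t'"
  shows "triv_section F t' (lam c t t' (cmap c p) u) p = triv_section F t u p"
  unfolding lam_cmap[OF chart_J[OF assms(1)] assms(3)]
  by (rule triv_section_triv[OF assms(2,5) triv_section_in[OF triv_J[OF assms(1)] assms(4)]])

lemma surj_lam:
  assumes "(c, t) \<in> J" "t' \<in> T" "p \<in> cdom c" "p \<in> fst t" "p \<in> fst t'"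
  shows "surj (lam c t t' (cmap c p))"
proof (rule surjI)
  show "lam c t t' (cmap c p) (snd t p (triv_section F t' u p)) = u" for u
    unfolding lam_triv[OF assms(1,3,4) triv_section_in[OF assms(2,5)]] by (rule triv_triv_section[OF assms(2,5)])
qed

lemma trans_ch:
  assumes "(c, t) \<in> J" "(c', t') \<in> J" "p \<in> overlap c t c' t'"
  shows "(cmap (ch c' t') \<circ> cinv (ch c t)) (cmap c p, u) = frame_change.\<Phi> (trans c c') (lam c t t') (cmap c p, u)"
proof -
  interpret ft: frame_change "cmap c ` overlap c t c' t'" "trans c c'" "lam c t t'"
    by (rule frame_change_lam[OF assms(1,2)])
  show ?thesis
    using assms by (simp add: ft.\<Phi>_def cinv_ch cmap_ch cinv_cmap chart_J lam_cmap)
qed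

lemma overlap_ch: "cdom (ch c t) \<inter> cdom (ch c' t') = {e. fst e \<in> overlap c t c' t' \<and> snd e \<in> F (fst e)}"
  by (auto simp: ch_dom)

text \<open>In bundle charts the coordinate changes are the maps \<open>\<Phi>\<close>. Hence the
  calculus of tangent vectors holds a second time, for the total space.\<close>

sublocale tot: atlas B
proof
  show "smooth_atlas B"
    unfolding smooth_atlas_def
  proof (intro conjI ballI)
    fix C assume "C \<in> B"
    then obtain c t where C: "(c, t) \<in> J" "C = ch c t" by (rule B_cases)
    show "inj_on (cmap C) (cdom C)"
    proof (rule inj_on_inverseI)
      fix e assume "e \<in> cdom C"
      then show "cinv C (cmap C e) = e"
        using C cinv_ch(1)[OF C(1), of "fst e"] triv_section_triv[OF triv_J[OF C(1)], of "fst e" "snd e"]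
        by (simp add: ch_dom cmap_ch)
    qed
    fix C' assume "C' \<in> B"
    then obtain c' t' where C': "(c', t') \<in> J" "C' = ch c' t'" by (rule B_cases)
    interpret ft: frame_change "cmap c ` overlap c t c' t'" "trans c c'" "lam c t t'"
      by (rule frame_change_lam[OF C(1) C'(1)])
    have im: "cmap C ` (cdom C \<inter> cdom C') = (cmap c ` overlap c t c' t') \<times> UNIV"
      unfolding C C' overlap_ch by (rule image_ch[OF C(1)]) auto
    show "open (cmap C ` (cdom C \<inter> cdom C'))" unfolding im by (rule ft.open_cylinder)
    show "smooth_on (cmap C ` (cdom C \<inter> cdom C')) (cmap C' \<circ> cinv C)"
      unfolding im
    proof (rule smooth_on_congI[OF _ ft.smooth_\<Phi> ft.open_cylinder])
      fix z :: "(real^'n) \<times> (real^'m)" assume "z \<in> (cmap c ` overlap c t c' t') \<times> UNIV"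
      then obtain p u where "p \<in> overlap c t c' t'" "z = (cmap c p, u)" by auto
      then show "(cmap C' \<circ> cinv C) z = ft.\<Phi> z"
        using trans_ch[OF C(1) C'(1)] C(2) C'(2) by simp
    qed
  next
    fix C assume "C \<in> B"
    then obtain c t where C: "(c, t) \<in> J" "C = ch c t" by (rule B_cases)
    have "cdom C = {e. fst e \<in> cdom c \<inter> fst t \<and> snd e \<in> F (fst e)}"
      by (auto simp: C ch_dom)
    then have "cmap C ` cdom C = (cmap c ` (cdom c \<inter> fst t)) \<times> UNIV"
      using image_ch(1)[OF C(1) subset_refl] C(2) by simp
    moreover have "open (cmap c ` (cdom c \<inter> fst t))"
      by (rule mopen_open_image[OF mopen_Int[OF mopen_cdom mopen_triv]])
        (use C chart_J triv_J in auto)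
    ultimately show "open (cmap C ` cdom C)" by (simp add: open_Times)
  qed
qed

lemma fd_trans_ch:
  assumes "(c, t) \<in> J" "(c', t') \<in> J" "e \<in> cdom (ch c t)" "e \<in> cdom (ch c' t')"
  shows "fd (cmap (ch c' t') \<circ> cinv (ch c t)) (cmap (ch c t) e)
    = frame_change.\<Phi>' (trans c c') (lam c t t') (cmap (ch c t) e)"
proof -
  interpret ft: frame_change "cmap c ` overlap c t c' t'" "trans c c'" "lam c t t'"
    by (rule frame_change_lam[OF assms(1,2)])
  let ?z = "cmap (ch c t) e"
  have z: "fst ?z \<in> cmap c ` overlap c t c' t'" using assms(3,4) by (auto simp: ch_dom cmap_ch)
  have "fd (cmap (ch c' t') \<circ> cinv (ch c t)) ?z = fd ft.\<Phi> ?z"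
  proof (rule fd_cong[OF ft.open_cylinder])
    show "?z \<in> (cmap c ` overlap c t c' t') \<times> UNIV" using z by (simp add: mem_Times_iff)
    fix y :: "(real^'n) \<times> (real^'m)" assume "y \<in> (cmap c ` overlap c t c' t') \<times> UNIV"
    then obtain p u where "p \<in> overlap c t c' t'" "y = (cmap c p, u)" by auto
    then show "(cmap (ch c' t') \<circ> cinv (ch c t)) y = ft.\<Phi> y" using trans_ch[OF assms(1,2)] by simp
  qed
  then show ?thesis using ft.fd_\<Phi>[OF z] by simp
qed

lemma \<Phi>_ch:
  assumes "(c, t) \<in> J" "(c', t') \<in> J" "e \<in> cdom (ch c t)" "e \<in> cdom (ch c' t')"
  shows "frame_change.\<Phi> (trans c c') (lam c t t') (cmap (ch c t) e) = cmap (ch c' t') e"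
proof -
  interpret ft: frame_change "cmap c ` overlap c t c' t'" "trans c c'" "lam c t t'"
    by (rule frame_change_lam[OF assms(1,2)])
  show ?thesis
    using assms lam_triv[OF assms(1), of "fst e" "snd e" t']
    by (simp add: ft.\<Phi>_def cmap_ch ch_dom cinv_cmap chart_J)
qed

lemma coord_vec_ch_change:
  assumes "(c, t) \<in> J" "(c', t') \<in> J" "e \<in> cdom (ch c t)" "e \<in> cdom (ch c' t')"
  shows "coord_vec B (ch c t) e w
    = coord_vec B (ch c' t') e (frame_change.\<Phi>' (trans c c') (lam c t t') (cmap (ch c t) e) w)"
  using tot.coord_vec_change[OF ch_in_B[OF assms(1)] ch_in_B[OF assms(2)] assms(3,4)]
  by (simp only: fd_trans_ch[OF assms])

subsection \<open>The projection\<close>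

text \<open>In every bundle chart the projection reads (x, u) \<mapsto> x, so the base component of
  \<open>w\<close> is what remains. Base components in two bundle charts differ by the Jacobian of
  the base coordinates, and thus the definite description in \<open>tangent_map\<close> has a
  value.\<close>

lemma tangent_map_projection:
  assumes w: "w \<in> tangent B e" and j: "(c, t) \<in> J" "e \<in> cdom (ch c t)"
  shows "tangent_map B A fst (e, w) = (fst e, coord_vec A c (fst e) (fst (w (ch c t))))"
proof -
  have fd: "fd (cmap d \<circ> fst \<circ> cinv (ch c' t')) (cmap (ch c' t') e) (w (ch c' t'))
      = coord_vec A c (fst e) (fst (w (ch c t))) d"
    if d: "d \<in> A" "fst e \<in> cdom d" and j': "(c', t') \<in> J" "e \<in> cdom (ch c' t')" for d c' t'
  proof -
    have e: "fst e \<in> cdom c'" "fst e \<in> fst t'" using j'(2) by (auto simp: ch_dom)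
    interpret ft: frame_change "cmap c ` overlap c t c' t'" "trans c c'" "lam c t t'"
      by (rule frame_change_lam[OF j(1) j'(1)])
    let ?z = "cmap (ch c' t') e" and ?X = "cmap c' ` (cdom c' \<inter> fst t' \<inter> cdom d)"
    have X: "open ?X"
      by (rule mopen_open_image[OF mopen_Int[OF mopen_Int[OF mopen_cdom mopen_triv] mopen_cdom]])
        (use d chart_J[OF j'(1)] triv_J[OF j'(1)] in auto)
    have "fd (cmap d \<circ> fst \<circ> cinv (ch c' t')) ?z = fd (\<lambda>z. trans c' d (fst z)) ?z"
    proof (rule fd_cong[OF open_Times[OF X open_UNIV]])
      show "?z \<in> ?X \<times> UNIV" using e d by (simp add: cmap_ch)
      fix y :: "(real^'n) \<times> (real^'m)" assume "y \<in> ?X \<times> UNIV"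
      then obtain p u where "p \<in> cdom c'" "p \<in> fst t'" "y = (cmap c' p, u)" by auto
      then show "(cmap d \<circ> fst \<circ> cinv (ch c' t')) y = trans c' d (fst y)"
        using cinv_ch[OF j'(1), of p u] chart_J[OF j'(1)] by (simp add: cinv_cmap)
    qed
    also have "\<dots> = (\<lambda>v. fd (trans c' d) (fst ?z) (fst v))"
    proof (rule fd_eq[OF fd_chain])
      show "(fst has_derivative fst) (at ?z)"
        by (rule bounded_linear_imp_has_derivative, rule bounded_linear_fst)
      show "trans c' d differentiable at (fst ?z)"
        using has_derivative_trans[OF chart_J[OF j'(1)] d(1) e(1) d(2)] by (auto simp: cmap_ch differentiable_def)
    qed
    finally have 1: "fd (cmap d \<circ> fst \<circ> cinv (ch c' t')) ?z (w (ch c' t'))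
        = coord_vec A c' (fst e) (fst (w (ch c' t'))) d"
      using d by (simp add: coord_vec_def cmap_ch)
    have "w (ch c' t') = ft.\<Phi>' (cmap (ch c t) e) (w (ch c t))"
      using tot.tangentD[OF w ch_in_B[OF j(1)] ch_in_B[OF j'(1)] j(2) j'(2)]
      by (simp only: fd_trans_ch[OF j(1) j'(1) j(2) j'(2)])
    \<comment> \<open>The base component of \<open>\<Phi>'\<close> does not involve the transition
      map of the fibres.\<close>
    then have 2: "fst (w (ch c' t')) = fd (trans c c') (cmap c (fst e)) (fst (w (ch c t)))"
      by (simp add: ft.\<Phi>'_def cmap_ch)
    have "coord_vec A c' (fst e) (fst (w (ch c' t'))) = coord_vec A c (fst e) (fst (w (ch c t)))"
      unfolding 2 by (rule coord_vec_change[symmetric]) (use j j' e chart_J in \<open>auto simp: ch_dom\<close>)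
    with 1 show ?thesis by simp
  qed
  have "(THE v. \<forall>C\<in>B. e \<in> cdom C \<longrightarrow> v = fd (cmap d \<circ> fst \<circ> cinv C) (cmap C e) (w C))
      = coord_vec A c (fst e) (fst (w (ch c t))) d" if d: "d \<in> A" "fst e \<in> cdom d" for d
  proof (rule the_equality)
    show "\<forall>C\<in>B. e \<in> cdom C \<longrightarrow> coord_vec A c (fst e) (fst (w (ch c t))) d = fd (cmap d \<circ> fst \<circ> cinv C) (cmap C e) (w C)"
    proof (intro ballI impI)
      fix C assume "C \<in> B" and e: "e \<in> cdom C"
      then obtain c' t' where C: "(c', t') \<in> J" "C = ch c' t'" by (auto elim: B_cases)
      show "coord_vec A c (fst e) (fst (w (ch c t))) d = fd (cmap d \<circ> fst \<circ> cinv C) (cmap C e) (w C)"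
        unfolding C(2) by (rule fd[OF d C(1) e[unfolded C(2)], symmetric])
    qed
    show "v = coord_vec A c (fst e) (fst (w (ch c t))) d"
      if "\<forall>C\<in>B. e \<in> cdom C \<longrightarrow> v = fd (cmap d \<circ> fst \<circ> cinv C) (cmap C e) (w C)" for v
      using that[rule_format, OF ch_in_B[OF j(1)] j(2)] unfolding fd[OF d j] .
  qed
  then show ?thesis
    unfolding tangent_map_def fst_conv snd_conv by (auto simp: fun_eq_iff coord_vec_def simp del: o_apply)
qed

subsection \<open>The complement of the zero section\<close>

lemma slit_cover: "e \<in> slit A F \<Longrightarrow> \<exists>c t. (c, t) \<in> J \<and> e \<in> cdom (ch c t)"
  using cover[of "fst e"] by (auto simp: slit_def ch_dom)

lemma slit_ch:
  assumes "(c, t) \<in> J"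
  shows "{e \<in> slit A F. fst e \<in> S} \<inter> cdom (ch c t)
    = {e. fst e \<in> S \<inter> (cdom c \<inter> fst t) \<and> snd e \<in> F (fst e) \<and> snd e \<noteq> 0}"
  using triv_carrier[OF triv_J[OF assms]] by (auto simp: slit_def ch_dom)

lemma image_slit:
  assumes "(c, t) \<in> J"
  shows "cmap (ch c t) ` ({e \<in> slit A F. fst e \<in> S} \<inter> cdom (ch c t)) = (cmap c ` (S \<inter> (cdom c \<inter> fst t))) \<times> (- {0})"
  unfolding slit_ch[OF assms] by (rule image_ch(2)[OF assms]) auto

lemma mopen_slit:
  assumes "mopen A S"
  shows "mopen B {e \<in> slit A F. fst e \<in> S}"
  unfolding mopen_def
proof (intro conjI ballI)
  show "{e \<in> slit A F. fst e \<in> S} \<subseteq> carrier_of B"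
    using slit_cover ch_in_B by (fastforce simp: carrier_of_def)
  fix C assume "C \<in> B"
  then obtain c t where C: "(c, t) \<in> J" "C = ch c t" by (rule B_cases)
  show "open (cmap C ` ({e \<in> slit A F. fst e \<in> S} \<inter> cdom C))"
    unfolding C(2) image_slit[OF C(1)]
    by (intro open_Times mopen_open_image[OF mopen_Int[OF assms mopen_Int[OF mopen_cdom mopen_triv]]])
      (use chart_J[OF C(1)] triv_J[OF C(1)] in auto)
qed

end

text \<open>Where several indices cover a point, \<open>compat\<close> makes the choice immaterial.
  Functions are total, so uniqueness refers to those with the default value outside
  \<open>W\<close>, which is what \<open>extensional\<close> expresses.\<close>

lemma glue_ex1:
  assumes cover: "\<And>e. e \<in> W \<Longrightarrow> \<exists>j\<in>J. e \<in> P j"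
    and compat: "\<And>i j e. i \<in> J \<Longrightarrow> j \<in> J \<Longrightarrow> e \<in> W \<Longrightarrow> e \<in> P i \<Longrightarrow> e \<in> P j \<Longrightarrow> g i e = g j e"
  shows "\<exists>!\<xi>. \<xi> \<in> extensional W \<and> (\<forall>j\<in>J. \<forall>e\<in>W \<inter> P j. \<xi> e = g j e)"
proof -
  define \<xi> where "\<xi> e = (if e \<in> W then g (SOME j. j \<in> J \<and> e \<in> P j) e else undefined)" for e
  have "\<xi> e = g j e" if j: "j \<in> J" "e \<in> W" "e \<in> P j" for j e
  proof -
    let ?i = "SOME j. j \<in> J \<and> e \<in> P j"
    have "?i \<in> J \<and> e \<in> P ?i" by (rule someI[of "\<lambda>j. j \<in> J \<and> e \<in> P j" j]) (use j in auto)
    then show ?thesis unfolding \<xi>_def if_P[OF j(2)] using compat[OF _ j(1,2)] j(3) by blast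
  qed
  moreover have "\<xi> \<in> extensional W" by (simp add: \<xi>_def extensional_def)
  ultimately have "\<xi> \<in> extensional W \<and> (\<forall>j\<in>J. \<forall>e\<in>W \<inter> P j. \<xi> e = g j e)" by blast
  moreover have "\<eta> = \<xi>" if "\<eta> \<in> extensional W \<and> (\<forall>j\<in>J. \<forall>e\<in>W \<inter> P j. \<eta> e = g j e)" for \<eta>
  proof (rule extensionalityI[of _ W])
    fix e assume e: "e \<in> W"
    then obtain j where "j \<in> J" "e \<in> P j" using cover by blast
    then show "\<eta> e = \<xi> e" using that \<open>\<And>j e. j \<in> J \<Longrightarrow> e \<in> W \<Longrightarrow> e \<in> P j \<Longrightarrow> \<xi> e = g j e\<close>[of j e] e by simp
  qed (use that \<open>\<xi> \<in> extensional W\<close> in auto)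
  ultimately show ?thesis by (rule ex1I)
qed

lemma has_vector_derivative_Pair_iff:
  "(z has_vector_derivative (a, b)) (at s) \<longleftrightarrow>
    ((\<lambda>r. fst (z r)) has_vector_derivative a) (at s) \<and> ((\<lambda>r. snd (z r)) has_vector_derivative b) (at s)"
proof
  assume "(z has_vector_derivative (a, b)) (at s)"
  then show "((\<lambda>r. fst (z r)) has_vector_derivative a) (at s) \<and> ((\<lambda>r. snd (z r)) has_vector_derivative b) (at s)"
    using bounded_linear.has_vector_derivative[OF bounded_linear_fst, of z "(a, b)"]
      bounded_linear.has_vector_derivative[OF bounded_linear_snd, of z "(a, b)"] by simp
next
  assume "((\<lambda>r. fst (z r)) has_vector_derivative a) (at s) \<and> ((\<lambda>r. snd (z r)) has_vector_derivative b) (at s)"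
  then have "((\<lambda>r. (fst (z r), snd (z r))) has_vector_derivative (a, b)) (at s)"
    by (intro has_vector_derivative_Pair) auto
  then show "(z has_vector_derivative (a, b)) (at s)" by simp
qed

section \<open>The semispray and the horizontal lift of a regular Lagrangian\<close>

text \<open>\<open>R c t x b\<close> and \<open>K c t x a b\<close> are \<open>\<rho>\<^sup>i\<^sub>a b\<^sup>a\<close> and \<open>C\<^sup>e\<^sub>a\<^sub>b a\<^sup>a b\<^sup>b\<close>. The tangent bundle is the case
  \<open>R = id\<close>, \<open>K = 0\<close> in induced coordinates.\<close>

locale lagrangian_bundle = bundle_atlas A F T J B
  for A :: "('p, real^'n::finite) chart set" and F :: "'p \<Rightarrow> 'f::real_vector set"
    and T :: "('p, 'f, 'm::finite) triv set" and J B +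
  fixes R :: "('p, real^'n) chart \<Rightarrow> ('p, 'f, 'm) triv \<Rightarrow> real^'n \<Rightarrow> real^'m \<Rightarrow> real^'n"
    and K :: "('p, real^'n) chart \<Rightarrow> ('p, 'f, 'm) triv \<Rightarrow> real^'n \<Rightarrow> real^'m \<Rightarrow> real^'m \<Rightarrow> real^'m"
    and l :: "'p \<times> 'f \<Rightarrow> real"
  assumes linear_R: "\<And>c t p. (c, t) \<in> J \<Longrightarrow> p \<in> cdom c \<inter> fst t \<Longrightarrow> linear (R c t (cmap c p))"
    and linear_K1: "\<And>c t p b. (c, t) \<in> J \<Longrightarrow> p \<in> cdom c \<inter> fst t \<Longrightarrow> linear (\<lambda>a. K c t (cmap c p) a b)"
    and linear_K2: "\<And>c t p a. (c, t) \<in> J \<Longrightarrow> p \<in> cdom c \<inter> fst t \<Longrightarrow> linear (K c t (cmap c p) a)"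
    and smooth_R: "\<And>c t a. (c, t) \<in> J \<Longrightarrow> smooth_on (cmap c ` (cdom c \<inter> fst t)) (\<lambda>x. R c t x a)"
    and smooth_K: "\<And>c t a b. (c, t) \<in> J \<Longrightarrow> smooth_on (cmap c ` (cdom c \<inter> fst t)) (\<lambda>x. K c t x a b)"
    and R_change: "\<And>c t c' t' p b. (c, t) \<in> J \<Longrightarrow> (c', t') \<in> J \<Longrightarrow> p \<in> overlap c t c' t' \<Longrightarrow>
      R c' t' (cmap c' p) (lam c t t' (cmap c p) b) = fd (trans c c') (cmap c p) (R c t (cmap c p) b)"
    and K_change: "\<And>c t c' t' p a b. (c, t) \<in> J \<Longrightarrow> (c', t') \<in> J \<Longrightarrow> p \<in> overlap c t c' t' \<Longrightarrow>
      lam c t t' (cmap c p) (K c t (cmap c p) a b)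
        = K c' t' (cmap c' p) (lam c t t' (cmap c p) a) (lam c t t' (cmap c p) b)
          + fd (\<lambda>x. lam c t t' x b) (cmap c p) (R c t (cmap c p) a)
          - fd (\<lambda>x. lam c t t' x a) (cmap c p) (R c t (cmap c p) b)"
    and regular: "regular_lagrangian B (slit A F) l"
begin

abbreviation "loc c t \<equiv> local_rep l (ch c t)"

text \<open>The coordinate image of the slit bundle, an open set on which the local Lagrangian is
  smooth with invertible fibre metric.\<close>

definition dm :: "('p, real^'n) chart \<Rightarrow> ('p, 'f, 'm) triv \<Rightarrow> ((real^'n) \<times> (real^'m)) set" where
  "dm c t = (cmap c ` (cdom c \<inter> fst t)) \<times> (- {0})"

definition W :: "('p, real^'n) chart \<Rightarrow> ('p, 'f, 'm) triv \<Rightarrow> (real^'n) \<times> (real^'m) \<Rightarrow> real^'m" where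
  "W c t z = spray (loc c t) (R c t (fst z)) (K c t (fst z)) z"

lemma image_slit_dm: "(c, t) \<in> J \<Longrightarrow> cmap (ch c t) ` (slit A F \<inter> cdom (ch c t)) = dm c t"
  using image_slit[of c t UNIV] by (simp add: dm_def)

lemma open_dm: "(c, t) \<in> J \<Longrightarrow> open (dm c t)"
  unfolding dm_def using chart_J triv_J
  by (intro open_Times mopen_open_image[OF mopen_Int[OF mopen_cdom mopen_triv]]) auto

lemma in_dm: "(c, t) \<in> J \<Longrightarrow> e \<in> slit A F \<Longrightarrow> e \<in> cdom (ch c t) \<Longrightarrow> cmap (ch c t) e \<in> dm c t"
  using image_slit_dm by blast

lemma smooth_loc: "(c, t) \<in> J \<Longrightarrow> smooth_on (dm c t) (loc c t)"
  using regular ch_in_B[of c t] image_slit_dm[of c t]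
  unfolding regular_lagrangian_def smooth_fun_def local_rep_def by metis

lemma invertible_loc:
  assumes "(c, t) \<in> J" "z \<in> dm c t"
  shows "invertible (fibre_metric (loc c t) z)"
proof -
  obtain e where "e \<in> slit A F \<inter> cdom (ch c t)" "z = cmap (ch c t) e"
    using assms(2) unfolding image_slit_dm[OF assms(1), symmetric] by blast
  then show ?thesis using regular ch_in_B[OF assms(1)] unfolding regular_lagrangian_def by blast
qed

lemma dm_cases:
  assumes "z \<in> dm c t" obtains p where "p \<in> cdom c \<inter> fst t" "fst z = cmap c p"
proof -
  have "fst z \<in> cmap c ` (cdom c \<inter> fst t)" using assms unfolding dm_def by (rule mem_Times_iff[THEN iffD1, THEN conjunct1])
  then show thesis using that by blast
qed

lemma smooth_base:
  assumes "(c, t) \<in> J" "smooth_on (cmap c ` (cdom c \<inter> fst t)) g"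
  shows "smooth_on (dm c t) (\<lambda>z. g (fst z))"
proof (rule smooth_on_compose[OF open_dm[OF assms(1)] _ _ _ assms(2)])
  show "open (cmap c ` (cdom c \<inter> fst t))"
    using chart_J[OF assms(1)] triv_J[OF assms(1)]
    by (intro mopen_open_image[OF mopen_Int[OF mopen_cdom mopen_triv]]) auto
qed (auto simp: dm_def smooth_on_linear bounded_linear_fst)

lemma smooth_W:
  assumes j: "(c, t) \<in> J"
  shows "smooth_on (dm c t) (W c t)"
  unfolding W_def[abs_def]
proof (rule smooth_on_spray[OF open_dm[OF j] smooth_loc[OF j]])
  show "z \<in> dm c t \<Longrightarrow> invertible (fibre_metric (loc c t) z)" for z by (rule invertible_loc[OF j])
  show "z \<in> dm c t \<Longrightarrow> linear (R c t (fst z))" for z by (elim dm_cases) (simp add: linear_R[OF j])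
  show "z \<in> dm c t \<Longrightarrow> linear (K c t (fst z) a)" for z a by (elim dm_cases) (simp add: linear_K2[OF j])
  show "smooth_on (dm c t) (\<lambda>z. R c t (fst z) a)" for a by (rule smooth_base[OF j smooth_R[OF j]])
  show "smooth_on (dm c t) (\<lambda>z. K c t (fst z) a b)" for a b by (rule smooth_base[OF j smooth_K[OF j]])
qed

text \<open>The instance of \<open>spray_change\<close> over the overlap of two bundle charts. It is
  stated for all coordinates \<open>z\<close> in an open set, as \<open>hor_change\<close>
  differentiates it.\<close>

lemma W_change:
  assumes j: "(c, t) \<in> J" and j': "(c', t') \<in> J"
    and z: "z \<in> (cmap c ` overlap c t c' t') \<times> (- {0})"
  shows "frame_change.\<Phi> (trans c c') (lam c t t') z \<in> dm c' t'"
    and "W c' t' (frame_change.\<Phi> (trans c c') (lam c t t') z)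
      = fd (\<lambda>x. lam c t t' x (snd z)) (fst z) (R c t (fst z) (snd z)) + lam c t t' (fst z) (W c t z)"
proof -
  interpret ft: frame_change "cmap c ` overlap c t c' t'" "trans c c'" "lam c t t'"
    by (rule frame_change_lam[OF j j'])
  let ?O = "(cmap c ` overlap c t c' t') \<times> (- {0 :: real^'m})"
  have O: "open ?O" by (intro open_Times ft.X) auto
  \<comment> \<open>Coordinates are traced back to points lying in both charts, because the
    Lagrangians in the two charts are related only through the function \<open>l\<close> on the
    total space.\<close>
  have lift: "\<exists>e. e \<in> slit A F \<and> e \<in> cdom (ch c t) \<and> e \<in> cdom (ch c' t') \<and> y = cmap (ch c t) e" if "y \<in> ?O" for y
  proof -
    have "y \<in> cmap (ch c t) ` ({e \<in> slit A F. fst e \<in> cdom c' \<inter> fst t'} \<inter> cdom (ch c t))"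
      using that unfolding image_slit[OF j] by (simp only: Int_commute)
    then obtain e where e: "e \<in> slit A F" "fst e \<in> cdom c' \<inter> fst t'" "e \<in> cdom (ch c t)" "y = cmap (ch c t) e"
      by blast
    then have "e \<in> cdom (ch c' t')" by (simp add: ch_dom)
    with e show ?thesis by blast
  qed
  have \<Phi>: "ft.\<Phi> y \<in> dm c' t'" "loc c t y = loc c' t' (ft.\<Phi> y)" if y: "y \<in> ?O" for y
  proof -
    obtain e where e: "e \<in> slit A F" "e \<in> cdom (ch c t)" "e \<in> cdom (ch c' t')" "y = cmap (ch c t) e"
      using lift[OF y] by blast
    note eq = \<Phi>_ch[OF j j' e(2,3), folded e(4)]
    show "ft.\<Phi> y \<in> dm c' t'" unfolding eq by (rule in_dm[OF j' e(1,3)])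
    show "loc c t y = loc c' t' (ft.\<Phi> y)"
      unfolding eq unfolding e(4) by (simp add: local_rep_def tot.cinv_cmap ch_in_B j j' e(2,3))
  qed
  show 1: "ft.\<Phi> z \<in> dm c' t'" by (rule \<Phi>(1)[OF z])
  have dm: "?O \<subseteq> dm c t" by (auto simp: dm_def)
  from z have "fst z \<in> cmap c ` overlap c t c' t'" by (simp add: mem_Times_iff)
  then obtain p where p: "p \<in> overlap c t c' t'" "fst z = cmap c p" by blast
  have p1: "p \<in> cdom c \<inter> fst t" using p by blast
  have p': "fst (ft.\<Phi> z) = cmap c' p"
    using p chart_J[OF j] by (simp add: ft.\<Phi>_def cinv_cmap)
  show "W c' t' (ft.\<Phi> z)
      = fd (\<lambda>x. lam c t t' x (snd z)) (fst z) (R c t (fst z) (snd z)) + lam c t t' (fst z) (W c t z)"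
    unfolding W_def
  proof (rule ft.spray_change[OF O z _ open_dm[OF j'] _ smooth_loc[OF j']])
    show "?O \<subseteq> (cmap c ` overlap c t c' t') \<times> UNIV" by auto
    show "ft.\<Phi> ` ?O \<subseteq> dm c' t'" using \<Phi>(1) by blast
    show "smooth_on ?O (loc c t)" by (rule smooth_on_subset[OF smooth_loc[OF j] dm])
    show "invertible (fibre_metric (loc c t) z)" using dm z by (intro invertible_loc[OF j]) blast
    show "invertible (fibre_metric (loc c' t') (ft.\<Phi> z))" by (rule invertible_loc[OF j' 1])
    show "loc c t y = loc c' t' (ft.\<Phi> y)" if "y \<in> ?O" for y by (rule \<Phi>(2)[OF that])
    show "linear (R c t (fst z))" unfolding p(2) by (rule linear_R[OF j p1])
    show "linear (\<lambda>a. K c t (fst z) a b)" for b unfolding p(2) by (rule linear_K1[OF j p1])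
    show "surj (lam c t t' (fst z))"
      unfolding p(2) by (rule surj_lam[OF j triv_J[OF j']]) (use p in auto)
    show "R c' t' (fst (ft.\<Phi> z)) (lam c t t' (fst z) b) = fd (trans c c') (fst z) (R c t (fst z) b)" for b
      unfolding p' p(2) by (rule R_change[OF j j' p(1)])
    show "lam c t t' (fst z) (K c t (fst z) a b)
        = K c' t' (fst (ft.\<Phi> z)) (lam c t t' (fst z) a) (lam c t t' (fst z) b)
          + fd (\<lambda>x. lam c t t' x b) (fst z) (R c t (fst z) a) - fd (\<lambda>x. lam c t t' x a) (fst z) (R c t (fst z) b)" for a b
      unfolding p' p(2) by (rule K_change[OF j j' p(1)])
  qed
qed

lemma overlap_dm:
  assumes "(c, t) \<in> J" "(c', t') \<in> J" "e \<in> slit A F" "e \<in> cdom (ch c t)" "e \<in> cdom (ch c' t')"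
  shows "cmap (ch c t) e \<in> (cmap c ` overlap c t c' t') \<times> (- {0})"
    and "fst e \<in> overlap c t c' t'"
  using in_dm[OF assms(1,3,4)] assms(4,5) by (auto simp: ch_dom cmap_ch dm_def)

subsection \<open>The semispray\<close>

definition xi_at :: "('p, real^'n) chart \<Rightarrow> ('p, 'f, 'm) triv \<Rightarrow> 'p \<times> 'f \<Rightarrow> ('p \<times> 'f, (real^'n) \<times> (real^'m)) tvec" where
  "xi_at c t e = (let z = cmap (ch c t) e in coord_vec B (ch c t) e (R c t (fst z) (snd z), W c t z))"

text \<open>\<open>R_change\<close> and \<open>W_change\<close> are precisely the base and the fibre
  component of the statement that \<open>\<Phi>'\<close> maps one coordinate expression to the
  other.\<close>

lemma xi_at_change:
  assumes j: "(c, t) \<in> J" and j': "(c', t') \<in> J"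
    and e: "e \<in> slit A F" "e \<in> cdom (ch c t)" "e \<in> cdom (ch c' t')"
  shows "xi_at c t e = xi_at c' t' e"
proof -
  interpret ft: frame_change "cmap c ` overlap c t c' t'" "trans c c'" "lam c t t'"
    by (rule frame_change_lam[OF j j'])
  let ?z = "cmap (ch c t) e"
  have 1: "W c' t' (cmap (ch c' t') e)
      = fd (\<lambda>x. lam c t t' x (snd ?z)) (fst ?z) (R c t (fst ?z) (snd ?z)) + lam c t t' (fst ?z) (W c t ?z)"
    using W_change(2)[OF j j' overlap_dm(1)[OF j j' e]] unfolding \<Phi>_ch[OF j j' e(2,3)] .
  have 2: "R c' t' (cmap c' (fst e)) (snd t' (fst e) (snd e)) = fd (trans c c') (fst ?z) (R c t (fst ?z) (snd ?z))"
    using R_change[OF j j' overlap_dm(2)[OF j j' e], of "snd ?z"] lam_triv[OF j, of "fst e" "snd e" t'] e(2)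
    by (simp add: cmap_ch ch_dom)
  show ?thesis
    unfolding xi_at_def Let_def coord_vec_ch_change[OF j j' e(2,3)] ft.\<Phi>'_def fst_conv snd_conv 1
    by (simp add: 2[symmetric]) (simp add: cmap_ch)
qed

text \<open>Like \<open>is_xi_L\<close>, this leaves the values outside the slit bundle
  open.\<close>

definition spray_field :: "('p \<times> 'f \<Rightarrow> ('p \<times> 'f, (real^'n) \<times> (real^'m)) tvec) \<Rightarrow> bool" where
  "spray_field \<xi> \<longleftrightarrow> (\<forall>c t. (c, t) \<in> J \<longrightarrow> (\<forall>e\<in>slit A F \<inter> cdom (ch c t). \<xi> e = xi_at c t e))"

lemma spray_fieldD: "spray_field \<xi> \<Longrightarrow> (c, t) \<in> J \<Longrightarrow> e \<in> slit A F \<Longrightarrow> e \<in> cdom (ch c t) \<Longrightarrow> \<xi> e = xi_at c t e"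
  unfolding spray_field_def by blast

text \<open>In the chart \<open>ch c t\<close> the field has the components \<open>g\<close>, and
  smoothness in one chart around each point is enough. The set \<open>S\<close> makes room for
  fields over the domain of a single local basis.\<close>

lemma smooth_coord_field:
  assumes j: "(c, t) \<in> J" and S: "mopen A S" and g: "smooth_on (dm c t) g"
  shows "smooth_vector_field B ({e \<in> slit A F. fst e \<in> S} \<inter> cdom (ch c t)) (\<lambda>e. coord_vec B (ch c t) e (g (cmap (ch c t) e)))"
proof (rule tot.smooth_vector_field_local)
  let ?U = "{e \<in> slit A F. fst e \<in> S} \<inter> cdom (ch c t)"
  show "coord_vec B (ch c t) e (g (cmap (ch c t) e)) \<in> tangent B e" if "e \<in> ?U" for e
    using that by (intro tot.coord_vec_in_tangent ch_in_B[OF j]) auto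
  fix e assume e: "e \<in> ?U"
  have U: "mopen B ?U"
    by (rule tot.mopen_Int[OF mopen_slit[OF S] tot.mopen_cdom[OF ch_in_B[OF j]]])
  have "smooth_on (cmap (ch c t) ` ?U) (\<lambda>x. coord_vec B (ch c t) (cinv (ch c t) x) (g (cmap (ch c t) (cinv (ch c t) x))) (ch c t))"
  proof (rule smooth_on_congI[OF _ _ tot.mopen_open_image[OF U ch_in_B[OF j]]])
    show "smooth_on (cmap (ch c t) ` ?U) g"
      by (rule smooth_on_subset[OF g]) (auto intro: in_dm[OF j])
  qed (auto simp: tot.cinv_cmap[OF ch_in_B[OF j]] tot.coord_vec_same[OF ch_in_B[OF j]])
  with e U ch_in_B[OF j] show "\<exists>C\<in>B. \<exists>U. mopen B U \<and> e \<in> U \<and> U \<subseteq> ?U \<inter> cdom C \<and>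
      smooth_on (cmap C ` U) (\<lambda>x. coord_vec B (ch c t) (cinv C x) (g (cmap (ch c t) (cinv C x))) C)"
    by (intro bexI[of _ "ch c t"] exI[of _ ?U]) auto
qed

lemma slit_Collect: "slit A F = {e \<in> slit A F. fst e \<in> carrier_of A}"
  by (auto simp: slit_def)

lemma mopen_carrier: "mopen A (carrier_of A)"
  unfolding mopen_def
proof (intro conjI ballI)
  fix c assume c: "c \<in> A"
  have "carrier_of A \<inter> cdom c = cdom c" using c by (auto simp: carrier_of_def)
  then show "open (cmap c ` (carrier_of A \<inter> cdom c))"
    using mopen_open_image[OF mopen_cdom[OF c] c] by simp
qed simp

lemma smooth_snd_dm: "(c, t) \<in> J \<Longrightarrow> smooth_on (dm c t) (\<lambda>z. snd z)"
  by (rule smooth_on_linear[OF bounded_linear_snd])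

lemma linear_R_dm: "(c, t) \<in> J \<Longrightarrow> z \<in> dm c t \<Longrightarrow> linear (R c t (fst z))"
  by (elim dm_cases) (simp add: linear_R)

lemma spray_field_smooth:
  assumes "spray_field \<xi>"
  shows "smooth_vector_field B (slit A F) \<xi>"
proof -
  have loc: "smooth_vector_field B (slit A F \<inter> cdom (ch c t)) (xi_at c t)" if j: "(c, t) \<in> J" for c t
  proof -
    have "smooth_on (dm c t) (\<lambda>z. (R c t (fst z) (snd z), W c t z))"
      by (intro smooth_on_Pair[OF open_dm[OF j]] smooth_W[OF j] smooth_on_linear_family[OF open_dm[OF j]
          linear_R_dm[OF j] smooth_base[OF j smooth_R[OF j]] smooth_snd_dm[OF j]])
    from smooth_coord_field[OF j mopen_carrier this] show ?thesis
      unfolding xi_at_def[abs_def] Let_def by (subst slit_Collect)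
  qed
  show ?thesis
  proof (rule tot.smooth_vector_field_local)
    fix e assume e: "e \<in> slit A F"
    then obtain c t where j: "(c, t) \<in> J" "e \<in> cdom (ch c t)" using slit_cover by blast
    let ?U = "slit A F \<inter> cdom (ch c t)"
    have eq: "\<xi> e' = xi_at c t e'" if "e' \<in> ?U" for e'
      using spray_fieldD[OF assms j(1)] that by blast
    show "\<xi> e \<in> tangent B e"
      unfolding spray_fieldD[OF assms j(1) e j(2)] xi_at_def Let_def
      by (rule tot.coord_vec_in_tangent[OF ch_in_B[OF j(1)] j(2)])
    have U: "mopen B ?U"
      by (subst slit_Collect) (rule tot.mopen_Int[OF mopen_slit[OF mopen_carrier] tot.mopen_cdom[OF ch_in_B[OF j(1)]]])
    have "smooth_fun B (?U \<inter> cdom (ch c t)) (\<lambda>e. xi_at c t e (ch c t))"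
      using loc[OF j(1)] ch_in_B[OF j(1)] unfolding smooth_vector_field_def by blast
    from tot.smooth_fun_chart[OF this ch_in_B[OF j(1)], of ?U]
    have sm: "smooth_on (cmap (ch c t) ` ?U) ((\<lambda>e. xi_at c t e (ch c t)) \<circ> cinv (ch c t))" by blast
    have "smooth_on (cmap (ch c t) ` ?U) (\<lambda>x. \<xi> (cinv (ch c t) x) (ch c t))"
    proof (rule smooth_on_congI[OF _ sm tot.mopen_open_image[OF U ch_in_B[OF j(1)]]])
      fix y assume "y \<in> cmap (ch c t) ` ?U"
      then obtain e' where "e' \<in> ?U" "y = cmap (ch c t) e'" by blast
      then have "cinv (ch c t) y \<in> ?U" using tot.cinv_cmap[OF ch_in_B[OF j(1)], of e'] by simp
      from eq[OF this] show "\<xi> (cinv (ch c t) y) (ch c t) = ((\<lambda>e. xi_at c t e (ch c t)) \<circ> cinv (ch c t)) y"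
        by simp
    qed blast
    with U e j ch_in_B[OF j(1)] show "\<exists>C\<in>B. \<exists>U. mopen B U \<and> e \<in> U \<and> U \<subseteq> slit A F \<inter> cdom C \<and>
        smooth_on (cmap C ` U) (\<lambda>x. \<xi> (cinv C x) C)"
      by blast
  qed
qed

lemma xi_at_ch:
  assumes "(c, t) \<in> J" "e \<in> cdom (ch c t)"
  shows "xi_at c t e (ch c t) = (R c t (cmap c (fst e)) (snd t (fst e) (snd e)), W c t (cmap (ch c t) e))"
  unfolding xi_at_def Let_def tot.coord_vec_same[OF ch_in_B[OF assms(1)] assms(2)] by (simp add: cmap_ch)

subsection \<open>Paths\<close>

text \<open>Reduces both systems of equations to one chart and one time: \<open>P\<close> stands for
  either of them and has to single out the velocity of the semispray. The curve is differentiable,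
  so a velocity exists beforehand and the equations only have to identify it.\<close>

lemma integral_curve_iff:
  assumes \<xi>: "spray_field \<xi>" and \<gamma>: "differentiable_curve B (slit A F) I \<gamma>"
    and P: "\<And>s c t v. s \<in> I \<Longrightarrow> (c, t) \<in> J \<Longrightarrow> \<gamma> s \<in> slit A F \<Longrightarrow> \<gamma> s \<in> cdom (ch c t) \<Longrightarrow>
      ((\<lambda>r. cmap (ch c t) (\<gamma> r)) has_vector_derivative v) (at s) \<Longrightarrow>
      P s c t \<longleftrightarrow> v = (let z = cmap (ch c t) (\<gamma> s) in (R c t (fst z) (snd z), W c t z))"
  shows "(\<forall>s\<in>I. \<forall>c t. (c, t) \<in> J \<longrightarrow> \<gamma> s \<in> cdom (ch c t) \<longrightarrow> P s c t) \<longleftrightarrow> integral_curve B \<xi> I \<gamma>"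
proof
  assume all: "\<forall>s\<in>I. \<forall>c t. (c, t) \<in> J \<longrightarrow> \<gamma> s \<in> cdom (ch c t) \<longrightarrow> P s c t"
  show "integral_curve B \<xi> I \<gamma>"
    unfolding integral_curve_def
  proof
    fix s assume s: "s \<in> I"
    then obtain v where v: "\<gamma> s \<in> slit A F" "v \<in> tangent B (\<gamma> s)" "has_velocity B \<gamma> s v"
      using \<gamma> by (auto simp: differentiable_curve_def)
    obtain c t where j: "(c, t) \<in> J" "\<gamma> s \<in> cdom (ch c t)" using slit_cover[OF v(1)] by blast
    have "((\<lambda>r. cmap (ch c t) (\<gamma> r)) has_vector_derivative v (ch c t)) (at s)"
      using v(3) j(2) ch_in_B[OF j(1)] by (auto simp: has_velocity_def o_def)
    from P[OF s j(1) v(1) j(2) this] all s j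
    \<comment> \<open>Agreement in the one chart \<open>ch c t\<close> is sufficient, since
      \<open>v\<close> is a tangent vector and is recovered from its components there.\<close>
    have "v (ch c t) = (let z = cmap (ch c t) (\<gamma> s) in (R c t (fst z) (snd z), W c t z))" by blast
    with tot.tangent_eq_coord_vec[OF v(2) ch_in_B[OF j(1)] j(2)] have "v = xi_at c t (\<gamma> s)"
      unfolding xi_at_def Let_def by simp
    then show "has_velocity B \<gamma> s (\<xi> (\<gamma> s))"
      using v(3) spray_fieldD[OF \<xi> j(1) v(1) j(2)] by simp
  qed
next
  assume int: "integral_curve B \<xi> I \<gamma>"
  show "\<forall>s\<in>I. \<forall>c t. (c, t) \<in> J \<longrightarrow> \<gamma> s \<in> cdom (ch c t) \<longrightarrow> P s c t"
  proof (intro ballI allI impI)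
    fix s c t assume s: "s \<in> I" and j: "(c, t) \<in> J" "\<gamma> s \<in> cdom (ch c t)"
    have sl: "\<gamma> s \<in> slit A F" using \<gamma> s by (auto simp: differentiable_curve_def)
    have "((\<lambda>r. cmap (ch c t) (\<gamma> r)) has_vector_derivative \<xi> (\<gamma> s) (ch c t)) (at s)"
      using int s j(2) ch_in_B[OF j(1)] by (auto simp: integral_curve_def has_velocity_def o_def)
    from P[OF s j(1) sl j(2) this] show "P s c t"
      unfolding spray_fieldD[OF \<xi> j(1) sl j(2)] xi_at_def Let_def
        tot.coord_vec_same[OF ch_in_B[OF j(1)] j(2)] by blast
  qed
qed

text \<open>As \<open>z\<close> has the velocity \<open>v\<close>, the chain rule determines the
  derivative of each fibre derivative of the Lagrangian along the curve. The differential equations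
  thereby become algebraic conditions on \<open>v\<close>: its base part is \<rho> u, and
  \<open>EL\<close> vanishes for \<open>w = snd v\<close>.\<close>

lemma EL_point:
  assumes j: "(c, t) \<in> J" and z: "z s \<in> dm c t" and v: "(z has_vector_derivative v) (at s)"
  shows "((\<lambda>r. fst (z r)) has_vector_derivative R c t (fst (z s)) (snd (z s))) (at s) \<and>
    (\<forall>a. \<exists>d. ((\<lambda>r. pd_u (loc c t) a (z r)) has_real_derivative d) (at s) \<and>
      d - fd (loc c t) (z s) (R c t (fst (z s)) (axis a 1), 0)
        + fd (loc c t) (z s) (0, K c t (fst (z s)) (axis a 1) (snd (z s))) = 0) \<longleftrightarrow>
    v = (R c t (fst (z s)) (snd (z s)), W c t (z s))"
proof -
  let ?u = "R c t (fst (z s)) (snd (z s))"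
  have f: "smooth_on (dm c t) (loc c t)" by (rule smooth_loc[OF j])
  have 1: "((\<lambda>r. fst (z r)) has_vector_derivative ?u) (at s) \<longleftrightarrow> fst v = ?u"
  proof -
    have "((\<lambda>r. fst (z r)) has_vector_derivative fst v) (at s)"
      using v has_vector_derivative_Pair_iff[of z "fst v" "snd v" s] by simp
    then show ?thesis by (metis vector_derivative_unique_at)
  qed
  have 2: "((\<lambda>r. pd_u (loc c t) a (z r)) has_real_derivative d) (at s) \<longleftrightarrow>
      d = fd (\<lambda>y. fd (loc c t) y (0, axis a 1)) (z s) v" for a d
  proof -
    let ?g = "\<lambda>y. fd (loc c t) y (0, axis a 1)"
    have g: "?g differentiable (at (z s))"
      by (rule smooth_on_differentiable[OF smooth_on_fd_const[OF f] z])
    have "((\<lambda>r. ?g (z r)) has_derivative (\<lambda>h. fd ?g (z s) (h *\<^sub>R v))) (at s)"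
      using v by (intro fd_chain g) (simp add: has_vector_derivative_def)
    then have "((\<lambda>r. ?g (z r)) has_real_derivative fd ?g (z s) v) (at s)"
      unfolding linear_scale[OF fd_linear[OF g]] by (rule has_derivative_imp_has_field_derivative) simp
    then show ?thesis unfolding pd_u_def by (metis DERIV_unique)
  qed
  have "(\<forall>a. EL (loc c t) (R c t (fst (z s))) (K c t (fst (z s))) (z s) w (axis a 1) = 0) \<longleftrightarrow> w = W c t (z s)" for w
    unfolding W_def by (rule EL_axis_eq_0_iff[OF open_dm[OF j] f z invertible_loc[OF j z]])
  then have 3: "(\<forall>a. fd (\<lambda>y. fd (loc c t) y (0, axis a 1)) (z s) (?u, snd v)
        - fd (loc c t) (z s) (R c t (fst (z s)) (axis a 1), 0)
        + fd (loc c t) (z s) (0, K c t (fst (z s)) (axis a 1) (snd (z s))) = 0) \<longleftrightarrow> snd v = W c t (z s)"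
    unfolding EL_def by blast
  obtain v1 v2 where v12: "v = (v1, v2)" by (cases v)
  \<comment> \<open>The base velocity \<open>?u\<close> is built into \<open>EL\<close>; the first
    equation gives \<open>v1 = ?u\<close>, after which \<open>3\<close> applies.\<close>
  show ?thesis unfolding 1 2 using 3 unfolding v12 fst_conv snd_conv by auto
qed

lemma geodesic_point:
  assumes v: "(z has_vector_derivative v) (at s)"
  shows "((\<lambda>r. fst (z r)) has_vector_derivative u) (at s) \<and>
    (\<forall>a. \<exists>d. ((\<lambda>r. snd (z r) $ a) has_real_derivative d) (at s) \<and> d = w $ a) \<longleftrightarrow> v = (u, w)"
proof -
  have fs: "((\<lambda>r. fst (z r)) has_vector_derivative fst v) (at s)" "((\<lambda>r. snd (z r)) has_vector_derivative snd v) (at s)"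
    using v has_vector_derivative_Pair_iff[of z "fst v" "snd v" s] by simp_all
  have 1: "((\<lambda>r. fst (z r)) has_vector_derivative u) (at s) \<longleftrightarrow> fst v = u"
    using fs(1) by (metis vector_derivative_unique_at)
  have 2: "((\<lambda>r. snd (z r) $ a) has_real_derivative d) (at s) \<longleftrightarrow> d = snd v $ a" for a d
  proof -
    have "((\<lambda>r. snd (z r) $ a) has_real_derivative snd v $ a) (at s)"
      using bounded_linear.has_vector_derivative[OF bounded_linear_vec_nth fs(2)]
      by (simp add: has_real_derivative_iff_has_vector_derivative)
    then show ?thesis by (metis DERIV_unique)
  qed
  show ?thesis unfolding 1 2 by (auto simp: prod_eq_iff vec_eq_iff)
qed

end

context lagrangian_bundle begin

subsection \<open>The horizontal lift\<close>

text \<open>With \<open>W = - 2 G\<close> the fibre component is \<open>- N b\<close>, where N is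
  \<partial>G/\<partial>u plus \<open>s/2\<close> times the bracket term: \<open>s = 0\<close> gives
  the coefficients \<partial>G/\<partial>u, and \<open>s = 1\<close> those of the global
  splitting.\<close>

definition hor :: "real \<Rightarrow> ('p, real^'n) chart \<Rightarrow> ('p, 'f, 'm) triv \<Rightarrow> (real^'n) \<times> (real^'m) \<Rightarrow> real^'m \<Rightarrow> (real^'n) \<times> (real^'m)" where
  "hor s c t z b = (R c t (fst z) b, (1/2) *\<^sub>R fd (W c t) z (0, b) - (s/2) *\<^sub>R K c t (fst z) b (snd z))"

lemma linear_hor:
  assumes j: "(c, t) \<in> J" and z: "z \<in> dm c t"
  shows "linear (hor s c t z)"
proof -
  have R: "linear (R c t (fst z))" and K: "linear (\<lambda>b. K c t (fst z) b (snd z))"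
    using z by (elim dm_cases; simp add: linear_R[OF j] linear_K1[OF j])+
  have W: "linear (\<lambda>b. fd (W c t) z (0, b))"
    by (rule linear_Pair_zero(2)[OF fd_linear[OF smooth_on_differentiable[OF smooth_W[OF j] z]]])
  show ?thesis
    unfolding hor_def
    by (rule linearI)
      (simp_all only: linear_add[OF R] linear_add[OF W] linear_add[OF K] linear_scale[OF R]
        linear_scale[OF W] linear_scale[OF K] add_Pair scaleR_Pair scaleR_right_distrib
        scaleR_right_diff_distrib add_diff_add scaleR_left_commute)
qed

lemma smooth_hor:
  assumes j: "(c, t) \<in> J"
  shows "smooth_on (dm c t) (\<lambda>z. hor s c t z b)"
proof -
  have "z \<in> dm c t \<Longrightarrow> linear (K c t (fst z) b)" for z by (elim dm_cases) (simp add: linear_K2[OF j])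
  then show ?thesis
    unfolding hor_def
    by (intro smooth_on_Pair smooth_on_diff smooth_on_scaleR smooth_on_const smooth_on_fd_const open_dm[OF j]
        smooth_W[OF j] smooth_base[OF j smooth_R[OF j]]
        smooth_on_linear_family[OF open_dm[OF j] _ smooth_base[OF j smooth_K[OF j]] smooth_snd_dm[OF j]])
qed

lemma hor_change:
  assumes j: "(c, t) \<in> J" and j': "(c', t') \<in> J"
    and e: "e \<in> slit A F" "e \<in> cdom (ch c t)" "e \<in> cdom (ch c' t')"
    and K: "\<And>b u. s *\<^sub>R (lam c t t' (cmap c (fst e)) (K c t (cmap c (fst e)) b u)
        - K c' t' (cmap c' (fst e)) (lam c t t' (cmap c (fst e)) b) (lam c t t' (cmap c (fst e)) u))
      = fd (\<lambda>x. lam c t t' x u) (cmap c (fst e)) (R c t (cmap c (fst e)) b)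
        - fd (\<lambda>x. lam c t t' x b) (cmap c (fst e)) (R c t (cmap c (fst e)) u)"
  shows "coord_vec B (ch c t) e (hor s c t (cmap (ch c t) e) b)
    = coord_vec B (ch c' t') e (hor s c' t' (cmap (ch c' t') e) (lam c t t' (cmap c (fst e)) b))"
proof -
  interpret ft: frame_change "cmap c ` overlap c t c' t'" "trans c c'" "lam c t t'"
    by (rule frame_change_lam[OF j j'])
  let ?O = "(cmap c ` overlap c t c' t') \<times> (- {0 :: real^'m})" and ?z = "cmap (ch c t) e"
  have O: "open ?O" by (intro open_Times ft.X) auto
  have z: "?z \<in> ?O" and p: "fst e \<in> overlap c t c' t'" using overlap_dm[OF j j' e] by auto
  have fz: "fst ?z = cmap c (fst e)" by (simp add: cmap_ch)
  have \<Phi>z: "ft.\<Phi> ?z = cmap (ch c' t') e" by (rule \<Phi>_ch[OF j j' e(2,3)])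
  have fz': "fst (cmap (ch c' t') e) = cmap c' (fst e)" by (simp add: cmap_ch)
  have "ft.\<Phi>' ?z (R c t (fst ?z) b, (1/2) *\<^sub>R fd (W c t) ?z (0, b) - (s/2) *\<^sub>R K c t (fst ?z) b (snd ?z))
      = (R c' t' (cmap c' (fst e)) (lam c t t' (fst ?z) b), (1/2) *\<^sub>R fd (W c' t') (ft.\<Phi> ?z) (0, lam c t t' (fst ?z) b)
        - (s/2) *\<^sub>R K c' t' (cmap c' (fst e)) (lam c t t' (fst ?z) b) (snd (ft.\<Phi> ?z)))"
  proof (rule ft.horizontal_change[where R = "R c t" and K = "K c t (fst ?z)", OF O z])
    show "?O \<subseteq> (cmap c ` overlap c t c' t') \<times> UNIV" by auto
    show "W c t differentiable at ?z"
      by (rule smooth_on_differentiable[OF smooth_W[OF j] in_dm[OF j e(1,2)]])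
    show "W c' t' differentiable at (ft.\<Phi> ?z)"
      unfolding \<Phi>z by (rule smooth_on_differentiable[OF smooth_W[OF j'] in_dm[OF j' e(1,3)]])
    show "W c' t' (ft.\<Phi> y) = fd (\<lambda>x. lam c t t' x (snd y)) (fst y) (R c t (fst y) (snd y)) + lam c t t' (fst y) (W c t y)"
      if "y \<in> ?O" for y by (rule W_change(2)[OF j j' that])
    show "linear (R c t (fst ?z))" unfolding fz by (rule linear_R[OF j]) (use p in blast)
    show "R c' t' (cmap c' (fst e)) (lam c t t' (fst ?z) b) = fd (trans c c') (fst ?z) (R c t (fst ?z) b)"
      unfolding fz by (rule R_change[OF j j' p])
    show "s *\<^sub>R (lam c t t' (fst ?z) (K c t (fst ?z) b (snd ?z))
        - K c' t' (cmap c' (fst e)) (lam c t t' (fst ?z) b) (lam c t t' (fst ?z) (snd ?z)))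
      = fd (\<lambda>x. lam c t t' x (snd ?z)) (fst ?z) (R c t (fst ?z) b)
        - fd (\<lambda>x. lam c t t' x b) (fst ?z) (R c t (fst ?z) (snd ?z))"
      unfolding fz by (rule K)
  qed
  then show ?thesis
    unfolding coord_vec_ch_change[OF j j' e(2,3)] hor_def \<Phi>z fz fz' by (simp only:)
qed

lemma hor_change_1:
  assumes "(c, t) \<in> J" "(c', t') \<in> J" "e \<in> slit A F" "e \<in> cdom (ch c t)" "e \<in> cdom (ch c' t')"
  shows "coord_vec B (ch c t) e (hor 1 c t (cmap (ch c t) e) b)
    = coord_vec B (ch c' t') e (hor 1 c' t' (cmap (ch c' t') e) (lam c t t' (cmap c (fst e)) b))"
  by (rule hor_change[OF assms]) (simp add: K_change[OF assms(1,2) overlap_dm(2)[OF assms]])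

text \<open>G is identified with \<open>- 1/2\<close> times a component of \<open>W\<close> only on
  \<open>dm c t\<close>; as this set is open, the identity may be differentiated.\<close>

lemma pd_u_coefficient:
  assumes j: "(c, t) \<in> J" and z: "z \<in> dm c t"
    and G: "\<And>y. y \<in> dm c t \<Longrightarrow> G y = (- 1/2) * W c t y $ i"
  shows "pd_u G b z = (- 1/2) * fd (W c t) z (0, axis b 1) $ i"
proof -
  have "pd_u G b z = fd (\<lambda>y. (- 1/2) * W c t y $ i) z (0, axis b 1)"
    unfolding pd_u_def using fd_cong[OF open_dm[OF j] z G] by simp
  also have "((\<lambda>y. (- 1/2) * W c t y $ i) has_derivative (\<lambda>v. (- 1/2) * fd (W c t) z v $ i)) (at z)"
    by (intro has_derivative_mult_right bounded_linear.has_derivative[OF bounded_linear_vec_nth]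
        smooth_on_has_derivative[OF smooth_W[OF j] z])
  from fd_eq[OF this] have "fd (\<lambda>y. (- 1/2) * W c t y $ i) z (0, axis b 1) = (- 1/2) * fd (W c t) z (0, axis b 1) $ i"
    by simp
  finally show ?thesis .
qed

lemma coord_vec_sum:
  assumes "(c, t) \<in> J" "e \<in> cdom (ch c t)"
  shows "(\<Sum>i\<in>UNIV. a $ i *\<^sub>R vec_x B (ch c t) e i) = coord_vec B (ch c t) e (a, 0)"
    and "(\<Sum>i\<in>UNIV. b $ i *\<^sub>R vec_u B (ch c t) e i) = coord_vec B (ch c t) e (0, b)"
proof -
  note l = tot.linear_coord_vec[OF ch_in_B[OF assms(1)] assms(2)]
  show "(\<Sum>i\<in>UNIV. a $ i *\<^sub>R vec_x B (ch c t) e i) = coord_vec B (ch c t) e (a, 0)"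
    unfolding vec_x_def by (rule linear_axis_sum[OF linear_Pair_zero(1)[OF l], symmetric])
  show "(\<Sum>i\<in>UNIV. b $ i *\<^sub>R vec_u B (ch c t) e i) = coord_vec B (ch c t) e (0, b)"
    unfolding vec_u_def by (rule linear_axis_sum[OF linear_Pair_zero(2)[OF l], symmetric])
qed

lemma coord_vec_diff:
  assumes "(c, t) \<in> J" "e \<in> cdom (ch c t)"
  shows "coord_vec B (ch c t) e (a, 0) - coord_vec B (ch c t) e (0, b) = coord_vec B (ch c t) e (a, - b)"
  using linear_diff[OF tot.linear_coord_vec[OF ch_in_B[OF assms(1)] assms(2)], of "(a, 0)" "(0, b)"] by simp

lemma xi_at_eq:
  assumes "(c, t) \<in> J" "e \<in> cdom (ch c t)"
    and "a = R c t (cmap c (fst e)) (snd t (fst e) (snd e))" "\<And>i. g i = - W c t (cmap (ch c t) e) $ i"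
  shows "xi_at c t e = (\<Sum>i\<in>UNIV. a $ i *\<^sub>R vec_x B (ch c t) e i) - (\<Sum>i\<in>UNIV. g i *\<^sub>R vec_u B (ch c t) e i)"
proof -
  have g: "g = (\<lambda>i. (- W c t (cmap (ch c t) e)) $ i)" by (rule ext) (simp add: assms(4))
  show ?thesis
    unfolding g coord_vec_sum[OF assms(1,2)] coord_vec_diff[OF assms(1,2)] xi_at_def Let_def assms(3)
    by (simp add: cmap_ch)
qed

end

text \<open>Turns the span of a frame into the range of the lift, the form in which
  \<open>whitney_splitting_unique_ex\<close> prescribes the fibres.\<close>

lemma span_range_axis:
  fixes h :: "real^'m::finite \<Rightarrow> 'v::real_vector"
  assumes "linear h"
  shows "span (range (\<lambda>a. h (axis a 1))) = range h"
proof -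
  have "Basis = range (\<lambda>a. axis a 1 :: real^'m)" by (auto simp: Basis_vec_def)
  then have "span (range (\<lambda>a. axis a 1 :: real^'m)) = UNIV" using span_Basis by metis
  then show ?thesis
    using linear_span_image[OF assms, of "range (\<lambda>a. axis a 1)"] by (simp add: image_image)
qed

section \<open>Lagrange spaces\<close>

text \<open>The trivialization by the coordinate vector fields of the chart \<open>c\<close>. Paired
  with \<open>c\<close> itself it gives the induced coordinates on TM.\<close>

definition tm_triv :: "('p, real^'n::finite) chart \<Rightarrow> ('p, ('p, real^'n) tvec, 'n) triv" where
  "tm_triv c = (cdom c, \<lambda>p v. v c)"

lemma tm_triv_simps [simp]: "fst (tm_triv c) = cdom c" "snd (tm_triv c) p v = v c"
  by (simp_all add: tm_triv_def)

context
  fixes A :: "('p, real^'n::finite) chart set"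
  assumes A: "smooth_atlas A"
begin

interpretation atlas A by unfold_locales (rule A)

lemma bij_tm_triv:
  assumes "c \<in> A" "p \<in> cdom c"
  shows "bij_betw (snd (tm_triv c) p) (tangent A p) UNIV"
proof (rule bij_betw_byWitness[where f' = "coord_vec A c p"])
  show "\<forall>v\<in>tangent A p. coord_vec A c p (snd (tm_triv c) p v) = v"
    using tangent_eq_coord_vec[OF _ assms] by simp
  show "\<forall>w\<in>UNIV. snd (tm_triv c) p (coord_vec A c p w) = w"
    by (simp add: coord_vec_same[OF assms])
  show "coord_vec A c p ` UNIV \<subseteq> tangent A p" using coord_vec_in_tangent[OF assms] by blast
qed simp

lemma triv_section_tangent:
  assumes "c \<in> A" "p \<in> cdom c"
  shows "triv_section (tangent A) (tm_triv c) w p = coord_vec A c p w"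
  unfolding triv_section_def using bij_tm_triv[OF assms]
  by (intro inv_into_f_eq) (simp_all add: bij_betw_def coord_vec_in_tangent[OF assms] coord_vec_same[OF assms])

text \<open>The transition maps are the Jacobians of the coordinate changes, which are smooth as
  derivatives of smooth maps.\<close>

lemma vector_bundle_tangent: "vector_bundle A (tangent A) (tm_triv ` A)"
  unfolding vector_bundle_def
proof (intro conjI ballI allI)
  show "subspace (tangent A p)" for p by (rule subspace_tangent)
  show "carrier_of A = (\<Union>t\<in>tm_triv ` A. fst t)" by (simp add: carrier_of_def)
  show "mopen A (fst t)" if "t \<in> tm_triv ` A" for t
    using that mopen_cdom by auto
  show "bij_betw (snd t p) (tangent A p) UNIV" if "t \<in> tm_triv ` A" "p \<in> fst t" for t p
    using that bij_tm_triv by auto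
  show "snd t p (f + g) = snd t p f + snd t p g" if "t \<in> tm_triv ` A" for t p f g
    using that by auto
  show "snd t p (r *\<^sub>R f) = r *\<^sub>R snd t p f" if "t \<in> tm_triv ` A" for t p r f
    using that by (auto simp: scaleR_fun_def)
  fix t t' and w :: "real^'n" assume "t \<in> tm_triv ` A" "t' \<in> tm_triv ` A"
  then obtain c d where c: "c \<in> A" "t = tm_triv c" and d: "d \<in> A" "t' = tm_triv d" by auto
  show "smooth_fun A (fst t \<inter> fst t') (\<lambda>p. snd t' p (triv_section (tangent A) t w p))"
  proof (rule smooth_fun_local)
    fix p assume p: "p \<in> fst t \<inter> fst t'"
    let ?U = "cdom c \<inter> cdom d"
    have U: "mopen A ?U" by (rule mopen_Int[OF mopen_cdom[OF c(1)] mopen_cdom[OF d(1)]])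
    have "smooth_on (cmap c ` ?U) ((\<lambda>p. snd t' p (triv_section (tangent A) t w p)) \<circ> cinv c)"
    proof (rule smooth_on_congI[OF _ smooth_on_fd_const mopen_open_image[OF U c(1)]])
      show "smooth_on (cmap c ` ?U) (trans c d)" by (rule smooth_trans[OF c(1) d(1) subset_refl])
      fix x assume "x \<in> cmap c ` ?U"
      then show "((\<lambda>p. snd t' p (triv_section (tangent A) t w p)) \<circ> cinv c) x = fd (trans c d) x w"
        using c d by (auto simp: cinv_cmap triv_section_tangent coord_vec_apply)
    qed blast
    then show "\<exists>c\<in>A. \<exists>U. mopen A U \<and> p \<in> U \<and> U \<subseteq> cdom c \<and>
        smooth_on (cmap c ` U) ((\<lambda>p. snd t' p (triv_section (tangent A) t w p)) \<circ> cinv c)"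
      using U p c d by (intro bexI[of _ c] exI[of _ ?U]) auto
  qed
qed

lemma bundle_atlas_tangent:
  "bundle_atlas A (tangent A) (tm_triv ` A) ((\<lambda>c. (c, tm_triv c)) ` A) (tm_atlas A)"
proof (intro bundle_atlas.intro bundle_atlas_axioms.intro)
  show "atlas A" by unfold_locales
  show "vector_bundle A (tangent A) (tm_triv ` A)" by (rule vector_bundle_tangent)
  show "(\<lambda>c. (c, tm_triv c)) ` A \<subseteq> A \<times> tm_triv ` A" by auto
  show "\<exists>c t. (c, t) \<in> (\<lambda>c. (c, tm_triv c)) ` A \<and> p \<in> cdom c \<inter> fst t" if "p \<in> carrier_of A" for p
  proof -
    from that obtain c where "c \<in> A" "p \<in> cdom c" unfolding carrier_of_def by blast
    then show ?thesis by (intro exI[of _ c] exI[of _ "tm_triv c"]) simp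
  qed
  show "tm_atlas A = (\<lambda>(c, t). bundle_chart (tangent A) c t) ` (\<lambda>c. (c, tm_triv c)) ` A"
    by (simp add: tm_atlas_def tm_chart_def[abs_def] tm_triv_def image_image)
qed

end

context
  fixes A :: "('p, real^'n::finite) chart set" and L :: "'p \<times> ('p, real^'n) tvec \<Rightarrow> real"
  assumes L: "lagrange_space A L"
begin

interpretation bundle_atlas A "tangent A" "tm_triv ` A" "(\<lambda>c. (c, tm_triv c)) ` A" "tm_atlas A"
  using L by (intro bundle_atlas_tangent) (simp add: lagrange_space_def smooth_manifold_def)

lemma lam_tangent:
  assumes "c \<in> A" "d \<in> A" "p \<in> cdom c" "p \<in> cdom d"
  shows "lam c (tm_triv c) (tm_triv d) (cmap c p) w = fd (trans c d) (cmap c p) w"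
  unfolding lam_cmap[OF assms(1,3)] triv_section_tangent[OF smooth_atlas assms(1,3)]
  by (simp only: tm_triv_simps coord_vec_apply[OF assms(2,4)])

text \<open>For \<Lambda> = D\<phi>, \<rho> = id and C = 0 the law of C becomes the symmetry of the
  second derivative of the coordinate change. This uses that both local bases are coordinate bases,
  whose fields commute.\<close>

lemma lagrangian_bundle_tangent:
  "lagrangian_bundle A (tangent A) (tm_triv ` A) ((\<lambda>c. (c, tm_triv c)) ` A) (tm_atlas A)
    (\<lambda>_ _ _ b. b) (\<lambda>_ _ _ _ _. 0) L"
proof (intro lagrangian_bundle.intro lagrangian_bundle_axioms.intro)
  let ?J = "(\<lambda>c. (c, tm_triv c)) ` A"
  show "bundle_atlas A (tangent A) (tm_triv ` A) ?J (tm_atlas A)" by unfold_locales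
  show "linear (\<lambda>b. b :: real^'n)" "linear (\<lambda>b. 0 :: real^'n)" by (auto intro: linearI)
  show "linear (\<lambda>b. 0 :: real^'n)" by (auto intro: linearI)
  show "smooth_on S (\<lambda>x. a)" for S :: "(real^'n) set" and a :: "real^'n" by (rule smooth_on_const)
  show "smooth_on S (\<lambda>x. 0)" for S :: "(real^'n) set" by (rule smooth_on_const)
  show "regular_lagrangian (tm_atlas A) (slit A (tangent A)) L" using L by (simp add: lagrange_space_def)
next
  let ?J = "(\<lambda>c. (c, tm_triv c)) ` A"
  fix c t c' t' p and b :: "real^'n"
  assume "(c, t) \<in> ?J" "(c', t') \<in> ?J" and p: "p \<in> overlap c t c' t'"
  then have c: "c \<in> A" "t = tm_triv c" and c': "c' \<in> A" "t' = tm_triv c'" by auto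
  show "lam c t t' (cmap c p) b = fd (trans c c') (cmap c p) b"
    unfolding c(2) c'(2) using p by (intro lam_tangent[OF c(1) c'(1)]) auto
next
  let ?J = "(\<lambda>c. (c, tm_triv c)) ` A"
  fix c t c' t' p and a b :: "real^'n"
  assume j: "(c, t) \<in> ?J" "(c', t') \<in> ?J" and p: "p \<in> overlap c t c' t'"
  then have c: "c \<in> A" "t = tm_triv c" and c': "c' \<in> A" "t' = tm_triv c'" by auto
  have p': "p \<in> cdom c" "p \<in> cdom c'" using p by auto
  let ?U = "cmap c ` (cdom c \<inter> cdom c')"
  have U: "open ?U" by (rule mopen_open_image[OF mopen_Int[OF mopen_cdom[OF c(1)] mopen_cdom[OF c'(1)]] c(1)]) auto
  have x: "cmap c p \<in> ?U" using p' by auto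
  have "fd (\<lambda>x. lam c t t' x b) (cmap c p) = fd (\<lambda>x. fd (trans c c') x b) (cmap c p)" for b
    by (rule fd_cong[OF U x]) (use lam_tangent[OF c(1) c'(1)] c(2) c'(2) in auto)
  moreover have "fd (\<lambda>x. fd (trans c c') x b) (cmap c p) a = fd (\<lambda>x. fd (trans c c') x a) (cmap c p) b"
    by (rule fd_symmetric[OF U smooth_trans[OF c(1) c'(1) subset_refl] x])
  moreover have "lam c t t' (cmap c p) 0 = 0"
    by (rule linear_0[OF frame_change.linear_\<Lambda>[OF frame_change_lam[OF j]]]) (use p in blast)
  ultimately show "lam c t t' (cmap c p) 0 = 0 + fd (\<lambda>x. lam c t t' x b) (cmap c p) a - fd (\<lambda>x. lam c t t' x a) (cmap c p) b"
    by simp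
qed

interpretation lagrangian_bundle A "tangent A" "tm_triv ` A" "(\<lambda>c. (c, tm_triv c)) ` A" "tm_atlas A"
  "\<lambda>_ _ _ b. b" "\<lambda>_ _ _ _ _. 0" L
  by (rule lagrangian_bundle_tangent)

lemma tm_J: "c \<in> A \<Longrightarrow> (c, tm_triv c) \<in> (\<lambda>c. (c, tm_triv c)) ` A" by simp

lemma all_J: "(\<forall>c t. (c, t) \<in> (\<lambda>c. (c, tm_triv c)) ` A \<longrightarrow> P c t) \<longleftrightarrow> (\<forall>c\<in>A. P c (tm_triv c))"
  by blast

lemma ball_tm_atlas: "(\<forall>C\<in>tm_atlas A. P C) \<longleftrightarrow> (\<forall>c\<in>A. P (ch c (tm_triv c)))"
  by (simp add: tm_atlas_def tm_chart_def tm_triv_def)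

lemma fd_loc_0: "c \<in> A \<Longrightarrow> z \<in> dm c (tm_triv c) \<Longrightarrow> fd (loc c (tm_triv c)) z 0 = 0"
  by (rule linear_0[OF fd_linear[OF smooth_on_differentiable[OF smooth_loc[OF tm_J]]]])

lemma lagrange_G_eq:
  assumes c: "c \<in> A" and z: "z \<in> dm c (tm_triv c)"
  shows "lagrange_G (loc c (tm_triv c)) z i = (- 1/2) * W c (tm_triv c) z $ i"
proof -
  \<comment> \<open>With zero bracket the corresponding term of \<open>EL_force\<close> is a
    derivative in the direction \<open>(0, 0)\<close>.\<close>
  have "fd (loc c (tm_triv c)) z (0, 0) = 0" using fd_loc_0[OF c z] by (simp add: zero_prod_def)
  then have "EL_force (loc c (tm_triv c)) (\<lambda>b. b) (\<lambda>_ _. 0) z $ j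
      = (\<Sum>k\<in>UNIV. pd_u (pd_x (loc c (tm_triv c)) k) j z * snd z $ k) - pd_x (loc c (tm_triv c)) j z" for j
    by (simp add: EL_force_def pd_x_def)
  then show ?thesis
    by (simp add: lagrange_G_def W_def spray_def matrix_vector_mult_def)
qed

lemma is_xi_L_iff: "is_xi_L A L \<xi> \<longleftrightarrow> spray_field \<xi>"
proof -
  have "xi_at c (tm_triv c) e = (let C = ch c (tm_triv c) in
      (\<Sum>i\<in>UNIV. snd (cmap C e) $ i *\<^sub>R vec_x (tm_atlas A) C e i)
      - (\<Sum>i\<in>UNIV. (2 * lagrange_G (local_rep L C) (cmap C e) i) *\<^sub>R vec_u (tm_atlas A) C e i))"
    if "c \<in> A" "e \<in> slit A (tangent A)" "e \<in> cdom (ch c (tm_triv c))" for c e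
  proof -
    have "2 * lagrange_G (loc c (tm_triv c)) (cmap (ch c (tm_triv c)) e) i = - W c (tm_triv c) (cmap (ch c (tm_triv c)) e) $ i" for i
      using lagrange_G_eq[OF that(1) in_dm[OF tm_J[OF that(1)] that(2,3)]] by simp
    then show ?thesis
      unfolding Let_def by (intro xi_at_eq[OF tm_J[OF that(1)] that(3)]) (simp_all add: cmap_ch)
  qed
  then show ?thesis
    unfolding is_xi_L_def spray_field_def all_J ball_tm_atlas by (auto simp: Let_def)
qed

lemma ex1_spray_field: "\<exists>!\<xi>. \<xi> \<in> extensional (slit A (tangent A)) \<and> is_xi_L A L \<xi>"
proof -
  have "\<exists>!\<xi>. \<xi> \<in> extensional (slit A (tangent A)) \<and>
      (\<forall>c\<in>A. \<forall>e\<in>slit A (tangent A) \<inter> cdom (ch c (tm_triv c)). \<xi> e = xi_at c (tm_triv c) e)"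
    using slit_cover xi_at_change[OF tm_J tm_J] by (intro glue_ex1) blast+
  then show ?thesis unfolding is_xi_L_iff spray_field_def all_J .
qed

text \<open>The base component at (x, y) is y, because the anchor is the identity; so the projected
  vector is the point of TM itself.\<close>

lemma spray_field_semispray:
  assumes "spray_field \<xi>"
  shows "tm_semispray A \<xi>"
  unfolding tm_semispray_def
proof (intro conjI ballI)
  show "smooth_vector_field (tm_atlas A) (slit A (tangent A)) \<xi>" by (rule spray_field_smooth[OF assms])
  fix e assume e: "e \<in> slit A (tangent A)"
  then obtain c t where j: "(c, t) \<in> (\<lambda>c. (c, tm_triv c)) ` A" "e \<in> cdom (ch c t)" using slit_cover by blast
  then have c: "c \<in> A" "t = tm_triv c" by auto
  have p: "fst e \<in> cdom c" "snd e \<in> tangent A (fst e)" using j(2) by (auto simp: ch_dom)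
  have "\<xi> e \<in> tangent (tm_atlas A) e"
    unfolding spray_fieldD[OF assms j(1) e j(2)] xi_at_def Let_def
    by (rule tot.coord_vec_in_tangent[OF ch_in_B[OF j(1)] j(2)])
  from tangent_map_projection[OF this j]
  have "tangent_map (tm_atlas A) A fst (e, \<xi> e) = (fst e, coord_vec A c (fst e) (snd e c))"
    unfolding spray_fieldD[OF assms j(1) e j(2)] xi_at_ch[OF j] by (simp add: c)
  also have "\<dots> = e" using tangent_eq_coord_vec[OF p(2) c(1) p(1)] by simp
  finally show "tangent_map (tm_atlas A) A tm_projection (e, \<xi> e) = e"
    by (simp add: tm_projection_def[abs_def])
qed

lemma euler_lagrange_tm_iff:
  assumes "spray_field \<xi>" "differentiable_curve (tm_atlas A) (slit A (tangent A)) I \<gamma>"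
  shows "euler_lagrange_tm A L I \<gamma> \<longleftrightarrow> integral_curve (tm_atlas A) \<xi> I \<gamma>"
proof -
  have "euler_lagrange_tm A L I \<gamma> \<longleftrightarrow> (\<forall>s\<in>I. \<forall>c t. (c, t) \<in> (\<lambda>c. (c, tm_triv c)) ` A \<longrightarrow> \<gamma> s \<in> cdom (ch c t) \<longrightarrow>
      (let f = loc c t; z = (\<lambda>s. cmap (ch c t) (\<gamma> s)) in
      ((\<lambda>s. fst (z s)) has_vector_derivative snd (z s)) (at s) \<and>
      (\<forall>i. \<exists>d. ((\<lambda>s. pd_u f i (z s)) has_real_derivative d) (at s) \<and> d - pd_x f i (z s) = 0)))"
    unfolding euler_lagrange_tm_def all_J ball_tm_atlas ..
  also have "\<dots> \<longleftrightarrow> integral_curve (tm_atlas A) \<xi> I \<gamma>"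
  proof (rule integral_curve_iff[OF assms])
    fix s c t v assume j: "(c, t) \<in> (\<lambda>c. (c, tm_triv c)) ` A" and e: "\<gamma> s \<in> slit A (tangent A)" "\<gamma> s \<in> cdom (ch c t)"
      and v: "((\<lambda>r. cmap (ch c t) (\<gamma> r)) has_vector_derivative v) (at s)"
    let ?z = "\<lambda>r. cmap (ch c t) (\<gamma> r)"
    note z = in_dm[OF j e]
    from j have c: "c \<in> A" "t = tm_triv c" by blast+
    have "fd (loc c t) (?z s) (0, 0) = 0"
      using fd_loc_0[OF c(1)] z unfolding c(2) by (simp only: zero_prod_def)
    with EL_point[OF j, of ?z s v, OF z v]
    show "(let f = loc c t; z = (\<lambda>s. cmap (ch c t) (\<gamma> s)) in
      ((\<lambda>s. fst (z s)) has_vector_derivative snd (z s)) (at s) \<and>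
      (\<forall>i. \<exists>d. ((\<lambda>s. pd_u f i (z s)) has_real_derivative d) (at s) \<and> d - pd_x f i (z s) = 0)) \<longleftrightarrow>
      v = (let z = ?z s in (snd z, W c t z))"
      unfolding Let_def pd_x_def by simp
  qed
  finally show ?thesis .
qed

lemma nonlinear_geodesic_tm_iff:
  assumes "spray_field \<xi>" "differentiable_curve (tm_atlas A) (slit A (tangent A)) I \<gamma>"
  shows "nonlinear_geodesic_tm A L I \<gamma> \<longleftrightarrow> integral_curve (tm_atlas A) \<xi> I \<gamma>"
proof -
  have "nonlinear_geodesic_tm A L I \<gamma> \<longleftrightarrow> (\<forall>s\<in>I. \<forall>c t. (c, t) \<in> (\<lambda>c. (c, tm_triv c)) ` A \<longrightarrow> \<gamma> s \<in> cdom (ch c t) \<longrightarrow>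
      (let f = loc c t; z = (\<lambda>s. cmap (ch c t) (\<gamma> s)) in
      ((\<lambda>s. fst (z s)) has_vector_derivative snd (z s)) (at s) \<and>
      (\<forall>i. \<exists>d. ((\<lambda>s. snd (z s) $ i) has_real_derivative d) (at s) \<and> d + 2 * lagrange_G f (z s) i = 0)))"
    unfolding nonlinear_geodesic_tm_def all_J ball_tm_atlas ..
  also have "\<dots> \<longleftrightarrow> integral_curve (tm_atlas A) \<xi> I \<gamma>"
  proof (rule integral_curve_iff[OF assms])
    fix s c t v assume j: "(c, t) \<in> (\<lambda>c. (c, tm_triv c)) ` A" and e: "\<gamma> s \<in> slit A (tangent A)" "\<gamma> s \<in> cdom (ch c t)"
      and v: "((\<lambda>r. cmap (ch c t) (\<gamma> r)) has_vector_derivative v) (at s)"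
    let ?z = "\<lambda>r. cmap (ch c t) (\<gamma> r)"
    from j have c: "c \<in> A" "t = tm_triv c" by blast+
    have "2 * lagrange_G (loc c t) (?z s) i = - W c t (?z s) $ i" for i
      using lagrange_G_eq[OF c(1)] in_dm[OF j e] unfolding c(2) by simp
    with geodesic_point[OF v, of "snd (?z s)" "W c t (?z s)"]
    show "(let f = loc c t; z = (\<lambda>s. cmap (ch c t) (\<gamma> s)) in
      ((\<lambda>s. fst (z s)) has_vector_derivative snd (z s)) (at s) \<and>
      (\<forall>i. \<exists>d. ((\<lambda>s. snd (z s) $ i) has_real_derivative d) (at s) \<and> d + 2 * lagrange_G f (z s) i = 0)) \<longleftrightarrow>
      v = (let z = ?z s in (snd z, W c t z))"
      unfolding Let_def by simp
  qed
  finally show ?thesis .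
qed

text \<open>The bracket term vanishes on TM, so the lift with \<open>s = 1\<close> has the
  coefficients \<partial>G/\<partial>y. This value of \<open>s\<close> is the one for which
  \<open>hor_change_1\<close> supplies the compatibility of charts.\<close>

lemma tm_frame:
  assumes c: "c \<in> A" and e: "e \<in> slit A (tangent A)" "e \<in> cdom (ch c (tm_triv c))"
  shows "vec_x (tm_atlas A) (ch c (tm_triv c)) e j
      - (\<Sum>i\<in>UNIV. lagrange_N (loc c (tm_triv c)) (cmap (ch c (tm_triv c)) e) i j *\<^sub>R vec_u (tm_atlas A) (ch c (tm_triv c)) e i)
    = coord_vec (tm_atlas A) (ch c (tm_triv c)) e (hor 1 c (tm_triv c) (cmap (ch c (tm_triv c)) e) (axis j 1))"
proof -
  let ?z = "cmap (ch c (tm_triv c)) e"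
  note j = tm_J[OF c]
  have N: "lagrange_N (loc c (tm_triv c)) ?z i j = ((- 1/2) *\<^sub>R fd (W c (tm_triv c)) ?z (0, axis j 1)) $ i" for i
    unfolding lagrange_N_def using pd_u_coefficient[OF j in_dm[OF j e] lagrange_G_eq[OF c]] by simp
  show ?thesis
    unfolding N coord_vec_sum(2)[OF j e(2)] unfolding vec_x_def coord_vec_diff[OF j e(2)]
    by (simp add: hor_def)
qed

lemma ex1_tm_nconnection:
  "\<exists>!H. tm_nconnection A H \<and> tm_coefficients A H (\<lambda>C. lagrange_N (local_rep L C))"
proof -
  let ?S = "slit A (tangent A)" and ?P = "\<lambda>c. cdom (ch c (tm_triv c))"
  let ?h = "\<lambda>c e b. coord_vec (tm_atlas A) (ch c (tm_triv c)) e (hor 1 c (tm_triv c) (cmap (ch c (tm_triv c)) e) b)"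
  let ?v = "\<lambda>c e b. coord_vec (tm_atlas A) (ch c (tm_triv c)) e (0, b)"
  have lin: "linear (?h c e)" "linear (?v c e)" and inj: "inj (coord_vec (tm_atlas A) (ch c (tm_triv c)) e)"
    if "c \<in> A" "e \<in> ?S \<inter> ?P c" for c e
  proof -
    note j = tm_J[OF that(1)]
    have e: "e \<in> ?S" "e \<in> ?P c" using that by auto
    note l = tot.linear_coord_vec[OF ch_in_B[OF j] e(2)]
    show "linear (?h c e)"
      using linear_compose[OF linear_hor[OF j in_dm[OF j e]] l] by (simp add: o_def)
    show "linear (?v c e)" by (rule linear_Pair_zero(2)[OF l])
    show "inj (coord_vec (tm_atlas A) (ch c (tm_triv c)) e)" by (rule tot.inj_coord_vec[OF ch_in_B[OF j] e(2)])
  qed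
  have "\<exists>!H. whitney_splitting (tm_atlas A) ?S (tangent (tm_atlas A)) (tm_vertical A) (smooth_vector_field (tm_atlas A)) H \<and>
      (\<forall>c\<in>A. \<forall>e\<in>?S \<inter> ?P c. H `` {e} = range (?h c e))"
  proof (rule whitney_splitting_unique_ex[where v = ?v])
    show "\<exists>c\<in>A. e \<in> ?P c" if "e \<in> ?S" for e using slit_cover[OF that] by blast
    show "mopen (tm_atlas A) (?S \<inter> ?P c)" if "c \<in> A" for c
      by (subst slit_Collect) (rule tot.mopen_Int[OF mopen_slit[OF mopen_carrier] tot.mopen_cdom[OF ch_in_B[OF tm_J[OF that]]]])
    show "smooth_vector_field (tm_atlas A) (?S \<inter> ?P c) (\<lambda>e. ?h c e (axis a 1))" if "c \<in> A" for c a
      using smooth_coord_field[OF tm_J[OF that] mopen_carrier smooth_hor[OF tm_J[OF that]]]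
      by (subst slit_Collect)
    show "range (?h c e) \<subseteq> range (?h d e)" if "c \<in> A" "d \<in> A" "e \<in> ?S \<inter> ?P c" "e \<in> ?P d" for c d e
      using hor_change_1[OF tm_J[OF that(1)] tm_J[OF that(2)] _ _ that(4)] that(3) by auto
  next
    fix c e assume c: "c \<in> A" and e: "e \<in> ?S \<inter> ?P c"
    note j = tm_J[OF c]
    have eP: "e \<in> ?P c" using e by blast
    note l = tot.linear_coord_vec[OF ch_in_B[OF j] eP]
    \<comment> \<open>The base component is \<open>a\<close>, and the vertical summand merely shifts
      the fibre component: a triangular change of coordinates, which gives all tangent
      vectors.\<close>
    have sum: "?h c e a + ?v c e b = coord_vec (tm_atlas A) (ch c (tm_triv c)) e
        (a, b + snd (hor 1 c (tm_triv c) (cmap (ch c (tm_triv c)) e) a))" for a b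
      unfolding linear_add[OF l, symmetric] by (simp add: hor_def add.commute)
    have tangent: "tangent (tm_atlas A) e = range (coord_vec (tm_atlas A) (ch c (tm_triv c)) e)"
      using tot.tangent_eq_coord_vec[OF _ ch_in_B[OF j] eP] tot.coord_vec_in_tangent[OF ch_in_B[OF j] eP]
      by (metis (no_types, lifting) image_subset_iff rangeI subsetI subset_antisym)
    show "tangent (tm_atlas A) e = {?h c e a + ?v c e b |a b. True}"
    proof (intro equalityI subsetI)
      fix w assume "w \<in> tangent (tm_atlas A) e"
      then obtain a b where "w = coord_vec (tm_atlas A) (ch c (tm_triv c)) e (a, b)" unfolding tangent by auto
      then have "w = ?h c e a + ?v c e (b - snd (hor 1 c (tm_triv c) (cmap (ch c (tm_triv c)) e) a))"
        unfolding sum by simp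
      then show "w \<in> {?h c e a + ?v c e b |a b. True}" by blast
    qed (auto simp: sum tangent)
    \<comment> \<open>In the chart the kernel of the tangent map of the projection consists of the
      vectors with zero base component.\<close>
    have ver: "tangent_map (tm_atlas A) A tm_projection (e, coord_vec (tm_atlas A) (ch c (tm_triv c)) e w) = (fst e, 0) \<longleftrightarrow> fst w = 0" for w
    proof -
      have p: "fst e \<in> cdom c" using eP by (simp add: ch_dom)
      note lp = linear_coord_vec[OF c p]
      have "tangent_map (tm_atlas A) A tm_projection (e, coord_vec (tm_atlas A) (ch c (tm_triv c)) e w)
          = (fst e, coord_vec A c (fst e) (fst w))"
        using tangent_map_projection[OF tot.coord_vec_in_tangent[OF ch_in_B[OF j] eP] j eP, of w]
        by (simp add: tm_projection_def[abs_def] tot.coord_vec_same[OF ch_in_B[OF j] eP])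
      moreover have "coord_vec A c (fst e) (fst w) = 0 \<longleftrightarrow> fst w = 0"
        using inj_coord_vec[OF c p] linear_0[OF lp] by (metis injD)
      ultimately show ?thesis by simp
    qed
    show "tm_vertical A e = range (?v c e)"
    proof (intro equalityI subsetI)
      fix w assume "w \<in> tm_vertical A e"
      then obtain y where "w = coord_vec (tm_atlas A) (ch c (tm_triv c)) e y" "fst y = 0"
        unfolding tm_vertical_def tangent using ver by auto
      then show "w \<in> range (?v c e)" by (metis prod.collapse rangeI)
    qed (auto simp: tm_vertical_def tangent ver)
    show "a = 0" if "?h c e a = ?v c e b" for a b
      using injD[OF inj[OF c e] that] by (simp add: hor_def)
  qed (rule lin; assumption)+
  moreover have "tm_coefficients A H (\<lambda>C. lagrange_N (local_rep L C)) \<longleftrightarrow>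
      (\<forall>c\<in>A. \<forall>e\<in>?S \<inter> ?P c. H `` {e} = range (?h c e))" for H
    unfolding tm_coefficients_def ball_tm_atlas
    by (intro ball_cong refl) (simp add: tm_frame span_range_axis[OF lin(1)])
  ultimately show ?thesis unfolding tm_nconnection_def by simp
qed

end

section \<open>Lie algebroids in local coordinates\<close>

context atlas begin

lemma smooth_fun_add:
  fixes f g :: "'p \<Rightarrow> 'b::euclidean_space"
  assumes "mopen A S" "smooth_fun A S f" "smooth_fun A S g"
  shows "smooth_fun A S (\<lambda>p. f p + g p)"
  using assms smooth_on_add[of "cmap c ` (S \<inter> cdom c)" "f \<circ> cinv c" "g \<circ> cinv c" for c]
  unfolding smooth_fun_def mopen_def o_def by blast

lemma smooth_fun_scaleR:
  fixes g :: "'p \<Rightarrow> 'b::euclidean_space"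
  assumes "mopen A S" "smooth_fun A S f" "smooth_fun A S g"
  shows "smooth_fun A S (\<lambda>p. f p *\<^sub>R g p)"
  using assms smooth_on_scaleR[of "cmap c ` (S \<inter> cdom c)" "f \<circ> cinv c" "g \<circ> cinv c" for c]
  unfolding smooth_fun_def mopen_def o_def by blast

lemma smooth_fun_const: "smooth_fun A S (\<lambda>p. w)"
  unfolding smooth_fun_def o_def by (simp add: smooth_on_const)

lemma smooth_fun_nth:
  fixes g :: "'p \<Rightarrow> real^'k"
  assumes "mopen A S" "smooth_fun A S g"
  shows "smooth_fun A S (\<lambda>p. g p $ i)"
  using assms smooth_on_nth[of "cmap c ` (S \<inter> cdom c)" "g \<circ> cinv c" for c]
  unfolding smooth_fun_def mopen_def o_def by blast

lemma smooth_fun_cong: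
  assumes "mopen A S" "\<And>p. p \<in> S \<Longrightarrow> f p = g p" "smooth_fun A S g"
  shows "smooth_fun A S f"
  unfolding smooth_fun_def
proof
  fix c assume c: "c \<in> A"
  show "smooth_on (cmap c ` (S \<inter> cdom c)) (f \<circ> cinv c)"
    by (rule smooth_on_congI[of _ _ "g \<circ> cinv c"])
      (use assms c in \<open>auto simp: smooth_fun_def mopen_def cinv_cmap\<close>)
qed

end

locale algebroid_atlas =
  fixes D :: "('p, 'f::real_vector, 'n::finite, 'm::finite) algebroid"
  assumes lie: "lie_algebroid D"
begin

text \<open>Here every chart is paired with every local basis, unlike on TM; the structure functions
  account for bases that are not adapted to the coordinates.\<close>

lemma bundle_atlas_algebroid: "bundle_atlas (base D) (fibre D) (trivs D) (base D \<times> trivs D) (e_atlas D)"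
proof (intro bundle_atlas.intro bundle_atlas_axioms.intro atlas.intro)
  show "smooth_atlas (base D)" using lie by (simp add: lie_algebroid_def smooth_manifold_def)
  show vb: "vector_bundle (base D) (fibre D) (trivs D)" using lie by (simp add: lie_algebroid_def)
  show "base D \<times> trivs D \<subseteq> base D \<times> trivs D" ..
  show "\<exists>c t. (c, t) \<in> base D \<times> trivs D \<and> p \<in> cdom c \<inter> fst t" if p: "p \<in> carrier_of (base D)" for p
  proof -
    obtain c where "c \<in> base D" "p \<in> cdom c" using p unfolding carrier_of_def by blast
    moreover have "p \<in> (\<Union>t\<in>trivs D. fst t)" using p vb by (simp add: vector_bundle_def)
    ultimately show ?thesis by blast
  qed
  show "e_atlas D = (\<lambda>(c, t). bundle_chart (fibre D) c t) ` (base D \<times> trivs D)"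
    unfolding e_atlas_def by (intro set_eqI iffI) (force, force)
qed

sublocale bundle_atlas "base D" "fibre D" "trivs D" "base D \<times> trivs D" "e_atlas D"
  by (rule bundle_atlas_algebroid)

abbreviation "tsec \<equiv> triv_section (fibre D)"

lemma anchor_props:
  assumes "p \<in> carrier_of (base D)" "f \<in> fibre D p"
  shows "anchor D p f \<in> tangent (base D) p"
    "g \<in> fibre D p \<Longrightarrow> anchor D p (f + g) = anchor D p f + anchor D p g"
    "anchor D p (r *\<^sub>R f) = r *\<^sub>R anchor D p f"
proof -
  note a = lie[unfolded lie_algebroid_def, THEN conjunct2, THEN conjunct2, THEN conjunct1, THEN bspec,
    OF assms(1), THEN bspec, OF assms(2)]
  show "anchor D p f \<in> tangent (base D) p" "anchor D p (r *\<^sub>R f) = r *\<^sub>R anchor D p f"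
    using a[THEN bspec, OF assms(2)] by blast+
  show "g \<in> fibre D p \<Longrightarrow> anchor D p (f + g) = anchor D p f + anchor D p g"
    using a by blast
qed

subsection \<open>Sections and their brackets\<close>

lemma sectionI:
  assumes "\<And>p. p \<in> U \<Longrightarrow> X p \<in> fibre D p"
    and "\<And>t. t \<in> trivs D \<Longrightarrow> smooth_fun (base D) (U \<inter> fst t) (\<lambda>p. snd t p (X p))"
  shows "X \<in> sections D U"
  using assms by (simp add: sections_def smooth_section_def)

lemma sectionD:
  assumes "X \<in> sections D U"
  shows "p \<in> U \<Longrightarrow> X p \<in> fibre D p"
    and "t \<in> trivs D \<Longrightarrow> smooth_fun (base D) (U \<inter> fst t) (\<lambda>p. snd t p (X p))"
  using assms by (auto simp: sections_def smooth_section_def)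

lemma mopen_subset_carrier: "mopen (base D) U \<Longrightarrow> p \<in> U \<Longrightarrow> p \<in> carrier_of (base D)"
  by (auto simp: mopen_def)

lemma section_add:
  assumes U: "mopen (base D) U" and X: "X \<in> sections D U" and Y: "Y \<in> sections D U"
  shows "(\<lambda>p. X p + Y p) \<in> sections D U"
proof (rule sectionI)
  show "X p + Y p \<in> fibre D p" if "p \<in> U" for p
    using subspace_add[OF subspace_fibre[OF mopen_subset_carrier[OF U that]]] sectionD(1)[OF X that] sectionD(1)[OF Y that] .
  fix t assume t: "t \<in> trivs D"
  have U': "mopen (base D) (U \<inter> fst t)" by (rule mopen_Int[OF U mopen_triv[OF t]])
  show "smooth_fun (base D) (U \<inter> fst t) (\<lambda>p. snd t p (X p + Y p))"
  proof (rule smooth_fun_cong[OF U' _ smooth_fun_add[OF U' sectionD(2)[OF X t] sectionD(2)[OF Y t]]])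
    fix p assume "p \<in> U \<inter> fst t"
    then show "snd t p (X p + Y p) = snd t p (X p) + snd t p (Y p)"
      by (intro triv_add[OF t] sectionD(1)[OF X] sectionD(1)[OF Y]) auto
  qed
qed

lemma section_scaleR:
  assumes U: "mopen (base D) U" and f: "smooth_fun (base D) U f" and X: "X \<in> sections D U"
  shows "(\<lambda>p. f p *\<^sub>R X p) \<in> sections D U"
proof (rule sectionI)
  show "f p *\<^sub>R X p \<in> fibre D p" if "p \<in> U" for p
    using subspace_scale[OF subspace_fibre[OF mopen_subset_carrier[OF U that]]] sectionD(1)[OF X that] .
  fix t assume t: "t \<in> trivs D"
  have U': "mopen (base D) (U \<inter> fst t)" by (rule mopen_Int[OF U mopen_triv[OF t]])
  show "smooth_fun (base D) (U \<inter> fst t) (\<lambda>p. snd t p (f p *\<^sub>R X p))"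
  proof (rule smooth_fun_cong[OF U' _ smooth_fun_scaleR[OF U' smooth_fun_subset[OF f] sectionD(2)[OF X t]]])
    fix p assume "p \<in> U \<inter> fst t"
    then show "snd t p (f p *\<^sub>R X p) = f p *\<^sub>R snd t p (X p)"
      by (intro triv_scale[OF t] sectionD(1)[OF X]) auto
  qed blast
qed

lemma section_zero:
  assumes U: "mopen (base D) U"
  shows "(\<lambda>p. 0) \<in> sections D U"
proof (rule sectionI)
  show "0 \<in> fibre D p" if "p \<in> U" for p
    using subspace_0[OF subspace_fibre[OF mopen_subset_carrier[OF U that]]] .
  fix t assume t: "t \<in> trivs D"
  have U': "mopen (base D) (U \<inter> fst t)" by (rule mopen_Int[OF U mopen_triv[OF t]])
  show "smooth_fun (base D) (U \<inter> fst t) (\<lambda>p. snd t p 0)"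
  proof (rule smooth_fun_cong[OF U' _ smooth_fun_const])
    fix p assume p: "p \<in> U \<inter> fst t"
    show "snd t p 0 = 0"
      using triv_eq_0_iff[OF t, of p 0] subspace_0[OF subspace_fibre[OF mopen_subset_carrier[OF U]]] p by blast
  qed
qed

lemma section_sum:
  assumes U: "mopen (base D) U" and "finite I" "\<And>i. i \<in> I \<Longrightarrow> X i \<in> sections D U"
  shows "(\<lambda>p. \<Sum>i\<in>I. X i p) \<in> sections D U"
  using assms(2,3)
proof (induction I rule: finite_induct)
  case empty
  then show ?case by (simp add: section_zero[OF U])
next
  case (insert i I)
  then have "(\<lambda>p. X i p + (\<Sum>i\<in>I. X i p)) \<in> sections D U" by (intro section_add[OF U]) auto
  then show ?case using insert by simp
qed

lemma section_tsec:
  assumes "t \<in> trivs D" "U \<subseteq> fst t"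
  shows "tsec t w \<in> sections D U"
proof (rule sectionI)
  show "tsec t w p \<in> fibre D p" if "p \<in> U" for p using triv_section_in[OF assms(1)] that assms(2) by blast
  fix t' assume t': "t' \<in> trivs D"
  have "smooth_fun (base D) (fst t \<inter> fst t') (\<lambda>p. snd t' p (tsec t w p))"
    using vector_bundle assms(1) t' unfolding vector_bundle_def by blast
  then show "smooth_fun (base D) (U \<inter> fst t') (\<lambda>p. snd t' p (tsec t w p))"
    by (rule smooth_fun_subset) (use assms(2) in blast)
qed

lemma bracket_local:
  assumes "mopen (base D) U" "mopen (base D) V" "V \<subseteq> U" "X \<in> sections D U" "Y \<in> sections D U"
    "X' \<in> sections D V" "Y' \<in> sections D V" "\<And>q. q \<in> V \<Longrightarrow> X' q = X q" "\<And>q. q \<in> V \<Longrightarrow> Y' q = Y q" "p \<in> V"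
  shows "bracket D V X' Y' p = bracket D U X Y p"
proof -
  have "\<forall>U V. mopen (base D) U \<and> mopen (base D) V \<and> V \<subseteq> U \<longrightarrow>
        (\<forall>X\<in>sections D U. \<forall>Y\<in>sections D U. \<forall>X'\<in>sections D V. \<forall>Y'\<in>sections D V.
          (\<forall>p\<in>V. X' p = X p \<and> Y' p = Y p) \<longrightarrow> (\<forall>p\<in>V. bracket D V X' Y' p = bracket D U X Y p))"
    using lie[unfolded lie_algebroid_def, THEN conjunct2, THEN conjunct2, THEN conjunct2, THEN conjunct2, THEN conjunct1] .
  then show ?thesis using assms by simp
qed

text \<open>For equal open sets, locality becomes extensionality: sections are total functions, and
  the bracket sees only their values on the open set.\<close>

lemmas bracket_cong = bracket_local[OF _ _ subset_refl]

context
  fixes U assumes U: "mopen (base D) U"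
begin

lemma bracket_axioms:
  assumes "X \<in> sections D U" "Y \<in> sections D U" "Z \<in> sections D U"
  shows "bracket D U X Y \<in> sections D U \<and>
          (\<forall>p\<in>U.
            bracket D U (\<lambda>q. X q + Y q) Z p = bracket D U X Z p + bracket D U Y Z p \<and>
            bracket D U X (\<lambda>q. Y q + Z q) p = bracket D U X Y p + bracket D U X Z p \<and>
            (\<forall>r. bracket D U (\<lambda>q. r *\<^sub>R X q) Y p = r *\<^sub>R bracket D U X Y p \<and>
                 bracket D U X (\<lambda>q. r *\<^sub>R Y q) p = r *\<^sub>R bracket D U X Y p) \<and>
            bracket D U X X p = 0 \<and>
            bracket D U X (bracket D U Y Z) p + bracket D U Y (bracket D U Z X) p
              + bracket D U Z (bracket D U X Y) p = 0 \<and>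
            (\<forall>f. smooth_fun (base D) U f \<longrightarrow>
              bracket D U X (\<lambda>q. f q *\<^sub>R Y q) p
                = f p *\<^sub>R bracket D U X Y p
                + tangent_deriv (base D) f p (anchor D p (X p)) *\<^sub>R Y p))"
proof -
  note last = lie[unfolded lie_algebroid_def, THEN conjunct2, THEN conjunct2, THEN conjunct2, THEN conjunct2, THEN conjunct2]
  show ?thesis by (rule last[THEN spec, THEN mp, OF U, THEN bspec, OF assms(1), THEN bspec, OF assms(2), THEN bspec, OF assms(3)])
qed

lemma bracket_section: "X \<in> sections D U \<Longrightarrow> Y \<in> sections D U \<Longrightarrow> bracket D U X Y \<in> sections D U"
  using bracket_axioms by blast

context
  fixes p assumes p: "p \<in> U"
begin

lemma bracket_add_right:
  assumes "X \<in> sections D U" "Y \<in> sections D U" "Z \<in> sections D U"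
  shows "bracket D U X (\<lambda>q. Y q + Z q) p = bracket D U X Y p + bracket D U X Z p"
  using bracket_axioms[OF assms] p by blast

lemma bracket_scaleR_right:
  assumes "X \<in> sections D U" "Y \<in> sections D U"
  shows "bracket D U X (\<lambda>q. r *\<^sub>R Y q) p = r *\<^sub>R bracket D U X Y p"
  using bracket_axioms[OF assms assms(2)] p by blast

lemma bracket_Leibniz:
  assumes "X \<in> sections D U" "Y \<in> sections D U" "smooth_fun (base D) U f"
  shows "bracket D U X (\<lambda>q. f q *\<^sub>R Y q) p
    = f p *\<^sub>R bracket D U X Y p + tangent_deriv (base D) f p (anchor D p (X p)) *\<^sub>R Y p"
  using bracket_axioms[OF assms(1,2,2)] assms(3) p by blast

text \<open>Polarization of \<open>[Z, Z] = 0\<close> at the sum \<open>X + Y\<close>.\<close>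

lemma bracket_swap:
  assumes X: "X \<in> sections D U" and Y: "Y \<in> sections D U"
  shows "bracket D U X Y p = - bracket D U Y X p"
proof -
  have alt: "bracket D U Z Z p = 0" if "Z \<in> sections D U" for Z
    using bracket_axioms[OF that that that] p by blast
  have "0 = bracket D U (\<lambda>q. X q + Y q) (\<lambda>q. X q + Y q) p" by (rule alt[OF section_add[OF U X Y], symmetric])
  also have "\<dots> = bracket D U X (\<lambda>q. X q + Y q) p + bracket D U Y (\<lambda>q. X q + Y q) p"
    using bracket_axioms[OF X Y section_add[OF U X Y]] p by blast
  also have "\<dots> = bracket D U X Y p + bracket D U Y X p"
    by (simp add: bracket_add_right[OF X X Y] bracket_add_right[OF Y X Y] alt[OF X] alt[OF Y])
  finally show ?thesis by (simp add: eq_neg_iff_add_eq_0)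
qed

lemma bracket_sum_right:
  assumes X: "X \<in> sections D U" and "finite I" "\<And>i. i \<in> I \<Longrightarrow> Y i \<in> sections D U"
  shows "bracket D U X (\<lambda>q. \<Sum>i\<in>I. Y i q) p = (\<Sum>i\<in>I. bracket D U X (Y i) p)"
  using assms(2,3)
proof (induction I rule: finite_induct)
  case empty
  \<comment> \<open>The zero section is written as a multiple of \<open>X\<close>, so that
    homogeneity gives the empty sum.\<close>
  have "bracket D U X (\<lambda>q. 0 *\<^sub>R X q) p = 0 *\<^sub>R bracket D U X X p" by (rule bracket_scaleR_right[OF X X])
  then show ?case by simp
next
  case (insert i I)
  then have "bracket D U X (\<lambda>q. Y i q + (\<Sum>i\<in>I. Y i q)) p = bracket D U X (Y i) p + bracket D U X (\<lambda>q. \<Sum>i\<in>I. Y i q) p"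
    by (intro bracket_add_right[OF X] section_sum[OF U]) auto
  then show ?case using insert by simp
qed

end

lemma linear_bracket_tsec:
  assumes t: "t \<in> trivs D" "U \<subseteq> fst t" and X: "X \<in> sections D U" and p: "p \<in> U"
  shows "linear (\<lambda>w. bracket D U X (tsec t w) p)"
proof (rule linearI)
  note s = section_tsec[OF t]
  have l: "linear (\<lambda>w. tsec t w q)" if "q \<in> U" for q using linear_triv_section[OF t(1)] that t(2) by blast
  show "bracket D U X (tsec t (a + b)) p = bracket D U X (tsec t a) p + bracket D U X (tsec t b) p" for a b
    unfolding bracket_add_right[OF p X s s, symmetric]
    by (rule bracket_cong[OF U U X section_add[OF U s s] X s _ _ p]) (simp_all add: linear_add[OF l])
  show "bracket D U X (tsec t (r *\<^sub>R a)) p = r *\<^sub>R bracket D U X (tsec t a) p" for r a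
    unfolding bracket_scaleR_right[OF p X s, symmetric]
    by (rule bracket_cong[OF U U X section_scaleR[OF U smooth_fun_const s] X s _ _ p])
      (simp_all add: linear_scale[OF l])
qed

text \<open>Expand \<open>Y\<close> in the local basis and apply the Leibniz rule to each term. The
  undifferentiated coefficients recombine to the bracket with the constant section of value
  \<open>g p\<close>, the differentiated ones to the derivative of \<open>g\<close> along the anchor
  of \<open>X\<close>.\<close>

lemma bracket_coordinates:
  assumes t: "t \<in> trivs D" "U \<subseteq> fst t" and X: "X \<in> sections D U"
    and g: "smooth_fun (base D) U g" and c: "c \<in> base D" "p \<in> U" "p \<in> cdom c"
    and Y: "Y \<in> sections D U" "\<And>q. q \<in> U \<Longrightarrow> Y q = tsec t (g q) q"
  shows "bracket D U X Y p = bracket D U X (tsec t (g p)) p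
    + tsec t (fd (g \<circ> cinv c) (cmap c p) (anchor D p (X p) c)) p"
proof -
  note s = section_tsec[OF t]
  have l: "linear (\<lambda>w. tsec t w q)" if "q \<in> U" for q using linear_triv_section[OF t(1)] that t(2) by blast
  have gi: "smooth_fun (base D) U (\<lambda>q. g q $ i)" for i by (rule smooth_fun_nth[OF U g])
  note si = section_scaleR[OF U gi s]
  have "bracket D U X Y p = bracket D U X (\<lambda>q. \<Sum>i\<in>UNIV. g q $ i *\<^sub>R tsec t (axis i 1) q) p"
  proof (rule bracket_cong[OF U U X section_sum[OF U finite si] X Y(1) refl _ c(2)])
    show "Y q = (\<Sum>i\<in>UNIV. g q $ i *\<^sub>R tsec t (axis i 1) q)" if "q \<in> U" for q
      unfolding Y(2)[OF that] by (rule linear_axis_sum[OF l[OF that]])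
  qed
  also have "\<dots> = (\<Sum>i\<in>UNIV. g p $ i *\<^sub>R bracket D U X (tsec t (axis i 1)) p
      + tangent_deriv (base D) (\<lambda>q. g q $ i) p (anchor D p (X p)) *\<^sub>R tsec t (axis i 1) p)"
    unfolding bracket_sum_right[OF c(2) X finite si] bracket_Leibniz[OF c(2) X s gi] ..
  also have "\<dots> = (\<Sum>i\<in>UNIV. g p $ i *\<^sub>R bracket D U X (tsec t (axis i 1)) p)
      + (\<Sum>i\<in>UNIV. fd (g \<circ> cinv c) (cmap c p) (anchor D p (X p) c) $ i *\<^sub>R tsec t (axis i 1) p)"
  proof -
    have "tangent_deriv (base D) (\<lambda>q. g q $ i) p (anchor D p (X p))
        = fd (g \<circ> cinv c) (cmap c p) (anchor D p (X p) c) $ i" for i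
    proof -
      have der: "((\<lambda>q. g q $ i) \<circ> cinv d has_derivative (\<lambda>v. fd (g \<circ> cinv d) (cmap d p) v $ i)) (at (cmap d p))"
        if d: "d \<in> base D" "p \<in> cdom d" for d
      proof -
        have "smooth_on (cmap d ` (U \<inter> cdom d)) (g \<circ> cinv d)" using g d by (simp add: smooth_fun_def)
        from smooth_on_has_derivative[OF this, of "cmap d p"] c(2) d(2)
        have "(g \<circ> cinv d has_derivative fd (g \<circ> cinv d) (cmap d p)) (at (cmap d p))" by blast
        from bounded_linear.has_derivative[OF bounded_linear_vec_nth this] show ?thesis by (simp add: o_def)
      qed
      have "tangent_deriv (base D) (\<lambda>q. g q $ i) p (anchor D p (X p))
          = fd ((\<lambda>q. g q $ i) \<circ> cinv c) (cmap c p) (anchor D p (X p) c)"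
        by (rule tangent_deriv_eq[OF anchor_props(1)[OF mopen_subset_carrier[OF U c(2)] sectionD(1)[OF X c(2)]] c(1,3)])
          (use der in \<open>auto simp: differentiable_def\<close>)
      then show ?thesis using fd_eq[OF der[OF c(1,3)]] by simp
    qed
    then show ?thesis by (simp only: sum.distrib)
  qed
  also have "(\<Sum>i\<in>UNIV. g p $ i *\<^sub>R bracket D U X (tsec t (axis i 1)) p) = bracket D U X (tsec t (g p)) p"
    by (rule linear_axis_sum[OF linear_bracket_tsec[OF t X c(2)], symmetric])
  also have "(\<Sum>i\<in>UNIV. fd (g \<circ> cinv c) (cmap c p) (anchor D p (X p) c) $ i *\<^sub>R tsec t (axis i 1) p)
      = tsec t (fd (g \<circ> cinv c) (cmap c p) (anchor D p (X p) c)) p"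
    by (rule linear_axis_sum[OF l[OF c(2)], symmetric])
  finally show ?thesis .
qed

end

end

section \<open>The structure functions and their transformation laws\<close>

context algebroid_atlas begin

text \<open>This and \<open>Br\<close> are the structure functions as maps on constant sections. The
  transformation laws are then free of indices; \<open>anchor_coef_eq\<close> and
  \<open>struct_coef_eq\<close> recover the components.\<close>

definition Rho :: "('p, real^'n) chart \<Rightarrow> ('p, 'f, 'm) triv \<Rightarrow> real^'n \<Rightarrow> real^'m \<Rightarrow> real^'n" where
  "Rho c t x b = anchor D (cinv c x) (tsec t b (cinv c x)) c"

definition Br :: "('p, real^'n) chart \<Rightarrow> ('p, 'f, 'm) triv \<Rightarrow> real^'n \<Rightarrow> real^'m \<Rightarrow> real^'m \<Rightarrow> real^'m" where
  "Br c t x a b = snd t (cinv c x) (bracket D (fst t) (tsec t a) (tsec t b) (cinv c x))"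

lemma anchor_coef_eq: "anchor_coef D c t x i a = Rho c t x (axis a 1) $ i"
  by (simp add: anchor_coef_def Let_def Rho_def basis_section_def)

lemma struct_coef_eq: "struct_coef D c t x e a b = Br c t x (axis a 1) (axis b 1) $ e"
  by (simp add: struct_coef_def Let_def Br_def basis_section_def)

lemma Rho_cmap: "c \<in> base D \<Longrightarrow> p \<in> cdom c \<Longrightarrow> Rho c t (cmap c p) b = anchor D p (tsec t b p) c"
  by (simp add: Rho_def cinv_cmap)

lemma Br_cmap: "c \<in> base D \<Longrightarrow> p \<in> cdom c \<Longrightarrow> Br c t (cmap c p) a b = snd t p (bracket D (fst t) (tsec t a) (tsec t b) p)"
  by (simp add: Br_def cinv_cmap)

lemma linear_Rho:
  assumes c: "c \<in> base D" "p \<in> cdom c" and t: "t \<in> trivs D" "p \<in> fst t"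
  shows "linear (Rho c t (cmap c p))"
proof (rule linearI)
  note l = linear_triv_section[OF t] and i = triv_section_in[OF t] and q = triv_carrier[OF t]
  show "Rho c t (cmap c p) (a + b) = Rho c t (cmap c p) a + Rho c t (cmap c p) b" for a b
    unfolding Rho_cmap[OF c] linear_add[OF l] anchor_props(2)[OF q i i] by simp
  show "Rho c t (cmap c p) (r *\<^sub>R a) = r *\<^sub>R Rho c t (cmap c p) a" for r a
    unfolding Rho_cmap[OF c] linear_scale[OF l] anchor_props(3)[OF q i] by (simp add: scaleR_fun_def)
qed

lemma bracket_tsec_in:
  assumes "t \<in> trivs D" "p \<in> fst t"
  shows "bracket D (fst t) (tsec t a) (tsec t b) p \<in> fibre D p"
  by (rule sectionD(1)[OF bracket_section[OF mopen_triv[OF assms(1)] section_tsec[OF assms(1) subset_refl]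
    section_tsec[OF assms(1) subset_refl]] assms(2)])

lemma linear_Br2:
  assumes c: "c \<in> base D" "p \<in> cdom c" and t: "t \<in> trivs D" "p \<in> fst t"
  shows "linear (Br c t (cmap c p) a)"
proof (rule linearI)
  note l = linear_bracket_tsec[OF mopen_triv[OF t(1)] t(1) subset_refl section_tsec[OF t(1) subset_refl] t(2), of a]
  show "Br c t (cmap c p) a (b + b') = Br c t (cmap c p) a b + Br c t (cmap c p) a b'" for b b'
    unfolding Br_cmap[OF c] linear_add[OF l] by (rule triv_add[OF t bracket_tsec_in[OF t] bracket_tsec_in[OF t]])
  show "Br c t (cmap c p) a (r *\<^sub>R b) = r *\<^sub>R Br c t (cmap c p) a b" for r b
    unfolding Br_cmap[OF c] linear_scale[OF l] by (rule triv_scale[OF t bracket_tsec_in[OF t]])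
qed

lemma Br_swap:
  assumes c: "c \<in> base D" "p \<in> cdom c" and t: "t \<in> trivs D" "p \<in> fst t"
  shows "Br c t (cmap c p) a b = - Br c t (cmap c p) b a"
proof -
  note s = section_tsec[OF t(1) subset_refl]
  have "bracket D (fst t) (tsec t a) (tsec t b) p = (- 1) *\<^sub>R bracket D (fst t) (tsec t b) (tsec t a) p"
    using bracket_swap[OF mopen_triv[OF t(1)] t(2) s s, of a b] by simp
  then show ?thesis
    unfolding Br_cmap[OF c] using triv_scale[OF t bracket_tsec_in[OF t], of "- 1" b a] by simp
qed

text \<open>Additivity and the Leibniz rule were exploited in the second argument; antisymmetry
  carries linearity over to the first.\<close>

lemma linear_Br1:
  assumes c: "c \<in> base D" "p \<in> cdom c" and t: "t \<in> trivs D" "p \<in> fst t"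
  shows "linear (\<lambda>a. Br c t (cmap c p) a b)"
proof -
  have "(\<lambda>a. Br c t (cmap c p) a b) = (\<lambda>a. - Br c t (cmap c p) b a)"
    by (rule ext) (rule Br_swap[OF assms])
  then show ?thesis using linear_compose_neg[OF linear_Br2[OF assms, of b]] by simp
qed

lemma smooth_Rho:
  assumes c: "c \<in> base D" and t: "t \<in> trivs D"
  shows "smooth_on (cmap c ` (cdom c \<inter> fst t)) (\<lambda>x. Rho c t x b)"
proof -
  have "smooth_vector_field (base D) (fst t) (\<lambda>p. anchor D p (tsec t b p))"
    using lie[unfolded lie_algebroid_def, THEN conjunct2, THEN conjunct2, THEN conjunct2, THEN conjunct1] t by blast
  then have "smooth_fun (base D) (fst t \<inter> cdom c) (\<lambda>p. anchor D p (tsec t b p) c)"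
    using c unfolding smooth_vector_field_def by blast
  from smooth_fun_chart[OF this c, of "cdom c \<inter> fst t"] show ?thesis
    unfolding Rho_def[abs_def] o_def by blast
qed

lemma smooth_Br:
  assumes c: "c \<in> base D" and t: "t \<in> trivs D"
  shows "smooth_on (cmap c ` (cdom c \<inter> fst t)) (\<lambda>x. Br c t x a b)"
proof -
  note s = section_tsec[OF t subset_refl]
  have "smooth_fun (base D) (fst t \<inter> fst t) (\<lambda>p. snd t p (bracket D (fst t) (tsec t a) (tsec t b) p))"
    by (rule sectionD(2)[OF bracket_section[OF mopen_triv[OF t] s s] t])
  from smooth_fun_chart[OF this c, of "cdom c \<inter> fst t"] show ?thesis
    unfolding Br_def[abs_def] o_def by blast
qed

text \<open>Both sides are components, in the chart \<open>c'\<close>, of the same tangent vector: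
  the anchor of one element of the fibre.\<close>

lemma Rho_change:
  assumes j: "(c, t) \<in> base D \<times> trivs D" "(c', t') \<in> base D \<times> trivs D" and p: "p \<in> overlap c t c' t'"
  shows "Rho c' t' (cmap c' p) (lam c t t' (cmap c p) b) = fd (trans c c') (cmap c p) (Rho c t (cmap c p) b)"
proof -
  note c = chart_J[OF j(1)] and c' = chart_J[OF j(2)] and t = triv_J[OF j(1)] and t' = triv_J[OF j(2)]
  have p': "p \<in> cdom c" "p \<in> cdom c'" "p \<in> fst t" "p \<in> fst t'" using p by auto
  show ?thesis
    unfolding Rho_cmap[OF c p'(1)] Rho_cmap[OF c' p'(2)] triv_section_lam[OF j(1) t' p'(1,3,4)]
    by (rule tangentD[OF anchor_props(1)[OF triv_carrier[OF t p'(3)] triv_section_in[OF t p'(3)]] c c' p'(1,2)])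
qed

text \<open>A constant section of the basis \<open>t\<close> has the coefficients
  \<open>lam c t t' x w\<close> in the basis \<open>t'\<close>. Replacing both arguments of the
  bracket in turn by sections that are constant in \<open>t'\<close> costs one Leibniz term each;
  antisymmetry gives these terms opposite signs.\<close>

lemma Br_change:
  assumes j: "(c, t) \<in> base D \<times> trivs D" "(c', t') \<in> base D \<times> trivs D" and p: "p \<in> overlap c t c' t'"
  shows "lam c t t' (cmap c p) (Br c t (cmap c p) a b)
    = Br c' t' (cmap c' p) (lam c t t' (cmap c p) a) (lam c t t' (cmap c p) b)
      + fd (\<lambda>x. lam c t t' x b) (cmap c p) (Rho c t (cmap c p) a)
      - fd (\<lambda>x. lam c t t' x a) (cmap c p) (Rho c t (cmap c p) b)"
proof -
  note c = chart_J[OF j(1)] and c' = chart_J[OF j(2)] and t = triv_J[OF j(1)] and t' = triv_J[OF j(2)]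
  have p': "p \<in> cdom c" "p \<in> cdom c'" "p \<in> fst t" "p \<in> fst t'" using p by auto
  let ?U = "fst t \<inter> fst t'"
  have U: "mopen (base D) ?U" by (rule mopen_Int[OF mopen_triv[OF t] mopen_triv[OF t']])
  have pU: "p \<in> ?U" using p' by blast
  have s: "tsec t w \<in> sections D ?U" and s': "tsec t' w \<in> sections D ?U" for w
    by (rule section_tsec[OF t], blast) (rule section_tsec[OF t'], blast)
  define g where "g w q = snd t' q (tsec t w q)" for w q
  have g: "smooth_fun (base D) ?U (g w)" for w
    unfolding g_def using vector_bundle t t' unfolding vector_bundle_def by blast
  have gl: "g w p = lam c t t' (cmap c p) w" for w by (simp add: g_def lam_cmap[OF c p'(1)])
  have gc: "g w \<circ> cinv c = (\<lambda>x. lam c t t' x w)" for w by (simp add: g_def lam_def fun_eq_iff)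
  have tg: "tsec t w q = tsec t' (g w q) q" if "q \<in> ?U" for w q
    unfolding g_def using that by (intro triv_section_triv[OF t', symmetric] triv_section_in[OF t]) auto
  note coord = bracket_coordinates[OF U t' Int_lower2 _ g c pU p'(1) s tg, unfolded gc gl]
  let ?L = "lam c t t' (cmap c p)"
  let ?A = "fd (\<lambda>x. lam c t t' x b) (cmap c p) (Rho c t (cmap c p) a)"
    and ?B = "fd (\<lambda>x. lam c t t' x a) (cmap c p) (Rho c t (cmap c p) b)"
  let ?br = "bracket D ?U (tsec t' (?L a)) (tsec t' (?L b)) p"
  have "bracket D ?U (tsec t a) (tsec t b) p = bracket D ?U (tsec t a) (tsec t' (?L b)) p + tsec t' ?A p"
    using coord[OF s] unfolding Rho_cmap[OF c p'(1)] .
  \<comment> \<open>The swap brings the remaining section of the basis \<open>t\<close> into the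
    second argument, where \<open>coord\<close> can expand it.\<close>
  also have "bracket D ?U (tsec t a) (tsec t' (?L b)) p = - bracket D ?U (tsec t' (?L b)) (tsec t a) p"
    by (rule bracket_swap[OF U pU s s'])
  also have "bracket D ?U (tsec t' (?L b)) (tsec t a) p
      = bracket D ?U (tsec t' (?L b)) (tsec t' (?L a)) p + tsec t' ?B p"
    using coord[OF s', of "?L b" a] unfolding triv_section_lam[OF j(1) t' p'(1,3,4)] Rho_cmap[OF c p'(1)] .
  also have "bracket D ?U (tsec t' (?L b)) (tsec t' (?L a)) p = - ?br"
    by (rule bracket_swap[OF U pU s' s'])
  finally have eq: "bracket D ?U (tsec t a) (tsec t b) p = ?br + tsec t' (?A - ?B) p"
    by (simp add: linear_diff[OF linear_triv_section[OF t' p'(4)]])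
  have in1: "?br \<in> fibre D p" by (rule sectionD(1)[OF bracket_section[OF U s' s'] pU])
  \<comment> \<open>The structure functions are brackets over the whole domains of \<open>t\<close>
    and \<open>t'\<close>; locality restricts both to the common domain, where the computation takes
    place.\<close>
  have r1: "bracket D (fst t) (tsec t a) (tsec t b) p = bracket D ?U (tsec t a) (tsec t b) p"
    by (rule bracket_local[OF mopen_triv[OF t] U _ section_tsec[OF t subset_refl] section_tsec[OF t subset_refl] s s refl refl pU, symmetric]) blast
  have r2: "bracket D (fst t') (tsec t' (?L a)) (tsec t' (?L b)) p = ?br"
    by (rule bracket_local[OF mopen_triv[OF t'] U _ section_tsec[OF t' subset_refl] section_tsec[OF t' subset_refl] s' s' refl refl pU, symmetric]) blast
  have "?L (Br c t (cmap c p) a b) = snd t' p (?br + tsec t' (?A - ?B) p)"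
    unfolding Br_cmap[OF c p'(1)] lam_triv[OF j(1) p'(1,3) bracket_tsec_in[OF t p'(3)]] unfolding r1 eq ..
  also have "\<dots> = snd t' p ?br + (?A - ?B)"
    unfolding triv_add[OF t' p'(4) in1 triv_section_in[OF t' p'(4)]] triv_triv_section[OF t' p'(4)] ..
  also have "snd t' p ?br = Br c' t' (cmap c' p) (?L a) (?L b)"
    unfolding Br_cmap[OF c' p'(2)] r2 ..
  finally show ?thesis by simp
qed

end

section \<open>Lagrange algebroids\<close>

locale lagrange_algebroid_atlas = algebroid_atlas D for D :: "('p, 'f::real_vector, 'n::finite, 'm::finite) algebroid" +
  fixes l :: "'p \<times> 'f \<Rightarrow> real"
  assumes l: "regular_lagrangian (e_atlas D) (e_slit D) l"
begin

lemma lagrangian_bundle_algebroid: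
  "lagrangian_bundle (base D) (fibre D) (trivs D) (base D \<times> trivs D) (e_atlas D) Rho Br l"
proof (rule lagrangian_bundle.intro[OF bundle_atlas_algebroid], rule lagrangian_bundle_axioms.intro)
  show "regular_lagrangian (e_atlas D) (slit (base D) (fibre D)) l" using l by (simp add: e_slit_def)
qed (blast intro: linear_Rho linear_Br1 linear_Br2 smooth_Rho smooth_Br | rule Rho_change Br_change; assumption)+

sublocale lagrangian_bundle "base D" "fibre D" "trivs D" "base D \<times> trivs D" "e_atlas D" Rho Br l
  by (rule lagrangian_bundle_algebroid)

lemma algebroid_J: "c \<in> base D \<Longrightarrow> t \<in> trivs D \<Longrightarrow> (c, t) \<in> base D \<times> trivs D" by simp

lemma all_J: "(\<forall>c t. (c, t) \<in> base D \<times> trivs D \<longrightarrow> P c t) \<longleftrightarrow> (\<forall>c\<in>base D. \<forall>t\<in>trivs D. P c t)"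
  by blast

section \<open>The index formulas for G and N in terms of the spray and the lift\<close>

lemma fd_loc_fibre:
  assumes "(c, t) \<in> base D \<times> trivs D" "z \<in> dm c t"
  shows "fd (loc c t) z (0, k) = (\<Sum>e\<in>UNIV. k $ e * pd_u (loc c t) e z)"
    and "fd (loc c t) z (h, 0) = (\<Sum>i\<in>UNIV. h $ i * pd_x (loc c t) i z)"
proof -
  note lin = fd_linear[OF smooth_on_differentiable[OF smooth_loc[OF assms(1)] assms(2)]]
  show "fd (loc c t) z (0, k) = (\<Sum>e\<in>UNIV. k $ e * pd_u (loc c t) e z)"
    unfolding pd_u_def by (subst linear_axis_sum[OF linear_Pair_zero(2)[OF lin]]) simp
  show "fd (loc c t) z (h, 0) = (\<Sum>i\<in>UNIV. h $ i * pd_x (loc c t) i z)"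
    unfolding pd_x_def by (subst linear_axis_sum[OF linear_Pair_zero(1)[OF lin]]) simp
qed

lemma coef_sums:
  assumes j: "(c, t) \<in> base D \<times> trivs D" and z: "z \<in> dm c t"
  shows "(\<Sum>d\<in>UNIV. anchor_coef D c t (fst z) i d * u $ d) = Rho c t (fst z) u $ i"
    and "(\<Sum>d\<in>UNIV. struct_coef D c t (fst z) e a d * u $ d) = Br c t (fst z) (axis a 1) u $ e"
proof -
  obtain p where p: "p \<in> cdom c \<inter> fst t" "fst z = cmap c p" using z by (rule dm_cases)
  show "(\<Sum>d\<in>UNIV. anchor_coef D c t (fst z) i d * u $ d) = Rho c t (fst z) u $ i"
    unfolding p(2) anchor_coef_eq
    by (subst linear_axis_sum[OF linear_R[OF j p(1)], of u]) (simp add: mult.commute)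
  show "(\<Sum>d\<in>UNIV. struct_coef D c t (fst z) e a d * u $ d) = Br c t (fst z) (axis a 1) u $ e"
    unfolding p(2) struct_coef_eq
    by (subst linear_axis_sum[OF linear_K2[OF j p(1)], of _ u]) (simp add: mult.commute)
qed

lemma force_terms:
  assumes j: "(c, t) \<in> base D \<times> trivs D" and z: "z \<in> dm c t"
  shows "(\<Sum>e\<in>UNIV. \<Sum>d\<in>UNIV. struct_coef D c t (fst z) e b d * u $ d * pd_u (loc c t) e z)
      = fd (loc c t) z (0, Br c t (fst z) (axis b 1) u)"
    and "(\<Sum>i\<in>UNIV. anchor_coef D c t (fst z) i b * pd_x (loc c t) i z) = fd (loc c t) z (Rho c t (fst z) (axis b 1), 0)"
proof -
  have "(\<Sum>d\<in>UNIV. struct_coef D c t (fst z) e b d * u $ d * pd_u (loc c t) e z)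
      = Br c t (fst z) (axis b 1) u $ e * pd_u (loc c t) e z" for e
    unfolding coef_sums(2)[OF j z, symmetric] sum_distrib_right ..
  then show "(\<Sum>e\<in>UNIV. \<Sum>d\<in>UNIV. struct_coef D c t (fst z) e b d * u $ d * pd_u (loc c t) e z)
      = fd (loc c t) z (0, Br c t (fst z) (axis b 1) u)"
    unfolding fd_loc_fibre(1)[OF j z] by simp
  show "(\<Sum>i\<in>UNIV. anchor_coef D c t (fst z) i b * pd_x (loc c t) i z) = fd (loc c t) z (Rho c t (fst z) (axis b 1), 0)"
    unfolding fd_loc_fibre(2)[OF j z] anchor_coef_eq ..
qed

lemma algebroid_G_eq:
  assumes j: "(c, t) \<in> base D \<times> trivs D" and z: "z \<in> dm c t"
  shows "algebroid_G D l c t z a = (- 1/2) * W c t z $ a"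
proof -
  have "(\<Sum>i\<in>UNIV. \<Sum>d\<in>UNIV. pd_u (pd_x (loc c t) i) b z * anchor_coef D c t (fst z) i d * snd z $ d)
      = (\<Sum>i\<in>UNIV. pd_u (pd_x (loc c t) i) b z * Rho c t (fst z) (snd z) $ i)" for b
    unfolding coef_sums(1)[OF j z, symmetric] sum_distrib_left by (simp only: mult.assoc)
  then have "EL_force (loc c t) (Rho c t (fst z)) (Br c t (fst z)) z $ b
      = (\<Sum>i\<in>UNIV. \<Sum>d\<in>UNIV. pd_u (pd_x (loc c t) i) b z * anchor_coef D c t (fst z) i d * snd z $ d)
        + (\<Sum>e\<in>UNIV. \<Sum>d\<in>UNIV. struct_coef D c t (fst z) e b d * snd z $ d * pd_u (loc c t) e z)
        - (\<Sum>i\<in>UNIV. anchor_coef D c t (fst z) i b * pd_x (loc c t) i z)" for b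
    unfolding force_terms[OF j z] by (simp add: EL_force_def)
  then show ?thesis
    by (simp add: algebroid_G_def Let_def W_def spray_def matrix_vector_mult_def)
qed

text \<open>Identifies the two kinds of coefficients in the theorem with the two values of the
  parameter of \<open>hor\<close>.\<close>

lemma algebroid_N_eq:
  assumes j: "(c, t) \<in> base D \<times> trivs D" and z: "z \<in> dm c t"
  shows "algebroid_N D l c t z b a = (- snd (hor 0 c t z (axis a 1))) $ b"
    and "algebroid_N_global D l c t z b a = (- snd (hor 1 c t z (axis a 1))) $ b"
proof -
  have N: "algebroid_N D l c t z b a = (- 1/2) * fd (W c t) z (0, axis a 1) $ b"
    unfolding algebroid_N_def by (rule pd_u_coefficient[OF j z algebroid_G_eq[OF j]])
  then show "algebroid_N D l c t z b a = (- snd (hor 0 c t z (axis a 1))) $ b" by (simp add: hor_def)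
  show "algebroid_N_global D l c t z b a = (- snd (hor 1 c t z (axis a 1))) $ b"
    unfolding algebroid_N_global_def N coef_sums(2)[OF j z] by (simp add: hor_def)
qed

subsection \<open>The prolongation\<close>

lemma prol_z_v_eq:
  assumes j: "(c, t) \<in> base D \<times> trivs D" and e: "e \<in> cdom (ch c t)"
  shows "prol_z D c t e a = (tsec t (axis a 1) (fst e), coord_vec (e_atlas D) (ch c t) e (Rho c t (cmap c (fst e)) (axis a 1), 0))"
    and "prol_v D c t e b = (0, coord_vec (e_atlas D) (ch c t) e (0, axis b 1))"
  unfolding prol_z_def prol_v_def anchor_coef_eq coord_vec_sum(1)[OF j e] basis_section_def vec_u_def by simp_all

lemma prol_z_v_sum:
  assumes j: "(c, t) \<in> base D \<times> trivs D" and e: "e \<in> cdom (ch c t)"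
  shows "(\<Sum>a\<in>UNIV. u $ a *\<^sub>R prol_z D c t e a)
      = (tsec t u (fst e), coord_vec (e_atlas D) (ch c t) e (Rho c t (cmap c (fst e)) u, 0))"
    and "(\<Sum>b\<in>UNIV. w $ b *\<^sub>R prol_v D c t e b) = (0, coord_vec (e_atlas D) (ch c t) e (0, w))"
proof -
  have p: "fst e \<in> cdom c" "fst e \<in> fst t" using e by (auto simp: ch_dom)
  note cv = tot.linear_coord_vec[OF ch_in_B[OF j] e]
  have R: "linear (Rho c t (cmap c (fst e)))" by (rule linear_R[OF j]) (use p in blast)
  note s = linear_triv_section[OF triv_J[OF j] p(2)]
  have "linear (\<lambda>u. coord_vec (e_atlas D) (ch c t) e (Rho c t (cmap c (fst e)) u, 0))"
    using linear_compose[OF R linear_Pair_zero(1)[OF cv]] by (simp add: o_def)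
  then have "linear (\<lambda>u. (tsec t u (fst e), coord_vec (e_atlas D) (ch c t) e (Rho c t (cmap c (fst e)) u, 0)))"
    using s by (simp add: linear_iff)
  from linear_axis_sum[OF this, of u]
  show "(\<Sum>a\<in>UNIV. u $ a *\<^sub>R prol_z D c t e a)
      = (tsec t u (fst e), coord_vec (e_atlas D) (ch c t) e (Rho c t (cmap c (fst e)) u, 0))"
    unfolding prol_z_v_eq[OF j e] ..
  have "linear (\<lambda>w. (0 :: 'f, coord_vec (e_atlas D) (ch c t) e (0, w)))"
    using linear_Pair_zero(2)[OF cv] by (simp add: linear_iff)
  from linear_axis_sum[OF this, of w]
  show "(\<Sum>b\<in>UNIV. w $ b *\<^sub>R prol_v D c t e b) = (0, coord_vec (e_atlas D) (ch c t) e (0, w))"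
    unfolding prol_z_v_eq[OF j e] ..
qed

text \<open>The condition \<rho>(b) = T\<pi>(z) prescribes the base component of z and leaves its
  fibre component \<open>y\<close> free, so \<open>(b, y)\<close> are linear coordinates of the
  fibre.\<close>

lemma prol_fibre_eq:
  assumes j: "(c, t) \<in> base D \<times> trivs D" and e: "e \<in> cdom (ch c t)"
  shows "prol_fibre D e = {(tsec t b (fst e), coord_vec (e_atlas D) (ch c t) e (Rho c t (cmap c (fst e)) b, y)) | b y. True}"
proof -
  let ?C = "ch c t" and ?p = "fst e"
  note c = chart_J[OF j] and t = triv_J[OF j]
  have p: "?p \<in> cdom c" "?p \<in> fst t" "snd e \<in> fibre D ?p" using e by (auto simp: ch_dom)
  have q: "?p \<in> carrier_of (base D)" by (rule triv_carrier[OF t p(2)])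
  have proj: "tangent_map (e_atlas D) (base D) fst (e, w) = (?p, coord_vec (base D) c ?p (fst (w ?C)))"
    if "w \<in> tangent (e_atlas D) e" for w by (rule tangent_map_projection[OF that j e])
  \<comment> \<open>Both sides are tangent vectors of the base, so the single chart \<open>c\<close>
    decides their equality.\<close>
  have anchor: "anchor D ?p f = coord_vec (base D) c ?p x \<longleftrightarrow> anchor D ?p f c = x" if "f \<in> fibre D ?p" for f x
    using tangent_eq_coord_vec[OF anchor_props(1)[OF q that] c p(1)] coord_vec_same[OF c p(1)] by metis
  have mem: "(f, w) \<in> prol_fibre D e \<longleftrightarrow> f \<in> fibre D ?p \<and> w \<in> tangent (e_atlas D) e \<and> anchor D ?p f c = fst (w ?C)" for f w
    using p(3) q proj anchor by (cases e) (auto simp: prol_fibre_def prolongation_def)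
  show ?thesis
  proof (intro equalityI subsetI)
    fix v assume "v \<in> prol_fibre D e"
    then obtain f w where v: "v = (f, w)" "f \<in> fibre D ?p" "w \<in> tangent (e_atlas D) e" "anchor D ?p f c = fst (w ?C)"
      using mem by (cases v) auto
    have f: "tsec t (snd t ?p f) ?p = f" by (rule triv_section_triv[OF t p(2) v(2)])
    have w: "w = coord_vec (e_atlas D) ?C e (Rho c t (cmap c ?p) (snd t ?p f), snd (w ?C))"
      using tot.tangent_eq_coord_vec[OF v(3) ch_in_B[OF j] e] unfolding Rho_cmap[OF c p(1)] f v(4) by simp
    have "v = (tsec t (snd t ?p f) ?p, coord_vec (e_atlas D) ?C e (Rho c t (cmap c ?p) (snd t ?p f), snd (w ?C)))"
      unfolding v(1) f by (rule arg_cong[OF w, of "Pair f"])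
    then show "v \<in> {(tsec t b ?p, coord_vec (e_atlas D) ?C e (Rho c t (cmap c ?p) b, y)) | b y. True}"
      by blast
  next
    fix v assume "v \<in> {(tsec t b ?p, coord_vec (e_atlas D) ?C e (Rho c t (cmap c ?p) b, y)) | b y. True}"
    then obtain b y where v: "v = (tsec t b ?p, coord_vec (e_atlas D) ?C e (Rho c t (cmap c ?p) b, y))" by blast
    show "v \<in> prol_fibre D e"
      unfolding v mem tot.coord_vec_same[OF ch_in_B[OF j] e] Rho_cmap[OF c p(1)]
      by (simp add: triv_section_in[OF t p(2)] tot.coord_vec_in_tangent[OF ch_in_B[OF j] e])
  qed
qed

lemma smooth_fun_lift:
  fixes g :: "'p \<Rightarrow> 'b::euclidean_space"
  assumes S: "mopen (base D) S" and g: "smooth_fun (base D) S g"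
  shows "smooth_fun (e_atlas D) {e \<in> slit (base D) (fibre D). fst e \<in> S} (\<lambda>e. g (fst e))"
  unfolding smooth_fun_def
proof
  fix C assume "C \<in> e_atlas D"
  then obtain c t where C: "(c, t) \<in> base D \<times> trivs D" "C = ch c t" by (rule B_cases)
  note c = chart_J[OF C(1)] and t = triv_J[OF C(1)]
  let ?X = "cmap c ` (S \<inter> (cdom c \<inter> fst t))"
  have X: "open ?X" by (rule mopen_open_image[OF mopen_Int[OF S mopen_Int[OF mopen_cdom[OF c] mopen_triv[OF t]]] c]) blast
  have O: "open (?X \<times> (- {0 :: real^'m}))" by (intro open_Times X) auto
  have gX: "smooth_on ?X (g \<circ> cinv c)" by (rule smooth_fun_chart[OF g c]) blast
  show "smooth_on (cmap C ` ({e \<in> slit (base D) (fibre D). fst e \<in> S} \<inter> cdom C)) ((\<lambda>e. g (fst e)) \<circ> cinv C)"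
    unfolding C(2) image_slit[OF C(1)]
  proof (rule smooth_on_congI[OF _ _ O])
    show "smooth_on (?X \<times> (- {0 :: real^'m})) (\<lambda>z. (g \<circ> cinv c) (fst z))"
      by (rule smooth_on_compose[OF O X _ smooth_on_linear[OF bounded_linear_fst] gX]) auto
    fix z assume "z \<in> ?X \<times> (- {0 :: real^'m})"
    then obtain p u where "p \<in> cdom c" "p \<in> fst t" "z = (cmap c p, u)" by auto
    then show "((\<lambda>e. g (fst e)) \<circ> cinv (ch c t)) z = (g \<circ> cinv c) (fst z)"
      using cinv_ch(1)[OF C(1)] c by (simp add: cinv_cmap)
  qed
qed

lemma smooth_fibre_coordinate:
  assumes t: "t \<in> trivs D"
  shows "smooth_fun (e_atlas D) {e \<in> slit (base D) (fibre D). fst e \<in> fst t} (\<lambda>e. snd t (fst e) (snd e))"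
proof (rule tot.smooth_fun_local)
  fix e assume e: "e \<in> {e \<in> slit (base D) (fibre D). fst e \<in> fst t}"
  then obtain c where c: "c \<in> base D" "fst e \<in> cdom c" by (auto simp: slit_def carrier_of_def)
  note j = algebroid_J[OF c(1) t]
  let ?U = "{e \<in> slit (base D) (fibre D). fst e \<in> fst t} \<inter> cdom (ch c t)"
  have U: "mopen (e_atlas D) ?U"
    by (rule tot.mopen_Int[OF mopen_slit[OF mopen_triv[OF t]] tot.mopen_cdom[OF ch_in_B[OF j]]])
  have "smooth_on (cmap (ch c t) ` ?U) ((\<lambda>e. snd t (fst e) (snd e)) \<circ> cinv (ch c t))"
  proof (rule smooth_on_congI[OF _ smooth_on_linear[OF bounded_linear_snd] tot.mopen_open_image[OF U ch_in_B[OF j]]])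
    fix z assume "z \<in> cmap (ch c t) ` ?U"
    then obtain e where "e \<in> cdom (ch c t)" "z = cmap (ch c t) e" by blast
    then show "((\<lambda>e. snd t (fst e) (snd e)) \<circ> cinv (ch c t)) z = snd z"
      unfolding o_apply by (simp add: tot.cinv_cmap[OF ch_in_B[OF j]]) (simp add: cmap_ch)
  qed blast
  moreover have "e \<in> ?U" using e c by (auto simp: ch_dom slit_def)
  ultimately show "\<exists>C\<in>e_atlas D. \<exists>U. mopen (e_atlas D) U \<and> e \<in> U \<and> U \<subseteq> cdom C \<and>
      smooth_on (cmap C ` U) ((\<lambda>e. snd t (fst e) (snd e)) \<circ> cinv C)"
    using U ch_in_B[OF j] by blast
qed

end

context lagrange_algebroid_atlas begin

subsection \<open>The semispray\<close>

text \<open>The first component of \<open>u\<^sup>a z\<^sub>a\<close> is the element of the fibre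
  with coordinates u, that is, \<open>snd e\<close>; what remains to be glued is the vector
  field.\<close>

lemma is_spray_section_iff:
  "is_spray_section D l S \<longleftrightarrow>
    (\<forall>c\<in>base D. \<forall>t\<in>trivs D. \<forall>e\<in>e_slit D \<inter> cdom (ch c t). S e = (snd e, xi_at c t e))"
proof -
  have "(let z = cmap (ch c t) e in
      (\<Sum>a\<in>UNIV. snd z $ a *\<^sub>R prol_z D c t e a) - (\<Sum>a\<in>UNIV. (2 * algebroid_G D l c t z a) *\<^sub>R prol_v D c t e a))
      = (snd e, xi_at c t e)"
    if c: "c \<in> base D" and t: "t \<in> trivs D" and e: "e \<in> e_slit D \<inter> cdom (ch c t)" for c t e
  proof -
    note j = algebroid_J[OF c t]
    have e': "e \<in> slit (base D) (fibre D)" "e \<in> cdom (ch c t)" using e by (auto simp: e_slit_def)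
    have p: "fst e \<in> fst t" "snd e \<in> fibre D (fst e)" using e'(2) by (auto simp: ch_dom)
    let ?z = "cmap (ch c t) e"
    have G: "2 * algebroid_G D l c t ?z a = (- W c t ?z) $ a" for a
      using algebroid_G_eq[OF j in_dm[OF j e'], of a] by simp
    show ?thesis
      unfolding Let_def G prol_z_v_sum[OF j e'(2)] unfolding xi_at_def Let_def
      by (simp add: coord_vec_diff[OF j e'(2)] cmap_ch triv_section_triv[OF t p])
  qed
  then show ?thesis unfolding is_spray_section_def Let_def by (intro ball_cong refl) simp
qed

lemma ball_J: "(\<forall>j\<in>base D \<times> trivs D. P (fst j) (snd j)) \<longleftrightarrow> (\<forall>c\<in>base D. \<forall>t\<in>trivs D. P c t)"
  by force

lemma ex1_spray_section: "\<exists>!S. S \<in> extensional (e_slit D) \<and> is_spray_section D l S"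
proof -
  have "\<exists>!S. S \<in> extensional (e_slit D) \<and> (\<forall>j\<in>base D \<times> trivs D.
      \<forall>e\<in>e_slit D \<inter> cdom (ch (fst j) (snd j)). S e = (snd e, xi_at (fst j) (snd j) e))"
  proof (rule glue_ex1)
    show "\<exists>j\<in>base D \<times> trivs D. e \<in> cdom (ch (fst j) (snd j))" if "e \<in> e_slit D" for e
    proof -
      obtain c t where "(c, t) \<in> base D \<times> trivs D" "e \<in> cdom (ch c t)"
        using slit_cover \<open>e \<in> e_slit D\<close> unfolding e_slit_def by blast
      then show ?thesis by (intro bexI[of _ "(c, t)"]) simp_all
    qed
    fix i j e assume ij: "i \<in> base D \<times> trivs D" "j \<in> base D \<times> trivs D" and e: "e \<in> e_slit D"
      "e \<in> cdom (ch (fst i) (snd i))" "e \<in> cdom (ch (fst j) (snd j))"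
    have "xi_at (fst i) (snd i) e = xi_at (fst j) (snd j) e"
      by (rule xi_at_change[OF _ _ e(1)[unfolded e_slit_def] e(2,3)]) (use ij in simp_all)
    then show "(snd e, xi_at (fst i) (snd i) e) = (snd e, xi_at (fst j) (snd j) e)" by simp
  qed
  then show ?thesis
    unfolding is_spray_section_iff
      ball_J[of "\<lambda>c t. \<forall>e\<in>e_slit D \<inter> cdom (ch c t). S e = (snd e, xi_at c t e)" for S] .
qed

lemma spray_section_eq:
  "is_spray_section D l S \<Longrightarrow> (c, t) \<in> base D \<times> trivs D \<Longrightarrow> e \<in> e_slit D \<Longrightarrow> e \<in> cdom (ch c t) \<Longrightarrow>
    S e = (snd e, xi_at c t e)"
  unfolding is_spray_section_iff by blast

lemma spray_section_spray_field:
  assumes "is_spray_section D l S"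
  shows "spray_field (\<lambda>e. snd (S e))"
  unfolding spray_field_def e_slit_def[symmetric]
proof (intro allI impI ballI)
  fix c t e assume "(c, t) \<in> base D \<times> trivs D" "e \<in> e_slit D \<inter> cdom (ch c t)"
  then show "snd (S e) = xi_at c t e" using spray_section_eq[OF assms, of c t e] by simp
qed

lemma fst_spray_section:
  assumes "is_spray_section D l S" "e \<in> e_slit D"
  shows "fst (S e) = snd e"
proof -
  obtain c t where "(c, t) \<in> base D \<times> trivs D" "e \<in> cdom (ch c t)"
    using slit_cover assms(2) unfolding e_slit_def by blast
  then show ?thesis using spray_section_eq[OF assms(1) _ assms(2)] by simp
qed

lemma spray_section_semispray:
  assumes S: "is_spray_section D l S"
  shows "algebroid_semispray D S"
  unfolding algebroid_semispray_def prol_section_def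
proof (intro conjI ballI)
  show "fst (S e) = snd e" if "e \<in> e_slit D" for e by (rule fst_spray_section[OF S that])
  show "smooth_vector_field (e_atlas D) (e_slit D) (\<lambda>e. snd (S e))"
    unfolding e_slit_def by (rule spray_field_smooth[OF spray_section_spray_field[OF S]])
  show "S e \<in> prol_fibre D e" if e: "e \<in> e_slit D" for e
  proof -
    obtain c t where j: "(c, t) \<in> base D \<times> trivs D" "e \<in> cdom (ch c t)"
      using slit_cover e unfolding e_slit_def by blast
    have p: "fst e \<in> fst t" "snd e \<in> fibre D (fst e)" using j(2) by (auto simp: ch_dom)
    have "S e = (tsec t (snd t (fst e) (snd e)) (fst e), coord_vec (e_atlas D) (ch c t) e
        (Rho c t (cmap c (fst e)) (snd t (fst e) (snd e)), W c t (cmap (ch c t) e)))"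
      unfolding spray_section_eq[OF S j(1) e j(2)] triv_section_triv[OF triv_J[OF j(1)] p] xi_at_def Let_def
      by (simp add: cmap_ch)
    then show ?thesis unfolding prol_fibre_eq[OF j] by blast
  qed
  fix t assume t: "t \<in> trivs D"
  have "mopen (e_atlas D) {e \<in> e_slit D. fst e \<in> fst t}"
    unfolding e_slit_def by (rule mopen_slit[OF mopen_triv[OF t]])
  then show "smooth_fun (e_atlas D) {e \<in> e_slit D. fst e \<in> fst t} (\<lambda>e. snd t (fst e) (fst (S e)))"
    by (rule tot.smooth_fun_cong[OF _ _ smooth_fibre_coordinate[OF t, folded e_slit_def]])
      (simp add: fst_spray_section[OF S])
qed

lemma spray_section_xi_l:
  assumes S: "is_spray_section D l S"
  shows "is_xi_l D l (\<lambda>e. snd (S e))"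
  unfolding is_xi_l_def Let_def
proof (intro ballI)
  fix c t e assume c: "c \<in> base D" and t: "t \<in> trivs D" and e: "e \<in> e_slit D \<inter> cdom (ch c t)"
  note j = algebroid_J[OF c t]
  have e': "e \<in> slit (base D) (fibre D)" "e \<in> cdom (ch c t)" using e by (auto simp: e_slit_def)
  let ?z = "cmap (ch c t) e"
  have z: "?z \<in> dm c t" by (rule in_dm[OF j e'])
  have R: "(\<Sum>a\<in>UNIV. snd ?z $ a * anchor_coef D c t (fst ?z) i a) = Rho c t (fst ?z) (snd ?z) $ i" for i
    using coef_sums(1)[OF j z, of i "snd ?z"] by (simp add: mult.commute)
  have G: "2 * algebroid_G D l c t ?z a = - W c t ?z $ a" for a
    using algebroid_G_eq[OF j z, of a] by simp
  have "snd (S e) = xi_at c t e" using spray_section_eq[OF S j] e by simp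
  also have "\<dots> = (\<Sum>i\<in>UNIV. Rho c t (fst ?z) (snd ?z) $ i *\<^sub>R vec_x (e_atlas D) (ch c t) e i)
      - (\<Sum>a\<in>UNIV. (2 * algebroid_G D l c t ?z a) *\<^sub>R vec_u (e_atlas D) (ch c t) e a)"
    by (rule xi_at_eq[OF j e'(2) _ G]) (simp add: cmap_ch)
  finally show "snd (S e) = (\<Sum>i\<in>UNIV. (\<Sum>a\<in>UNIV. snd ?z $ a * anchor_coef D c t (fst ?z) i a) *\<^sub>R vec_x (e_atlas D) (ch c t) e i)
      - (\<Sum>a\<in>UNIV. (2 * algebroid_G D l c t ?z a) *\<^sub>R vec_u (e_atlas D) (ch c t) e a)"
    unfolding R .
qed

lemma euler_lagrange_algebroid_iff:
  assumes "spray_field \<xi>" "differentiable_curve (e_atlas D) (e_slit D) I \<gamma>"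
  shows "euler_lagrange_algebroid D l I \<gamma> \<longleftrightarrow> integral_curve (e_atlas D) \<xi> I \<gamma>"
  unfolding euler_lagrange_algebroid_def all_J[symmetric]
proof (rule integral_curve_iff[OF assms(1) assms(2)[unfolded e_slit_def]])
  fix s c t v assume j: "(c, t) \<in> base D \<times> trivs D" and e: "\<gamma> s \<in> slit (base D) (fibre D)" "\<gamma> s \<in> cdom (ch c t)"
    and v: "((\<lambda>r. cmap (ch c t) (\<gamma> r)) has_vector_derivative v) (at s)"
  let ?z = "\<lambda>r. cmap (ch c t) (\<gamma> r)"
  note z = in_dm[OF j e]
  have R: "(\<chi> i. \<Sum>b\<in>UNIV. anchor_coef D c t (fst (?z s)) i b * snd (?z s) $ b) = Rho c t (fst (?z s)) (snd (?z s))"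
    unfolding coef_sums(1)[OF j z] by (simp add: vec_eq_iff)
  show "(let C = ch c t; f = local_rep l C; z = (\<lambda>r. cmap C (\<gamma> r)); u = snd (z s);
          \<rho> = anchor_coef D c t (fst (z s)); K = struct_coef D c t (fst (z s)) in
      ((\<lambda>r. fst (z r)) has_vector_derivative (\<chi> i. \<Sum>b\<in>UNIV. \<rho> i b * u $ b)) (at s) \<and>
      (\<forall>a. \<exists>d. ((\<lambda>r. pd_u f a (z r)) has_real_derivative d) (at s) \<and>
         d - (\<Sum>i\<in>UNIV. \<rho> i a * pd_x f i (z s))
           + (\<Sum>e\<in>UNIV. \<Sum>b\<in>UNIV. K e a b * u $ b * pd_u f e (z s)) = 0)) \<longleftrightarrow>
    v = (let z = ?z s in (Rho c t (fst z) (snd z), W c t z))"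
    unfolding Let_def R force_terms[OF j z] by (rule EL_point[OF j, of ?z s v, OF z v])
qed

lemma nonlinear_geodesic_algebroid_iff:
  assumes "spray_field \<xi>" "differentiable_curve (e_atlas D) (e_slit D) I \<gamma>"
  shows "nonlinear_geodesic_algebroid D l I \<gamma> \<longleftrightarrow> integral_curve (e_atlas D) \<xi> I \<gamma>"
  unfolding nonlinear_geodesic_algebroid_def all_J[symmetric]
proof (rule integral_curve_iff[OF assms(1) assms(2)[unfolded e_slit_def]])
  fix s c t v assume j: "(c, t) \<in> base D \<times> trivs D" and e: "\<gamma> s \<in> slit (base D) (fibre D)" "\<gamma> s \<in> cdom (ch c t)"
    and v: "((\<lambda>r. cmap (ch c t) (\<gamma> r)) has_vector_derivative v) (at s)"
  let ?z = "\<lambda>r. cmap (ch c t) (\<gamma> r)"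
  note z = in_dm[OF j e]
  have R: "(\<chi> i. \<Sum>b\<in>UNIV. anchor_coef D c t (fst (?z s)) i b * snd (?z s) $ b) = Rho c t (fst (?z s)) (snd (?z s))"
    unfolding coef_sums(1)[OF j z] by (simp add: vec_eq_iff)
  have G: "d + 2 * algebroid_G D l c t (?z s) a = 0 \<longleftrightarrow> d = W c t (?z s) $ a" for a d
    using algebroid_G_eq[OF j z, of a] by auto
  show "(let C = ch c t; z = (\<lambda>r. cmap C (\<gamma> r)); u = snd (z s); \<rho> = anchor_coef D c t (fst (z s)) in
      ((\<lambda>r. fst (z r)) has_vector_derivative (\<chi> i. \<Sum>b\<in>UNIV. \<rho> i b * u $ b)) (at s) \<and>
      (\<forall>a. \<exists>d. ((\<lambda>r. snd (z r) $ a) has_real_derivative d) (at s) \<and>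
         d + 2 * algebroid_G D l c t (z s) a = 0)) \<longleftrightarrow>
    v = (let z = ?z s in (Rho c t (fst z) (snd z), W c t z))"
    unfolding Let_def R G by (rule geodesic_point[OF v])
qed

subsection \<open>The splittings\<close>

text \<open>The lift to the prolongation: \<open>b\<close> gives the first component directly and
  the base component of the second through the anchor, so the pair lies in the prolongation for
  every \<open>s\<close>.\<close>

definition hlift :: "real \<Rightarrow> ('p, real^'n) chart \<Rightarrow> ('p, 'f, 'm) triv \<Rightarrow> 'p \<times> 'f \<Rightarrow> real^'m \<Rightarrow>
    'f \<times> ('p \<times> 'f, (real^'n) \<times> (real^'m)) tvec" where
  "hlift s c t e b = (tsec t b (fst e), coord_vec (e_atlas D) (ch c t) e (hor s c t (cmap (ch c t) e) b))"

lemma prol_frame: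
  assumes j: "(c, t) \<in> base D \<times> trivs D" and e: "e \<in> e_slit D" "e \<in> cdom (ch c t)"
    and N: "\<And>b. N b = (- snd (hor s c t (cmap (ch c t) e) (axis a 1))) $ b"
  shows "prol_z D c t e a - (\<Sum>b\<in>UNIV. N b *\<^sub>R prol_v D c t e b) = hlift s c t e (axis a 1)"
  unfolding N prol_z_v_sum(2)[OF j e(2)] unfolding prol_z_v_eq(1)[OF j e(2)] hlift_def
  by (simp add: coord_vec_diff[OF j e(2)]) (simp add: hor_def cmap_ch)

lemma linear_hlift:
  assumes j: "(c, t) \<in> base D \<times> trivs D" and e: "e \<in> e_slit D" "e \<in> cdom (ch c t)"
  shows "linear (hlift s c t e)"
proof -
  have p: "fst e \<in> fst t" using e(2) by (simp add: ch_dom)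
  have "linear (\<lambda>b. coord_vec (e_atlas D) (ch c t) e (hor s c t (cmap (ch c t) e) b))"
    using linear_compose[OF linear_hor[OF j in_dm[OF j e(1)[unfolded e_slit_def] e(2)]] tot.linear_coord_vec[OF ch_in_B[OF j] e(2)]]
    by (simp add: o_def)
  then show ?thesis
    using linear_triv_section[OF triv_J[OF j] p] unfolding hlift_def by (simp add: linear_iff)
qed

lemma smooth_hlift:
  assumes j: "(c, t) \<in> base D \<times> trivs D" and S: "mopen (base D) S"
  shows "prol_section D ({e \<in> e_slit D. fst e \<in> S} \<inter> cdom (ch c t)) (\<lambda>e. hlift s c t e b)"
  unfolding prol_section_def
proof (intro conjI ballI)
  let ?U = "{e \<in> e_slit D. fst e \<in> S} \<inter> cdom (ch c t)"
  show "hlift s c t e b \<in> prol_fibre D e" if "e \<in> ?U" for e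
  proof -
    have e: "e \<in> cdom (ch c t)" using that by blast
    show ?thesis unfolding prol_fibre_eq[OF j e] hlift_def hor_def by (simp add: cmap_ch) blast
  qed
  show "smooth_vector_field (e_atlas D) ?U (\<lambda>e. snd (hlift s c t e b))"
    unfolding hlift_def snd_conv e_slit_def by (rule smooth_coord_field[OF j S smooth_hor[OF j]])
  fix t' assume t': "t' \<in> trivs D"
  note t = triv_J[OF j]
  have "smooth_fun (base D) (fst t \<inter> fst t') (\<lambda>p. snd t' p (tsec t b p))"
    using vector_bundle t t' unfolding vector_bundle_def by blast
  from smooth_fun_lift[OF mopen_Int[OF mopen_triv[OF t] mopen_triv[OF t']] this]
  show "smooth_fun (e_atlas D) {e \<in> ?U. fst e \<in> fst t'} (\<lambda>e. snd t' (fst e) (fst (hlift s c t e b)))"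
    unfolding hlift_def fst_conv by (rule tot.smooth_fun_subset) (auto simp: ch_dom e_slit_def)
qed

text \<open>Common to both kinds of splitting. For \<open>s = 0\<close> the set \<open>J'\<close>
  contains the pairs with one fixed local basis and \<open>S\<close> is its domain; for
  \<open>s = 1\<close> it contains all pairs and \<open>S\<close> is the whole base. Hypothesis
  \<open>K\<close> is what makes the lifts compatible.\<close>

lemma ex1_prol_nconnection:
  assumes S: "mopen (base D) S" and J': "J' \<subseteq> base D \<times> trivs D"
    and cover: "\<And>e. e \<in> e_slit D \<Longrightarrow> fst e \<in> S \<Longrightarrow> \<exists>j\<in>J'. e \<in> cdom (ch (fst j) (snd j))"
    and K: "\<And>c t c' t' p b u. (c, t) \<in> J' \<Longrightarrow> (c', t') \<in> J' \<Longrightarrow> p \<in> overlap c t c' t' \<Longrightarrow>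
      s *\<^sub>R (lam c t t' (cmap c p) (Br c t (cmap c p) b u)
        - Br c' t' (cmap c' p) (lam c t t' (cmap c p) b) (lam c t t' (cmap c p) u))
      = fd (\<lambda>x. lam c t t' x u) (cmap c p) (Rho c t (cmap c p) b)
        - fd (\<lambda>x. lam c t t' x b) (cmap c p) (Rho c t (cmap c p) u)"
  shows "\<exists>!H. prol_nconnection D {e \<in> e_slit D. fst e \<in> S} H \<and>
    (\<forall>j\<in>J'. \<forall>e\<in>{e \<in> e_slit D. fst e \<in> S} \<inter> cdom (ch (fst j) (snd j)). H `` {e} = range (hlift s (fst j) (snd j) e))"
  unfolding prol_nconnection_def
proof (rule whitney_splitting_unique_ex[where v = "\<lambda>j e b. (0, coord_vec (e_atlas D) (ch (fst j) (snd j)) e (0, b))"])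
  let ?W = "{e \<in> e_slit D. fst e \<in> S}"
  have J: "(fst j, snd j) \<in> base D \<times> trivs D" if "j \<in> J'" for j using J' that by auto
  show "\<exists>j\<in>J'. e \<in> cdom (ch (fst j) (snd j))" if "e \<in> ?W" for e using cover that by blast
  show "mopen (e_atlas D) (?W \<inter> cdom (ch (fst j) (snd j)))" if "j \<in> J'" for j
    unfolding e_slit_def by (rule tot.mopen_Int[OF mopen_slit[OF S] tot.mopen_cdom[OF ch_in_B[OF J[OF that]]]])
  show "prol_section D (?W \<inter> cdom (ch (fst j) (snd j))) (\<lambda>e. hlift s (fst j) (snd j) e (axis a 1))" if "j \<in> J'" for j a
    by (rule smooth_hlift[OF J[OF that] S])
  show "range (hlift s (fst i) (snd i) e) \<subseteq> range (hlift s (fst j) (snd j) e)"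
    if i: "i \<in> J'" and j: "j \<in> J'" and ei: "e \<in> ?W \<inter> cdom (ch (fst i) (snd i))" and ej: "e \<in> cdom (ch (fst j) (snd j))" for i j e
  proof -
    obtain c t c' t' where ij: "i = (c, t)" "j = (c', t')" by (cases i, cases j)
    have e: "e \<in> slit (base D) (fibre D)" "e \<in> cdom (ch c t)" "e \<in> cdom (ch c' t')"
      using ei ej by (auto simp: ij e_slit_def)
    note Ji = J[OF i, unfolded ij fst_conv snd_conv] and Jj = J[OF j, unfolded ij fst_conv snd_conv]
    have p: "fst e \<in> overlap c t c' t'" by (rule overlap_dm(2)[OF Ji Jj e])
    \<comment> \<open>Both components transform by the same substitution of \<open>b\<close>: the
      first because it is one element of the fibre in two bases, the second by
      \<open>hor_change\<close>.\<close>
    have "hlift s c t e b = hlift s c' t' e (lam c t t' (cmap c (fst e)) b)" for b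
      unfolding hlift_def hor_change[OF Ji Jj e K[OF i[unfolded ij] j[unfolded ij] p]]
      using p by (simp add: triv_section_lam[OF Ji triv_J[OF Jj]])
    then show ?thesis unfolding ij fst_conv snd_conv by (metis image_subsetI rangeI)
  qed
next
  let ?W = "{e \<in> e_slit D. fst e \<in> S}"
  fix j e assume j: "j \<in> J'" and e: "e \<in> ?W \<inter> cdom (ch (fst j) (snd j))"
  obtain c t where ct: "j = (c, t)" by (cases j)
  have J: "(c, t) \<in> base D \<times> trivs D" using j J' ct by blast
  have e': "e \<in> e_slit D" "e \<in> cdom (ch c t)" using e ct by auto
  have p: "fst e \<in> fst t" using e'(2) by (simp add: ch_dom)
  note cv = tot.linear_coord_vec[OF ch_in_B[OF J] e'(2)]
  let ?cv = "coord_vec (e_atlas D) (ch c t) e"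
  show "linear (hlift s (fst j) (snd j) e)" unfolding ct fst_conv snd_conv by (rule linear_hlift[OF J e'])
  show "linear (\<lambda>b. (0 :: 'f, coord_vec (e_atlas D) (ch (fst j) (snd j)) e (0, b)))"
    using linear_Pair_zero(2)[OF cv] by (simp add: ct linear_iff)
  have sum: "hlift s c t e a + (0, ?cv (0, b))
      = (tsec t a (fst e), ?cv (Rho c t (cmap c (fst e)) a, b + snd (hor s c t (cmap (ch c t) e) a)))" for a b
    unfolding hlift_def by (simp add: linear_add[OF cv, symmetric]) (simp add: hor_def cmap_ch add.commute)
  show fib: "prol_fibre D e = {hlift s (fst j) (snd j) e a + (0, coord_vec (e_atlas D) (ch (fst j) (snd j)) e (0, b)) |a b. True}"
    unfolding ct fst_conv snd_conv sum prol_fibre_eq[OF J e'(2)]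
  proof (intro equalityI subsetI)
    fix q assume "q \<in> {(tsec t b (fst e), ?cv (Rho c t (cmap c (fst e)) b, y)) |b y. True}"
    then obtain b y where "q = (tsec t b (fst e), ?cv (Rho c t (cmap c (fst e)) b,
        (y - snd (hor s c t (cmap (ch c t) e) b)) + snd (hor s c t (cmap (ch c t) e) b)))" by auto
    then show "q \<in> {(tsec t a (fst e), ?cv (Rho c t (cmap c (fst e)) a, b + snd (hor s c t (cmap (ch c t) e) a))) |a b. True}"
      by blast
  qed blast
  \<comment> \<open>The first component of an element determines \<open>b\<close>. This yields the
    vertical fibre as well as the transversality of the lift.\<close>
  have t0: "tsec t a (fst e) = 0 \<longleftrightarrow> a = 0" for a
    using triv_triv_section[OF triv_J[OF J] p] linear_0[OF linear_triv_section[OF triv_J[OF J] p]] by metis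
  show "prol_vertical D e = range (\<lambda>b. (0, coord_vec (e_atlas D) (ch (fst j) (snd j)) e (0, b)))"
    unfolding ct fst_conv snd_conv prol_vertical_def prol_fibre_eq[OF J e'(2)]
  proof (intro equalityI subsetI)
    fix q assume "q \<in> {q \<in> {(tsec t b (fst e), ?cv (Rho c t (cmap c (fst e)) b, y)) |b y. True}. fst q = 0}"
    then obtain b y where "q = (tsec t b (fst e), ?cv (Rho c t (cmap c (fst e)) b, y))" "tsec t b (fst e) = 0" by auto
    then have "q = (0, ?cv (0, y))"
      using t0[of b] linear_0[OF linear_Rho[OF chart_J[OF J] _ triv_J[OF J] p]] e'(2) by (simp add: ch_dom)
    then show "q \<in> range (\<lambda>b. (0, ?cv (0, b)))" by blast
  next
    fix q :: "'f \<times> ('p \<times> 'f, (real^'n) \<times> (real^'m)) tvec" assume "q \<in> range (\<lambda>b. (0, ?cv (0, b)))"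
    then obtain y where q: "q = (0, ?cv (0, y))" by blast
    have "q = (tsec t 0 (fst e), ?cv (Rho c t (cmap c (fst e)) 0, y))"
      using t0[of 0] linear_0[OF linear_Rho[OF chart_J[OF J] _ triv_J[OF J] p]] e'(2) by (simp add: q ch_dom)
    then show "q \<in> {q \<in> {(tsec t b (fst e), ?cv (Rho c t (cmap c (fst e)) b, y)) |b y. True}. fst q = 0}"
      using q by auto
  qed
  show "a = 0" if "hlift s (fst j) (snd j) e a = (0, coord_vec (e_atlas D) (ch (fst j) (snd j)) e (0, b))" for a b
    using that t0[of a] by (simp add: hlift_def ct)
qed

lemma prol_coefficients_iff:
  assumes t: "t \<in> trivs D" and U: "U \<subseteq> e_slit D"
    and N: "\<And>c e a b. c \<in> base D \<Longrightarrow> e \<in> e_slit D \<Longrightarrow> e \<in> cdom (ch c t) \<Longrightarrow>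
      N c (cmap (ch c t) e) b a = (- snd (hor s c t (cmap (ch c t) e) (axis a 1))) $ b"
  shows "prol_coefficients D U H t N \<longleftrightarrow> (\<forall>c\<in>base D. \<forall>e\<in>U \<inter> cdom (ch c t). H `` {e} = range (hlift s c t e))"
  unfolding prol_coefficients_def
proof (intro ball_cong refl)
  fix c e assume c: "c \<in> base D" and e: "e \<in> U \<inter> cdom (ch c t)"
  note j = algebroid_J[OF c t]
  have e': "e \<in> e_slit D" "e \<in> cdom (ch c t)" using e U by auto
  have "prol_z D c t e a - (\<Sum>b\<in>UNIV. N c (cmap (ch c t) e) b a *\<^sub>R prol_v D c t e b) = hlift s c t e (axis a 1)" for a
    by (rule prol_frame[OF j e' N[OF c e']])
  then show "H `` {e} = span (range (\<lambda>a. prol_z D c t e a - (\<Sum>b\<in>UNIV. N c (cmap (ch c t) e) b a *\<^sub>R prol_v D c t e b)))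
      \<longleftrightarrow> H `` {e} = range (hlift s c t e)"
    by (simp only: span_range_axis[OF linear_hlift[OF j e']])
qed

lemma ex1_local_nconnection:
  assumes t: "t \<in> trivs D"
  shows "\<exists>!H. prol_nconnection D {e \<in> e_slit D. fst e \<in> fst t} H \<and>
    prol_coefficients D {e \<in> e_slit D. fst e \<in> fst t} H t (\<lambda>c. algebroid_N D l c t)"
proof -
  let ?W = "{e \<in> e_slit D. fst e \<in> fst t}"
  have "\<exists>!H. prol_nconnection D ?W H \<and>
    (\<forall>j\<in>(\<lambda>c. (c, t)) ` base D. \<forall>e\<in>?W \<inter> cdom (ch (fst j) (snd j)). H `` {e} = range (hlift 0 (fst j) (snd j) e))"
  proof (rule ex1_prol_nconnection[OF mopen_triv[OF t]])
    show "(\<lambda>c. (c, t)) ` base D \<subseteq> base D \<times> trivs D" using t by auto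
    show "\<exists>j\<in>(\<lambda>c. (c, t)) ` base D. e \<in> cdom (ch (fst j) (snd j))" if e: "e \<in> e_slit D" "fst e \<in> fst t" for e
    proof -
      obtain c where "c \<in> base D" "fst e \<in> cdom c" using e(1) unfolding e_slit_def slit_def carrier_of_def by blast
      then show ?thesis using e by (intro bexI[of _ "(c, t)"]) (auto simp: ch_dom e_slit_def slit_def)
    qed
    fix c t1 c' t2 p and b u :: "real^'m"
    assume "(c, t1) \<in> (\<lambda>c. (c, t)) ` base D" "(c', t2) \<in> (\<lambda>c. (c, t)) ` base D" and p: "p \<in> overlap c t1 c' t2"
    then have c: "c \<in> base D" "t1 = t" "t2 = t" by auto
    \<comment> \<open>For one local basis the transition map is the identity, even if the charts
      differ, so both derivative terms in the condition vanish and it holds for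
      \<open>s = 0\<close>.\<close>
    have "fd (\<lambda>x. lam c t t x w) (cmap c p) = (\<lambda>v. 0)" for w
    proof -
      have "fd (\<lambda>x. lam c t t x w) (cmap c p) = fd (\<lambda>x. w) (cmap c p)"
      proof (rule fd_cong[OF mopen_open_image[OF mopen_Int[OF mopen_cdom[OF c(1)] mopen_triv[OF t]] c(1)]])
        show "cmap c p \<in> cmap c ` (cdom c \<inter> fst t)" using p c by blast
        fix y assume "y \<in> cmap c ` (cdom c \<inter> fst t)"
        then obtain q where q: "q \<in> cdom c" "q \<in> fst t" "y = cmap c q" by blast
        show "lam c t t y w = w" unfolding q(3) lam_cmap[OF c(1) q(1)] by (rule triv_triv_section[OF t q(2)])
      qed blast
      then show ?thesis by simp
    qed
    then show "0 *\<^sub>R (lam c t1 t2 (cmap c p) (Br c t1 (cmap c p) b u)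
        - Br c' t2 (cmap c' p) (lam c t1 t2 (cmap c p) b) (lam c t1 t2 (cmap c p) u))
      = fd (\<lambda>x. lam c t1 t2 x u) (cmap c p) (Rho c t1 (cmap c p) b)
        - fd (\<lambda>x. lam c t1 t2 x b) (cmap c p) (Rho c t1 (cmap c p) u)"
      unfolding c(2,3) by simp
  qed
  moreover have "prol_coefficients D ?W H t (\<lambda>c. algebroid_N D l c t) \<longleftrightarrow>
      (\<forall>c\<in>base D. \<forall>e\<in>?W \<inter> cdom (ch c t). H `` {e} = range (hlift 0 c t e))" for H
  proof (rule prol_coefficients_iff[OF t])
    fix c e a b assume c: "c \<in> base D" and e: "e \<in> e_slit D" "e \<in> cdom (ch c t)"
    note j = algebroid_J[OF c t]
    show "algebroid_N D l c t (cmap (ch c t) e) b a = (- snd (hor 0 c t (cmap (ch c t) e) (axis a 1))) $ b"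
      by (rule algebroid_N_eq(1)[OF j in_dm[OF j e(1)[unfolded e_slit_def] e(2)]])
  qed blast
  ultimately show ?thesis by (simp only: ball_simps fst_conv snd_conv)
qed

lemma ex1_global_nconnection:
  "\<exists>!H. prol_nconnection D (e_slit D) H \<and>
    (\<forall>t\<in>trivs D. prol_coefficients D (e_slit D) H t (\<lambda>c. algebroid_N_global D l c t))"
proof -
  have W: "{e \<in> e_slit D. fst e \<in> carrier_of (base D)} = e_slit D" by (auto simp: e_slit_def slit_def)
  have "\<exists>!H. prol_nconnection D {e \<in> e_slit D. fst e \<in> carrier_of (base D)} H \<and>
    (\<forall>j\<in>base D \<times> trivs D. \<forall>e\<in>{e \<in> e_slit D. fst e \<in> carrier_of (base D)} \<inter> cdom (ch (fst j) (snd j)).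
      H `` {e} = range (hlift 1 (fst j) (snd j) e))"
  proof (rule ex1_prol_nconnection[OF mopen_carrier subset_refl])
    show "\<exists>j\<in>base D \<times> trivs D. e \<in> cdom (ch (fst j) (snd j))" if e: "e \<in> e_slit D" for e
    proof -
      obtain c t where "(c, t) \<in> base D \<times> trivs D" "e \<in> cdom (ch c t)"
        using slit_cover e unfolding e_slit_def by blast
      then show ?thesis by (intro bexI[of _ "(c, t)"]) simp_all
    qed
    \<comment> \<open>For \<open>s = 1\<close> the condition is the transformation law of the
      structure functions, rearranged.\<close>
    show "1 *\<^sub>R (lam c t t' (cmap c p) (Br c t (cmap c p) b u)
        - Br c' t' (cmap c' p) (lam c t t' (cmap c p) b) (lam c t t' (cmap c p) u))
      = fd (\<lambda>x. lam c t t' x u) (cmap c p) (Rho c t (cmap c p) b)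
        - fd (\<lambda>x. lam c t t' x b) (cmap c p) (Rho c t (cmap c p) u)"
      if "(c, t) \<in> base D \<times> trivs D" "(c', t') \<in> base D \<times> trivs D" "p \<in> overlap c t c' t'" for c t c' t' p b u
      unfolding Br_change[OF that] by simp
  qed
  moreover have "prol_coefficients D (e_slit D) H t (\<lambda>c. algebroid_N_global D l c t) \<longleftrightarrow>
      (\<forall>c\<in>base D. \<forall>e\<in>e_slit D \<inter> cdom (ch c t). H `` {e} = range (hlift 1 c t e))" if t: "t \<in> trivs D" for H t
  proof (rule prol_coefficients_iff[OF t subset_refl])
    fix c e a b assume c: "c \<in> base D" and e: "e \<in> e_slit D" "e \<in> cdom (ch c t)"
    note j = algebroid_J[OF c t]
    show "algebroid_N_global D l c t (cmap (ch c t) e) b a = (- snd (hor 1 c t (cmap (ch c t) e) (axis a 1))) $ b"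
      by (rule algebroid_N_eq(2)[OF j in_dm[OF j e(1)[unfolded e_slit_def] e(2)]])
  qed
  moreover have "(\<forall>c\<in>base D. \<forall>t\<in>trivs D. P c t) \<longleftrightarrow> (\<forall>t\<in>trivs D. \<forall>c\<in>base D. P c t)" for P by blast
  ultimately show ?thesis
    unfolding W ball_J[of "\<lambda>c t. \<forall>e\<in>e_slit D \<inter> cdom (ch c t). H `` {e} = range (hlift 1 c t e)" for H]
    by simp
qed

end

lemma lagrange_algebroid_atlas: "lagrange_algebroid D l \<Longrightarrow> lagrange_algebroid_atlas D l"
  unfolding lagrange_algebroid_def
  by (intro lagrange_algebroid_atlas.intro algebroid_atlas.intro lagrange_algebroid_atlas_axioms.intro) auto

text \<open>\<open>extensional\<close> fixes the values outside the slit bundle, so that uniqueness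
  of the semispray is meaningful for total functions; its properties are asserted for every function
  given by the local formula. For an algebroid the coefficients \<partial>G/\<partial>u describe one
  splitting over the domain of each local basis, and the corrected coefficients describe the global
  one.\<close>

theorem theorem4p3:
  fixes A :: "('p, (real^'n::finite)) chart set"
    and L :: "'p \<times> ('p, (real^'n)) tvec \<Rightarrow> real"
    and D :: "('q, 'f::real_vector, 'k::finite, 'm::finite) algebroid"
    and l :: "'q \<times> 'f \<Rightarrow> real"
  shows
    \<comment> \<open>Part (a)\<close>
    "(lagrange_space A L \<longrightarrow>
        (\<exists>!\<xi>. \<xi> \<in> extensional (slit A (tangent A)) \<and> is_xi_L A L \<xi>) \<and>
        (\<forall>\<xi>. is_xi_L A L \<xi> \<longrightarrow>
           tm_semispray A \<xi> \<and>
           (\<forall>I \<gamma>. open I \<and> is_interval I \<and>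
              differentiable_curve (tm_atlas A) (slit A (tangent A)) I \<gamma> \<longrightarrow>
              (euler_lagrange_tm A L I \<gamma> \<longleftrightarrow> integral_curve (tm_atlas A) \<xi> I \<gamma>) \<and>
              (nonlinear_geodesic_tm A L I \<gamma> \<longleftrightarrow> integral_curve (tm_atlas A) \<xi> I \<gamma>))) \<and>
        (\<exists>!H. tm_nconnection A H \<and>
              tm_coefficients A H (\<lambda>C. lagrange_N (local_rep L C))))
     \<and>
     (lagrange_algebroid D l \<longrightarrow>
        (\<exists>!S. S \<in> extensional (e_slit D) \<and> is_spray_section D l S) \<and>
        (\<forall>S. is_spray_section D l S \<longrightarrow>
           algebroid_semispray D S \<and>
           is_xi_l D l (\<lambda>e. snd (S e)) \<and>
           (\<forall>I \<gamma>. open I \<and> is_interval I \<and>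
              differentiable_curve (e_atlas D) (e_slit D) I \<gamma> \<longrightarrow>
              (euler_lagrange_algebroid D l I \<gamma> \<longleftrightarrow>
                 integral_curve (e_atlas D) (\<lambda>e. snd (S e)) I \<gamma>) \<and>
              (nonlinear_geodesic_algebroid D l I \<gamma> \<longleftrightarrow>
                 integral_curve (e_atlas D) (\<lambda>e. snd (S e)) I \<gamma>))) \<and>
        \<comment> \<open>for every local basis of sections: the splitting with coefficients dG/du\<close>
        (\<forall>t\<in>trivs D.
           \<exists>!H. prol_nconnection D {e \<in> e_slit D. fst e \<in> fst t} H \<and>
                prol_coefficients D {e \<in> e_slit D. fst e \<in> fst t} H t (\<lambda>c. algebroid_N D l c t)) \<and>
        \<comment> \<open>the canonical splitting over the whole of E minus the zero section\<close>
        (\<exists>!H. prol_nconnection D (e_slit D) H \<and>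
              (\<forall>t\<in>trivs D. prol_coefficients D (e_slit D) H t (\<lambda>c. algebroid_N_global D l c t))))"
proof (intro conjI impI)
  assume L: "lagrange_space A L"
  show "\<exists>!\<xi>. \<xi> \<in> extensional (slit A (tangent A)) \<and> is_xi_L A L \<xi>"
    by (rule ex1_spray_field[OF L])
  show "\<exists>!H. tm_nconnection A H \<and> tm_coefficients A H (\<lambda>C. lagrange_N (local_rep L C))"
    by (rule ex1_tm_nconnection[OF L])
  show "\<forall>\<xi>. is_xi_L A L \<xi> \<longrightarrow>
           tm_semispray A \<xi> \<and>
           (\<forall>I \<gamma>. open I \<and> is_interval I \<and>
              differentiable_curve (tm_atlas A) (slit A (tangent A)) I \<gamma> \<longrightarrow>
              (euler_lagrange_tm A L I \<gamma> \<longleftrightarrow> integral_curve (tm_atlas A) \<xi> I \<gamma>) \<and>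
              (nonlinear_geodesic_tm A L I \<gamma> \<longleftrightarrow> integral_curve (tm_atlas A) \<xi> I \<gamma>))"
    unfolding is_xi_L_iff[OF L]
    by (intro allI impI conjI spray_field_semispray[OF L] euler_lagrange_tm_iff[OF L]
        nonlinear_geodesic_tm_iff[OF L]; (elim conjE)?; assumption)
next
  assume "lagrange_algebroid D l"
  then interpret lagrange_algebroid_atlas D l by (rule lagrange_algebroid_atlas)
  show "\<exists>!S. S \<in> extensional (e_slit D) \<and> is_spray_section D l S"
    by (rule ex1_spray_section)
  show "\<forall>S. is_spray_section D l S \<longrightarrow>
           algebroid_semispray D S \<and>
           is_xi_l D l (\<lambda>e. snd (S e)) \<and>
           (\<forall>I \<gamma>. open I \<and> is_interval I \<and>
              differentiable_curve (e_atlas D) (e_slit D) I \<gamma> \<longrightarrow>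
              (euler_lagrange_algebroid D l I \<gamma> \<longleftrightarrow>
                 integral_curve (e_atlas D) (\<lambda>e. snd (S e)) I \<gamma>) \<and>
              (nonlinear_geodesic_algebroid D l I \<gamma> \<longleftrightarrow>
                 integral_curve (e_atlas D) (\<lambda>e. snd (S e)) I \<gamma>))"
    by (intro allI impI conjI spray_section_semispray spray_section_xi_l
        euler_lagrange_algebroid_iff nonlinear_geodesic_algebroid_iff spray_section_spray_field;
        (elim conjE)?; assumption)
  show "\<forall>t\<in>trivs D.
           \<exists>!H. prol_nconnection D {e \<in> e_slit D. fst e \<in> fst t} H \<and>
                prol_coefficients D {e \<in> e_slit D. fst e \<in> fst t} H t (\<lambda>c. algebroid_N D l c t)"
    using ex1_local_nconnection by blast
  show "\<exists>!H. prol_nconnection D (e_slit D) H \<and>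
              (\<forall>t\<in>trivs D. prol_coefficients D (e_slit D) H t (\<lambda>c. algebroid_N_global D l c t))"
    by (rule ex1_global_nconnection)
qed

end
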